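(* Let $\gamma>0$, let $\mu\in\mathcal{M}_{\gamma/8}$, and let $\xi,\zeta\in L^\infty(\mathbf{\Delta})$ (bounded measurable functions on $\mathbf{\Delta}$). Then $$\left|\int_{\mathbf{\Delta}}(P^t\zeta)(\mathbf{x})\,\xi(\mathbf{x})\,\mu(d\mathbf{x})-\int_{\mathbf{\Delta}}(P^t\zeta)(\mathbf{x})\,\mu(d\mathbf{x})\int_{\mathbf{\Delta}}\xi(\mathbf{x})\,\mu(d\mathbf{x})\right|=o\!\left(\frac{1}{t^{2-\gamma}}\right)$$ as $t\to\infty$.
   Context: Fix a positive integer $m$ and a constant $\bar E>0$. Superscripts are indices, not powers, on the coordinates $x^i$. The state space is the open simplex $$\mathbf{\Delta}=\Big\{(x^{1},\dots,x^{m},y)\in\mathbb{R}^{m+1}_{+}\ :\ y+\sum_{i=1}^{m}x^{i}=\bar E\Big\},$$ (all coordinates strictly positive). The process $\mathbf{x}_t=(x^1_t,\dots,x^m_t,y_t)$, $t\ge 0$, is the time-homogeneous Markov jump process on $\mathbf{\Delta}$ defined as follows: $x^i_t$ is the energy of particle $i$ and $y_t$ the energy of a tank. Particle $i$ carries a clock that rings at exponential rate $\sqrt{x^i_t}$ (the rate changes whenever $x^i_t$ changes); the clocks are independent of one another and of history. When the clock of particle $i$ rings at time $t$, the state immediately after is $$x^i_{t^+}=y_t+(1-u^2)x^i_t,\qquad y_{t^+}=u^2x^i_t,\qquad x^j_{t^+}=x^j_t\ \ (j\ne i),$$ where $u$ is a random variable uniform on $(0,1)$, drawn independently at each ring. $P^t(\mathbf{x},\cdot)$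 denotes the transition probabilities of $\mathbf{x}_t$, and for a measurable function $\zeta$ on $\mathbf{\Delta}$, $(P^t\zeta)(\mathbf{x})=\int_{\mathbf{\Delta}}P^t(\mathbf{x},d\mathbf{y})\,\zeta(\mathbf{y})$. For $\delta>0$, $\mathcal{M}_\delta$ is the collection of Borel probability measures $\mu$ on $\mathbf{\Delta}$ such that $$\int_{\mathbf{\Delta}}\Big(\sum_{k=1}^m (x^k)^{2\delta-1}+y^{\delta-\frac12}\Big)\,\mu(d\mathbf{x})<\infty .$$ *)

theory Defs
  imports "HOL-Probability.Probability"
begin

type_synonym 'm state = "(real ^ 'm) \<times> real"

definition energy_simplex :: "real \<Rightarrow> 'm::finite state set" where
  "energy_simplex E = {(x, y). (\<forall>i. 0 < x $ i) \<and> 0 < y \<and> y + (\<Sum>i\<in>UNIV. x $ i) = E}"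

definition state_space :: "real \<Rightarrow> 'm::finite state measure" where
  "state_space E = restrict_space borel (energy_simplex E)"

definition exchange :: "'m::finite \<Rightarrow> real \<Rightarrow> 'm state \<Rightarrow> 'm state" where
  "exchange i u = (\<lambda>(x, y).
     (\<chi> j. if j = i then y + (1 - u\<^sup>2) * x $ i else x $ j, u\<^sup>2 * x $ i))"

text \<open>
  The noise consumed by one jump: a family of i.i.d. standard exponential variables
  \<open>e i\<close>, one for each particle, and an independent \<open>u\<close> uniform on \<open>(0,1)\<close>.
  In the state \<open>(x, y)\<close> the variable \<open>e i / sqrt (x $ i)\<close> is exponential with rate
  \<open>sqrt (x $ i)\<close> and is the time until the clock of particle \<open>i\<close> rings.
  By the memoryless property of the exponential distribution, all clocks may be
  redrawn after every ring.
\<close>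

definition jump_noise :: "(('m::finite \<Rightarrow> real) \<times> real) measure" where
  "jump_noise =
     (\<Pi>\<^sub>M i\<in>UNIV. density lborel (\<lambda>s. ennreal (exponential_density 1 s)))
       \<Otimes>\<^sub>M restrict_space lborel {0<..<1}"

definition noise_space :: "(('m::finite \<Rightarrow> real) \<times> real) stream measure" where
  "noise_space = stream_space jump_noise"

definition clock :: "'m::finite state \<Rightarrow> ('m \<Rightarrow> real) \<Rightarrow> 'm \<Rightarrow> real" where
  "clock z e i = e i / sqrt (fst z $ i)"

definition waiting_time :: "'m::finite state \<Rightarrow> ('m \<Rightarrow> real) \<Rightarrow> real" where
  "waiting_time z e = Min (range (clock z e))"

text \<open>Ties between clocks have probability zero; \<^const>\<open>arg_min\<close> breaks them arbitrarily.\<close>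

definition ringing :: "'m::finite state \<Rightarrow> ('m \<Rightarrow> real) \<Rightarrow> 'm" where
  "ringing z e = arg_min (clock z e) (\<lambda>_. True)"

primrec post_jump ::
  "'m::finite state \<Rightarrow> (('m \<Rightarrow> real) \<times> real) stream \<Rightarrow> nat \<Rightarrow> 'm state" where
  "post_jump z \<omega> 0 = z"
| "post_jump z \<omega> (Suc n) =
     exchange (ringing (post_jump z \<omega> n) (fst (\<omega> !! n))) (snd (\<omega> !! n)) (post_jump z \<omega> n)"

definition jump_time ::
  "'m::finite state \<Rightarrow> (('m \<Rightarrow> real) \<times> real) stream \<Rightarrow> nat \<Rightarrow> real" where
  "jump_time z \<omega> n = (\<Sum>k<n. waiting_time (post_jump z \<omega> k) (fst (\<omega> !! k)))"

text \<open>
  The path started at \<open>z\<close>. The total rate is bounded on the simplex, so almost surely the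
  jump times tend to infinity and the least index below exists.
\<close>

definition process ::
  "'m::finite state \<Rightarrow> (('m \<Rightarrow> real) \<times> real) stream \<Rightarrow> real \<Rightarrow> 'm state" where
  "process z \<omega> t = post_jump z \<omega> (LEAST n. t < jump_time z \<omega> (Suc n))"

definition transition :: "real \<Rightarrow> real \<Rightarrow> 'm::finite state \<Rightarrow> 'm state measure" where
  "transition E t z = distr noise_space (state_space E) (\<lambda>\<omega>. process z \<omega> t)"

definition semigroup_op ::
  "real \<Rightarrow> real \<Rightarrow> ('m::finite state \<Rightarrow> real) \<Rightarrow> 'm state \<Rightarrow> real" where
  "semigroup_op E t \<zeta> z = (\<integral>w. \<zeta> w \<partial>transition E t z)"

definition moment_class :: "real \<Rightarrow> real \<Rightarrow> 'm::finite state measure set" where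
  "moment_class E \<delta> = {\<mu>. sets \<mu> = sets (state_space E) \<and> prob_space \<mu> \<and>
     (\<integral>\<^sup>+ (x, y). ennreal ((\<Sum>k\<in>UNIV. (x $ k) powr (2 * \<delta> - 1)) + y powr (\<delta> - 1 / 2)) \<partial>\<mu>) < \<infinity>}"

definition bounded_measurable :: "real \<Rightarrow> ('m::finite state \<Rightarrow> real) set" where
  "bounded_measurable E =
     {f. f \<in> borel_measurable (state_space E) \<and> bounded (f ` energy_simplex E)}"

end

theory Submission
  imports Defs
begin

text \<open>
  Write \<open>P\<close> for the semigroup, \<open>m\<close> for the number of particles and \<open>V\<close> for the integrand
  \<open>(\<Sum>k. x k powr (2 * \<delta> - 1)) + y powr (\<delta> - 1 / 2)\<close> of the moment condition.  The only obstacle to fast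
  mixing is a particle of small energy \<open>x\<close>, which waits a time of order \<open>1 / sqrt x\<close> for its next ring;
  \<open>V\<close> is large at states that contain such particles.

  The covariance of \<open>P t \<zeta>\<close> and \<open>\<xi>\<close> under \<open>\<mu>\<close> is at most twice the supremum of \<open>\<bar>\<xi>\<bar>\<close> times
  \<open>\<integral>z. \<bar>P t \<zeta> z - P t \<zeta> z0\<bar> \<partial>\<mu>\<close> for any fixed state \<open>z0\<close>, so it is enough to compare two
  starting points.  The total jump rate is bounded by \<open>\<Lambda> = m * sqrt E\<close>.  Hence \<open>P t\<close> is the average of the
  powers of a discrete kernel \<open>K\<close> over a Poisson variable of parameter \<open>\<Lambda> * t\<close>
  (\<open>semigroup_op_eq_uniformised\<close>); \<open>K\<close> rings particle \<open>i\<close> with probability \<open>sqrt (x i) / \<Lambda>\<close> and rests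
  otherwise.  Both sides of this identity obey the same first-jump equation, which is a contraction on bounded
  time intervals.  Since the Poisson mean of \<open>(n + 1) powr - p\<close> is of order \<open>t powr - p\<close> for \<open>p \<le> 2\<close>, it remains to
  bound \<open>(K ^^ n) \<zeta> z - (K ^^ n) \<zeta> z'\<close> by a multiple of \<open>(1 + V z + V z') * n powr - p\<close> with
  \<open>p = 2 - 4 * \<delta>\<close>.  Two properties of \<open>K\<close> give this.

  The first is the drift \<open>K V \<le> V - c * V powr (1 - 1 / p) + b\<close> (\<open>weight_drift\<close>).  A particle of energy \<open>x\<close>
  rings at rate \<open>sqrt x\<close> and then loses a fixed fraction of its term \<open>x powr (2 * \<delta> - 1)\<close>, unless the tank is
  nearly as empty as the particle.  In that case the tank term pays: whenever the tank is poor, some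
  particle has energy of order one and refills it at a rate bounded below.

  The second is an overlap of distributions (\<open>skeleton_overlap\<close>).  For states with \<open>V \<le> d\<close> all particle
  energies are bounded below, and \<open>2 * m - 1\<close> rings in a prescribed order bring any two such states to the same
  random state with a probability bounded below.  The number of rings does not depend on \<open>d\<close>.

  Through drift and overlap, \<open>V z + V z'\<close> behaves along a pair of states like the solution of
  \<open>v' = - v powr (1 - 1 / p)\<close>, which reaches \<open>0\<close> at a time of order \<open>v powr (1 / p)\<close>.  The oscillation that is left
  after \<open>n\<close> steps is therefore of order \<open>(1 + V z + V z') / n powr p\<close> (\<open>weighted_oscillation_decay\<close>).  This is a
  coupling argument in dual form: positive operators act on affine bounds in \<open>V\<close>, and no joint process is built.

  For \<open>\<gamma> < 2\<close> the choice \<open>\<delta> = \<gamma> / 8\<close> gives \<open>p = 2 - \<gamma> / 2\<close>, and the spare factor \<open>t powr - (\<gamma> / 2)\<close> turns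
  the bound into a small-o.  For \<open>\<gamma> \<ge> 2\<close> the integral only has to tend to \<open>0\<close>; this follows from pointwise
  convergence, with any \<open>\<delta> < 1 / 4\<close>, by dominated convergence.
\<close>

section \<open>Real powers\<close>

lemma powr_add_subadditive:
  fixes x y r :: real
  assumes "0 \<le> x" "0 \<le> y" "0 < r" "r \<le> 1"
  shows "(x + y) powr r \<le> x powr r + y powr r"
proof (cases "x + y = 0")
  case True
  then show ?thesis using assms by auto
next
  case False
  then have s: "x + y > 0" using assms by auto
  have ge: "(x + y) powr r * (w / (x + y)) \<le> w powr r" if "0 \<le> w" "w \<le> x + y" for w
  proof -
    have q: "0 \<le> w / (x + y)" "w / (x + y) \<le> 1" using that s by auto
    have "w / (x + y) \<le> (w / (x + y)) powr r"
      using powr_mono'[of r 1 "w / (x + y)"] q assms that(1) by simp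
    then have "(x + y) powr r * (w / (x + y)) \<le> (x + y) powr r * (w / (x + y)) powr r"
      by (intro mult_left_mono) auto
    also have "\<dots> = w powr r"
      using powr_mult[of "x + y" "w / (x + y)" r] q s by simp
    finally show ?thesis .
  qed
  have "(x + y) powr r = (x + y) powr r * (x / (x + y)) + (x + y) powr r * (y / (x + y))"
    using s by (simp add: distrib_left[symmetric] add_divide_distrib[symmetric])
  also have "\<dots> \<le> x powr r + y powr r"
    using ge[of x] ge[of y] assms by (intro add_mono) auto
  finally show ?thesis .
qed

lemma powr_sum_subadditive:
  fixes f :: "'i \<Rightarrow> real"
  assumes "finite I" "\<And>i. i \<in> I \<Longrightarrow> 0 \<le> f i" "0 < r" "r \<le> 1"
  shows "(\<Sum>i\<in>I. f i) powr r \<le> (\<Sum>i\<in>I. f i powr r)"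
  using assms
proof (induction I rule: finite_induct)
  case (insert i I)
  have "(f i + (\<Sum>i\<in>I. f i)) powr r \<le> f i powr r + (\<Sum>i\<in>I. f i) powr r"
    using insert by (intro powr_add_subadditive sum_nonneg) auto
  then show ?case using insert by fastforce
qed simp

lemma powr_ge_tangent:
  fixes p s h :: real
  assumes p: "1 \<le> p" and h: "0 \<le> h" "h < s"
  shows "s powr p - p * h * s powr (p - 1) \<le> (s - h) powr p"
proof -
  have "(s - h) powr p - s powr p \<ge> (p * s powr (p - 1)) * ((s - h) - s)"
  proof (rule convex_on_imp_above_tangent[OF powr_convex[OF p]])
    have "s > 0" using h by simp
    then have "((\<lambda>x. x powr p) has_real_derivative p * s powr (p - 1)) (at s)"
      by (rule has_real_derivative_powr)
    then show "((\<lambda>x. x powr p) has_real_derivative p * s powr (p - 1)) (at s within {0<..})"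
      by (rule has_field_derivative_at_within)
  qed (use h in \<open>auto simp: interior_open\<close>)
  then show ?thesis by (simp add: algebra_simps)
qed

text \<open>
  The right-hand side is the tangent at \<open>s powr p\<close> of the concave function
  \<open>v \<mapsto> (v powr (1 / p) + a) powr p\<close>.  With \<open>r = v powr (1 / p)\<close> the claim becomes the convexity of
  \<open>x \<mapsto> x powr p\<close> at \<open>(r + a) / (s + a)\<close>, which is a convex combination of \<open>r / s\<close> and \<open>1\<close>.
\<close>

lemma powr_shift_le_tangent:
  fixes p s v a :: real
  assumes p: "1 \<le> p" and s: "0 < s" and v: "0 < v" and a: "0 \<le> a"
  shows "(v powr (1 / p) + a) powr p \<le> (s + a) powr (p - 1) * (s powr (1 - p) * v + a)"
proof -
  define r where "r = v powr (1 / p)"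
  have r: "0 < r" "r powr p = v" using v p by (auto simp: r_def powr_powr)
  define q where "q = s / (s + a)"
  have q: "0 \<le> q" "q \<le> 1" using s a by (auto simp: q_def)
  have sa: "s + a > 0" using s a by auto
  have 1: "(q * (r / s) + (1 - q) * 1) powr p \<le> q * (r / s) powr p + (1 - q) * 1 powr p"
    using convex_onD[OF powr_convex[OF p], of "1 - q" "r / s" 1] q r s by simp
  have 2: "q * (r / s) + (1 - q) * 1 = (r + a) / (s + a)"
  proof -
    have "q * (r / s) = r / (s + a)" "1 - q = a / (s + a)"
      using s sa by (auto simp: q_def diff_divide_distrib[symmetric] field_simps)
    then show ?thesis by (simp add: add_divide_distrib)
  qed
  have 3: "(r + a) powr p = (s + a) powr p * ((r + a) / (s + a)) powr p"
    using powr_mult[of "s + a" "(r + a) / (s + a)" p] sa r a by simp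
  have 4: "(s + a) powr p = (s + a) powr (p - 1) * (s + a)"
    using sa powr_add[of "s + a" "p - 1" 1] by simp
  have 5: "(r / s) powr p = v * s powr (- p)"
    using r s by (simp add: powr_divide powr_minus field_simps)
  have 6: "s powr (1 - p) = s * s powr (- p)"
    using s powr_add[of s 1 "- p"] by simp
  have "(r + a) powr p \<le> (s + a) powr p * (q * (r / s) powr p + (1 - q))"
    using 1 unfolding 2 3 by (intro mult_left_mono) auto
  also have "\<dots> = (s + a) powr (p - 1) * ((s + a) * q * (v * s powr (- p)) + (s + a) * (1 - q))"
    unfolding 4 5 by (simp add: algebra_simps)
  also have "(s + a) * q = s" using sa by (simp add: q_def)
  also have "(s + a) * (1 - q) = a" using sa by (simp add: q_def field_simps)
  finally show ?thesis unfolding 6 r_def by (simp add: mult_ac)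
qed

section \<open>Contraction of weighted oscillations\<close>

text \<open>
  Affine bounds in \<open>V\<close> are the ones that can be pushed through a positive operator with control of its
  value at \<open>V\<close> only.
\<close>

definition osc_bounded :: "'a set \<Rightarrow> ('a \<Rightarrow> real) \<Rightarrow> real \<Rightarrow> real \<Rightarrow> ('a \<Rightarrow> real) \<Rightarrow> bool" where
  "osc_bounded S V a0 a1 g \<longleftrightarrow> (\<forall>w\<in>S. \<forall>w'\<in>S. \<bar>g w - g w'\<bar> \<le> a0 + a1 * (V w + V w'))"

text \<open>
  Here \<open>W\<close> stands for \<open>R V\<close>.  The hypothesis \<open>far\<close> expresses positivity of \<open>R\<close>, and \<open>near\<close> adds that
  where \<open>V\<close> is small the constant part of the bound shrinks by a factor \<open>1 - \<epsilon>\<close>.  For a suitable constant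
  \<open>A\<close>, one step replaces \<open>u = A + V z + V z'\<close> by at most \<open>u - c' * u powr (1 - 1 / p)\<close>: if \<open>V z\<close> or \<open>V z'\<close> is
  large this is the drift, otherwise the gain \<open>\<epsilon> * A\<close> outweighs \<open>b\<close>.

  Bounds by a concave function of \<open>u\<close> pass through \<open>R\<close> by means of their tangents.  The functions
  \<open>(u powr (1 / p) + h * (n - k)) powr p\<close> are concave in \<open>u\<close> and the step maps the one for \<open>k\<close> below the one for
  \<open>k + 1\<close>.  For \<open>k = 0\<close> the value is at least \<open>(h * n) powr p\<close>, for \<open>k = n\<close> it is \<open>u\<close>; the quotient is the rate.
\<close>

lemma weighted_oscillation_decay:
  fixes R :: "('a \<Rightarrow> real) \<Rightarrow> 'a \<Rightarrow> real" and V W :: "'a \<Rightarrow> real"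
  assumes p: "1 < p" and c: "0 < c" and b: "0 < b"
    and V: "\<And>z. z \<in> S \<Longrightarrow> 0 \<le> V z"
    and stable: "\<And>g. B g \<Longrightarrow> B (R g)"
    and drift: "\<And>z. z \<in> S \<Longrightarrow> W z \<le> V z - c * V z powr (1 - 1 / p) + b"
    and far: "\<And>g a0 a1 z z'. B g \<Longrightarrow> 0 \<le> a0 \<Longrightarrow> 0 \<le> a1 \<Longrightarrow> osc_bounded S V a0 a1 g \<Longrightarrow>
        z \<in> S \<Longrightarrow> z' \<in> S \<Longrightarrow> \<bar>R g z - R g z'\<bar> \<le> a0 + a1 * (W z + W z')"
    and near: "\<And>d. \<exists>\<epsilon>>0. \<forall>g a0 a1 z z'. B g \<longrightarrow> 0 \<le> a0 \<longrightarrow> 0 \<le> a1 \<longrightarrow> osc_bounded S V a0 a1 g \<longrightarrow>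
        z \<in> S \<longrightarrow> z' \<in> S \<longrightarrow> V z \<le> d \<longrightarrow> V z' \<le> d \<longrightarrow>
        \<bar>R g z - R g z'\<bar> \<le> (1 - \<epsilon>) * a0 + a1 * (W z + W z')"
  shows "\<exists>C\<ge>0. \<forall>f M n z z'. B f \<longrightarrow> (\<forall>w\<in>S. \<bar>f w\<bar> \<le> M) \<longrightarrow> 0 < n \<longrightarrow> z \<in> S \<longrightarrow> z' \<in> S \<longrightarrow>
        \<bar>(R ^^ n) f z - (R ^^ n) f z'\<bar> \<le> M * C * (1 + V z + V z') / real n powr p"
proof -
  define \<alpha> where "\<alpha> = 1 - 1 / p"
  have \<alpha>: "0 < \<alpha>" "\<alpha> \<le> 1" using p by (auto simp: \<alpha>_def)
  \<comment> \<open>Outside \<open>V \<le> d\<close> at least half of the drift survives the two constants \<open>b\<close>.\<close>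
  define d where "d = (4 * b / c) powr (1 / \<alpha>)"
  have d: "0 < d" "c * d powr \<alpha> = 4 * b"
    using b c \<alpha> by (auto simp: d_def powr_powr)
  obtain \<epsilon> where \<epsilon>: "0 < \<epsilon>" and near_d: "\<forall>g a0 a1 z z'. B g \<longrightarrow> 0 \<le> a0 \<longrightarrow> 0 \<le> a1 \<longrightarrow> osc_bounded S V a0 a1 g \<longrightarrow>
        z \<in> S \<longrightarrow> z' \<in> S \<longrightarrow> V z \<le> d \<longrightarrow> V z' \<le> d \<longrightarrow>
        \<bar>R g z - R g z'\<bar> \<le> (1 - \<epsilon>) * a0 + a1 * (W z + W z')"
    using near[of d] by (elim exE conjE)
  define A where "A = max 1 (4 * b / \<epsilon>)"
  have A: "1 \<le> A" "4 * b \<le> \<epsilon> * A"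
    using \<epsilon> by (auto simp: A_def max_def field_simps)
  \<comment> \<open>The loss \<open>c' * A\<close> caused by the constant part must stay below \<open>b\<close>.\<close>
  define c' where "c' = min 1 (min (c / 4) (b / A))"
  have c': "0 < c'" "c' \<le> 1" "c' \<le> c / 4" "c' * A \<le> b"
  proof -
    show "0 < c'" "c' \<le> 1" "c' \<le> c / 4"
      unfolding c'_def using A b c by (simp, linarith, linarith)
    have "c' \<le> b / A" by (simp add: c'_def)
    then show "c' * A \<le> b" using A by (simp add: pos_le_divide_eq)
  qed
  define h where "h = c' / p"
  have h: "0 < h" using c'(1) p by (simp add: h_def)
  have h1: "h < 1" using c'(2) p by (simp add: h_def pos_divide_less_eq)
  define U where "U z z' = A + V z + V z'" for z z'
  have U1: "1 \<le> U z z'" if "z \<in> S" "z' \<in> S" for z z'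
    using V[OF that(1)] V[OF that(2)] A by (simp add: U_def)
  have power_U: "U z z' powr \<alpha> \<le> A + (V z powr \<alpha> + V z' powr \<alpha>)" if "z \<in> S" "z' \<in> S" for z z'
  proof -
    have "U z z' powr \<alpha> \<le> (A + V z) powr \<alpha> + V z' powr \<alpha>"
      unfolding U_def using V[OF that(1)] V[OF that(2)] A \<alpha> by (intro powr_add_subadditive) auto
    also have "(A + V z) powr \<alpha> \<le> A powr \<alpha> + V z powr \<alpha>"
      using V[OF that(1)] A \<alpha> by (intro powr_add_subadditive) auto
    also have "A powr \<alpha> \<le> A"
      using powr_mono[of \<alpha> 1 A] A \<alpha> by simp
    finally show ?thesis by simp
  qed
  have one_step: "\<bar>R g z - R g z'\<bar> \<le> a0 + a1 * (U z z' - c' * U z z' powr \<alpha>)"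
    if g: "B g" and a: "0 \<le> a0" "0 \<le> a1" and z: "z \<in> S" "z' \<in> S"
      and osc: "\<And>w w'. w \<in> S \<Longrightarrow> w' \<in> S \<Longrightarrow> \<bar>g w - g w'\<bar> \<le> a0 + a1 * U w w'" for g a0 a1 z z'
  proof -
    define X where "X = V z powr \<alpha> + V z' powr \<alpha>"
    have X: "0 \<le> X" by (simp add: X_def)
    have "c' * U z z' powr \<alpha> \<le> c' * (A + X)"
      unfolding X_def using power_U[OF z] c' by (intro mult_left_mono) auto
    also have "\<dots> \<le> b + c / 4 * X"
      using c' mult_right_mono[OF c'(3) X] unfolding distrib_left by linarith
    finally have loss: "c' * U z z' powr \<alpha> \<le> b + c / 4 * X" .
    have W2: "W z + W z' \<le> V z + V z' - c * X + 2 * b"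
      using drift[OF z(1)] drift[OF z(2)] unfolding X_def \<alpha>_def[symmetric] distrib_left by linarith
    have osc': "osc_bounded S V (a0 + a1 * A) a1 g"
      unfolding osc_bounded_def using osc by (simp add: U_def algebra_simps)
    have a0': "0 \<le> a0 + a1 * A" using a A by auto
    show ?thesis
    proof (cases "V z \<le> d \<and> V z' \<le> d")
      case True
      have "\<bar>R g z - R g z'\<bar> \<le> (1 - \<epsilon>) * (a0 + a1 * A) + a1 * (W z + W z')"
        using True by (intro near_d[rule_format, OF g a0' a(2) osc' z]) auto
      also have "\<dots> \<le> a0 + a1 * ((1 - \<epsilon>) * A + (W z + W z'))"
        using a \<epsilon> by (simp add: algebra_simps)
      also have "(1 - \<epsilon>) * A + (W z + W z') \<le> U z z' - c' * U z z' powr \<alpha>"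
      proof -
        have "0 \<le> c * X" using c X by simp
        then show ?thesis using W2 loss A b unfolding U_def by (simp add: algebra_simps)
      qed
      finally show ?thesis using a by (simp add: mult_left_mono)
    next
      case False
      then have "d powr \<alpha> \<le> V z powr \<alpha> \<or> d powr \<alpha> \<le> V z' powr \<alpha>"
        using d \<alpha> by (auto intro!: powr_mono2)
      then have "d powr \<alpha> \<le> X" by (auto simp: X_def add_increasing add_increasing2)
      then have "c * d powr \<alpha> \<le> c * X" using c by simp
      then have big: "4 * b \<le> c * X" using d by simp
      have "\<bar>R g z - R g z'\<bar> \<le> (a0 + a1 * A) + a1 * (W z + W z')"
        by (intro far[OF g a0' a(2) osc' z])
      also have "\<dots> = a0 + a1 * (A + (W z + W z'))" by (simp add: algebra_simps)
      also have "A + (W z + W z') \<le> U z z' - c' * U z z' powr \<alpha>"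
        using W2 loss big unfolding U_def by (simp add: algebra_simps)
      finally show ?thesis using a by (simp add: mult_left_mono)
    qed
  qed
  define \<Phi> where "\<Phi> n k u = (u powr (1 / p) + h * (real n - real k)) powr p / (h * real n) powr p"
    for n k :: nat and u :: real
  have main: "\<forall>z\<in>S. \<forall>z'\<in>S. \<bar>(R ^^ k) f z - (R ^^ k) f z'\<bar> \<le> 2 * M * \<Phi> n k (U z z')"
    if f: "B f" "\<And>w. w \<in> S \<Longrightarrow> \<bar>f w\<bar> \<le> M" and n: "0 < n" and k: "k \<le> n" and M: "0 \<le> M" for f M n k
    using k
  proof (induction k)
    case 0
    show ?case
    proof (intro ballI)
      fix z z' assume z: "z \<in> S" "z' \<in> S"
      have "\<Phi> n 0 (U z z') \<ge> 1"
        unfolding \<Phi>_def using h n p by (simp add: powr_mono2)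
      then have "2 * M * 1 \<le> 2 * M * \<Phi> n 0 (U z z')" using M by (intro mult_left_mono) auto
      then show "\<bar>(R ^^ 0) f z - (R ^^ 0) f z'\<bar> \<le> 2 * M * \<Phi> n 0 (U z z')"
        using f(2)[OF z(1)] f(2)[OF z(2)] by simp
    qed
  next
    case (Suc k)
    have stab: "B ((R ^^ j) f)" for j by (induction j) (auto simp: f stable)
    define g where "g = (R ^^ k) f"
    define a where "a = h * (real n - real k)"
    have a: "h \<le> a"
    proof -
      have "1 \<le> real n - real k" using Suc.prems by linarith
      then show ?thesis using h mult_left_mono[of 1 "real n - real k" h] by (simp add: a_def)
    qed
    have a0: "0 \<le> a" using a h by linarith
    define D where "D = 2 * M / (h * real n) powr p"
    have D: "0 \<le> D" using M by (simp add: D_def)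
    have IH: "\<bar>g w - g w'\<bar> \<le> D * (U w w' powr (1 / p) + a) powr p" if "w \<in> S" "w' \<in> S" for w w'
      using Suc that unfolding g_def D_def \<Phi>_def a_def by simp
    show ?case
    proof (intro ballI)
      fix z z' assume z: "z \<in> S" "z' \<in> S"
      define u where "u = U z z'"
      define s where "s = u powr (1 / p)"
      have u: "1 \<le> u" using U1[OF z] by (simp add: u_def)
      have s: "1 \<le> s" "s powr p = u" using u p by (auto simp: s_def powr_powr ge_one_powr_ge_zero)
      have u\<alpha>: "u powr \<alpha> = s powr (p - 1)"
        using p u by (simp add: s_def powr_powr \<alpha>_def field_simps)
      define T where "T = (s + a) powr (p - 1)"
      have T: "0 \<le> T" by (simp add: T_def)
      have "\<bar>R g z - R g z'\<bar> \<le> D * T * a + D * T * s powr (1 - p) * (U z z' - c' * U z z' powr \<alpha>)"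
      proof (rule one_step)
        show "B g" unfolding g_def by (rule stab)
        fix w w' assume w: "w \<in> S" "w' \<in> S"
        have "(U w w' powr (1 / p) + a) powr p \<le> T * (s powr (1 - p) * U w w' + a)"
          unfolding T_def using p s a0 U1[OF w] by (intro powr_shift_le_tangent) auto
        then have "D * (U w w' powr (1 / p) + a) powr p \<le> D * (T * (s powr (1 - p) * U w w' + a))"
          using D by (intro mult_left_mono) auto
        then show "\<bar>g w - g w'\<bar> \<le> D * T * a + D * T * s powr (1 - p) * U w w'"
          using IH[OF w] by (simp add: algebra_simps)
      qed (use D T a0 z in auto)
      \<comment> \<open>The tangent at \<open>u\<close> is evaluated at \<open>u - c' * u powr \<alpha>\<close>.\<close>
      also have "\<dots> = D * (T * (a + s powr (1 - p) * u - c' * (s powr (1 - p) * s powr (p - 1))))"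
        unfolding u_def[symmetric] u\<alpha> by (simp add: algebra_simps)
      also have "s powr (1 - p) * s powr (p - 1) = 1"
        using s by (simp add: powr_add[symmetric])
      also have "s powr (1 - p) * u = s"
        using s powr_add[of s "1 - p" p] by simp
      also have "T * (a + s - c' * 1) = (s + a) powr p - p * h * (s + a) powr (p - 1)"
      proof -
        have "T * (s + a) = (s + a) powr p"
          using s a0 powr_add[of "s + a" "p - 1" 1] by (simp add: T_def)
        moreover have "p * h = c'" using p by (simp add: h_def)
        ultimately show ?thesis by (simp add: T_def algebra_simps)
      qed
      also have "\<dots> \<le> (s + a - h) powr p"
        using p h h1 s a0 by (intro powr_ge_tangent) auto
      also have "D * (s + a - h) powr p = 2 * M * \<Phi> n (Suc k) (U z z')"
        by (simp add: D_def \<Phi>_def s_def u_def a_def algebra_simps)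
      finally show "\<bar>(R ^^ Suc k) f z - (R ^^ Suc k) f z'\<bar> \<le> 2 * M * \<Phi> n (Suc k) (U z z')"
        using D by (simp add: g_def mult_left_mono)
    qed
  qed
  define C where "C = 2 * A / h powr p"
  have C: "0 \<le> C" using A by (simp add: C_def)
  have bound: "\<bar>(R ^^ n) f z - (R ^^ n) f z'\<bar> \<le> M * C * (1 + V z + V z') / real n powr p"
    if f: "B f" "\<forall>w\<in>S. \<bar>f w\<bar> \<le> M" and n: "0 < n" and z: "z \<in> S" "z' \<in> S" for f M n z z'
  proof -
    have M: "0 \<le> M" using f(2) z by force
    have "\<bar>(R ^^ n) f z - (R ^^ n) f z'\<bar> \<le> 2 * M * \<Phi> n n (U z z')"
      using main[OF f(1) _ n order_refl M] f(2) z by blast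
    also have "\<Phi> n n (U z z') = U z z' / (h powr p * real n powr p)"
      using U1[OF z] p h by (simp add: \<Phi>_def powr_powr powr_mult)
    also have "2 * M * (U z z' / (h powr p * real n powr p)) = M * (2 * U z z' / h powr p) / real n powr p"
      by (simp add: field_simps)
    also have "\<dots> \<le> M * (C * (1 + V z + V z')) / real n powr p"
    proof -
      have "U z z' \<le> A * (1 + V z + V z')"
        using A V[OF z(1)] V[OF z(2)] mult_right_mono[of 1 A "V z + V z'"] by (simp add: U_def algebra_simps)
      then have "2 * U z z' / h powr p \<le> C * (1 + V z + V z')"
        using h by (simp add: C_def field_simps)
      then show ?thesis using M by (intro divide_right_mono mult_left_mono) auto
    qed
    finally show ?thesis by (simp add: mult_ac)
  qed
  show ?thesis
    by (intro exI[of _ C] conjI allI impI C) (rule bound)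
qed


section \<open>The exchange map on the simplex\<close>

abbreviation uniform01 :: "real measure" where
  "uniform01 \<equiv> restrict_space lborel {0<..<1}"

lemma prob_space_uniform01: "prob_space uniform01"
  by (rule prob_spaceI) (simp add: emeasure_restrict_space)

interpretation uniform01: prob_space uniform01
  by (rule prob_space_uniform01)

lemma space_state_space [simp]: "space (state_space E) = energy_simplex E"
  by (simp add: state_space_def space_restrict_space)

lemma fst_exchange: "fst (exchange i u z) $ j =
    (if j = i then snd z + (1 - u\<^sup>2) * fst z $ i else fst z $ j)"
  by (simp add: exchange_def split: prod.splits)

lemma snd_exchange: "snd (exchange i u z) = u\<^sup>2 * fst z $ i"
  by (simp add: exchange_def split: prod.splits)

lemma mem_energy_simplex: "z \<in> energy_simplex E \<longleftrightarrow>
    (\<forall>i. 0 < fst z $ i) \<and> 0 < snd z \<and> snd z + (\<Sum>i\<in>UNIV. fst z $ i) = E"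
  by (auto simp: energy_simplex_def)

lemma sum_replace_one:
  fixes f :: "'m::finite \<Rightarrow> real"
  shows "(\<Sum>j\<in>UNIV. if j = i then a else f j) = (\<Sum>j\<in>UNIV. f j) - f i + a"
proof -
  have "(\<Sum>j\<in>UNIV. if j = i then a else f j) = a + (\<Sum>j\<in>UNIV - {i}. if j = i then a else f j)"
    by (subst sum.remove[of UNIV i]) auto
  also have "(\<Sum>j\<in>UNIV - {i}. if j = i then a else f j) = (\<Sum>j\<in>UNIV - {i}. f j)"
    by (intro sum.cong) auto
  also have "\<dots> = (\<Sum>j\<in>UNIV. f j) - f i"
    by (simp add: sum_diff1)
  finally show ?thesis by simp
qed

lemma exchange_in_simplex:
  assumes "z \<in> energy_simplex E" "0 < u" "u < 1"
  shows "exchange i u z \<in> energy_simplex E"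
proof -
  have u: "0 < u\<^sup>2" "u\<^sup>2 < 1" using assms by (auto simp: power_less_one_iff)
  have "0 < snd z + (1 - u\<^sup>2) * fst z $ i"
    using u assms(1) by (intro add_pos_pos mult_pos_pos) (auto simp: mem_energy_simplex)
  then show ?thesis
    using assms(1) u unfolding mem_energy_simplex fst_exchange snd_exchange sum_replace_one
    by (auto simp: algebra_simps)
qed

lemma energy_simplex_bounds:
  assumes "z \<in> energy_simplex E"
  shows "fst z $ i < E" "snd z < E"
proof -
  have "fst z $ i \<le> (\<Sum>i\<in>UNIV. fst z $ i)"
    using assms by (intro member_le_sum) (auto simp: mem_energy_simplex intro: less_imp_le)
  moreover have "0 < fst z $ i" "0 < snd z" using assms by (auto simp: mem_energy_simplex)
  moreover have "snd z + (\<Sum>i\<in>UNIV. fst z $ i) = E"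
    using assms by (simp add: mem_energy_simplex)
  ultimately show "fst z $ i < E" "snd z < E" by linarith+
qed

lemma borel_measurable_exchange:
  "(\<lambda>(z, u). exchange i u z) \<in> borel \<Otimes>\<^sub>M borel \<rightarrow>\<^sub>M (borel :: 'm::finite state measure)"
proof -
  have "continuous_on UNIV (\<lambda>w :: 'm state \<times> real.
      (\<chi> j. if j = i then snd (fst w) + (1 - (snd w)\<^sup>2) * fst (fst w) $ i else fst (fst w) $ j,
       (snd w)\<^sup>2 * fst (fst w) $ i))"
  proof (intro continuous_intros continuous_on_vec_lambda)
    fix j
    show "continuous_on UNIV (\<lambda>w :: 'm state \<times> real.
        if j = i then snd (fst w) + (1 - (snd w)\<^sup>2) * fst (fst w) $ i else fst (fst w) $ j)"
      by (cases "j = i") (auto intro!: continuous_intros)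
  qed
  then have "(\<lambda>(z, u). exchange i u z) \<in> borel_measurable (borel :: ('m state \<times> real) measure)"
    by (intro borel_measurable_continuous_onI) (simp add: exchange_def case_prod_unfold)
  then show ?thesis by (simp add: borel_prod)
qed

lemma measurable_state_space_into_borel [measurable]:
  "(\<lambda>z. z) \<in> state_space E \<rightarrow>\<^sub>M borel"
  unfolding state_space_def by (rule measurable_restrict_space1) simp

lemma measurable_exchange [measurable]:
  "(\<lambda>w. exchange i (snd w) (fst w)) \<in> state_space E \<Otimes>\<^sub>M uniform01 \<rightarrow>\<^sub>M state_space E"
proof -
  have 1: "snd \<in> state_space E \<Otimes>\<^sub>M uniform01 \<rightarrow>\<^sub>M borel"
    by (rule measurable_compose[OF measurable_snd measurable_restrict_space1[OF measurable_ident_sets[OF sets_lborel]]])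
  have 2: "fst \<in> state_space E \<Otimes>\<^sub>M uniform01 \<rightarrow>\<^sub>M borel"
    using measurable_compose[OF measurable_fst measurable_state_space_into_borel] by simp
  have "(\<lambda>w. exchange i (snd w) (fst w)) \<in> state_space E \<Otimes>\<^sub>M uniform01 \<rightarrow>\<^sub>M borel"
    using measurable_compose[OF measurable_Pair[OF 2 1] borel_measurable_exchange[of i]] by simp
  then show ?thesis
    unfolding state_space_def[of E]
    by (intro measurable_restrict_space2)
      (auto simp: space_pair_measure space_restrict_space state_space_def[symmetric] intro!: exchange_in_simplex)
qed

lemma measurable_exchange_at [measurable]:
  assumes "z \<in> energy_simplex E"
  shows "(\<lambda>u. exchange i u z) \<in> uniform01 \<rightarrow>\<^sub>M state_space E"
  using measurable_compose[OF measurable_Pair1'[of z "state_space E" uniform01] measurable_exchange[of i E]] assms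
  by simp

lemma measurable_energies [measurable]:
  "(\<lambda>z. fst z $ i) \<in> borel_measurable (state_space E :: 'm::finite state measure)"
  "snd \<in> borel_measurable (state_space E :: 'm::finite state measure)"
proof -
  have "(\<lambda>z :: 'm state. fst z $ i) \<in> borel_measurable borel"
    by (intro borel_measurable_continuous_onI continuous_intros)
  from measurable_compose[OF measurable_state_space_into_borel this]
  show "(\<lambda>z. fst z $ i) \<in> borel_measurable (state_space E :: 'm::finite state measure)" .
  have "(snd :: 'm state \<Rightarrow> real) \<in> borel_measurable borel"
    by (intro borel_measurable_continuous_onI continuous_intros)
  from measurable_compose[OF measurable_state_space_into_borel this]
  show "snd \<in> borel_measurable (state_space E :: 'm::finite state measure)" by simp
qed

section \<open>The jump chain\<close>

definition ring_mean :: "'m::finite \<Rightarrow> ('m state \<Rightarrow> real) \<Rightarrow> 'm state \<Rightarrow> real" where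
  "ring_mean i f z = (\<integral>u. f (exchange i u z) \<partial>uniform01)"

definition total_rate :: "'m::finite state \<Rightarrow> real" where
  "total_rate z = (\<Sum>i\<in>UNIV. sqrt (fst z $ i))"

definition max_rate :: "'m::finite itself \<Rightarrow> real \<Rightarrow> real" where
  "max_rate _ E = real CARD('m) * sqrt E"

text \<open>
  This is \<open>1\<close> plus the generator divided by \<open>\<Lambda> = max_rate\<close>: the jump chain that rings particle \<open>i\<close> with
  probability \<open>sqrt (x i) / \<Lambda>\<close> and rests with the remaining probability.
\<close>

definition skeleton :: "real \<Rightarrow> ('m::finite state \<Rightarrow> real) \<Rightarrow> 'm state \<Rightarrow> real" where
  "skeleton E f z = f z + (\<Sum>i\<in>UNIV. sqrt (fst z $ i) * (ring_mean i f z - f z)) / max_rate TYPE('m) E"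

lemma max_rate_pos: "0 < E \<Longrightarrow> 0 < max_rate TYPE('m::finite) E"
  by (simp add: max_rate_def)

lemma total_rate_le:
  fixes z :: "'m::finite state"
  assumes "z \<in> energy_simplex E"
  shows "total_rate z \<le> max_rate TYPE('m) E"
  unfolding total_rate_def max_rate_def
  using energy_simplex_bounds[OF assms]
  by (intro sum_bounded_above) (auto intro: less_imp_le)

lemma skeleton_convex_form:
  fixes z :: "'m::finite state"
  assumes "0 < E"
  shows "skeleton E f z = (1 - total_rate z / max_rate TYPE('m) E) * f z
           + (\<Sum>i\<in>UNIV. sqrt (fst z $ i) / max_rate TYPE('m) E * ring_mean i f z)"
proof -
  have "(\<Sum>i\<in>UNIV. sqrt (fst z $ i) * (ring_mean i f z - f z))
      = (\<Sum>i\<in>UNIV. sqrt (fst z $ i) * ring_mean i f z) - total_rate z * f z"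
    by (simp add: total_rate_def right_diff_distrib sum_subtractf sum_distrib_right)
  then show ?thesis using max_rate_pos[OF assms, where 'm='m]
    by (simp add: skeleton_def sum_divide_distrib[symmetric] diff_divide_distrib left_diff_distrib)
qed

text \<open>
  The Lyapunov function of the proof is the integrand in \<^const>\<open>moment_class\<close>.
\<close>

definition weight :: "real \<Rightarrow> 'm::finite state \<Rightarrow> real" where
  "weight \<delta> z = (\<Sum>k\<in>UNIV. (fst z $ k) powr (2 * \<delta> - 1)) + snd z powr (\<delta> - 1 / 2)"

text \<open>
  On this class the integrals in \<^const>\<open>skeleton\<close> converge, and the class is mapped into itself.  It contains the
  unbounded function \<^const>\<open>weight\<close> as well as all bounded functions, since the weight is bounded below.
\<close>

definition dominated :: "real \<Rightarrow> real \<Rightarrow> ('m::finite state \<Rightarrow> real) set" where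
  "dominated E \<delta> = {f \<in> borel_measurable (state_space E).
     \<exists>b. \<forall>z\<in>energy_simplex E. \<bar>f z\<bar> \<le> b * weight \<delta> z}"

lemma measurable_weight [measurable]:
  "weight \<delta> \<in> borel_measurable (state_space E :: 'm::finite state measure)"
  unfolding weight_def by measurable

lemma weight_nonneg: "0 \<le> weight \<delta> z"
  unfolding weight_def by (intro add_nonneg_nonneg sum_nonneg) auto

lemma weight_ge:
  assumes "z \<in> energy_simplex E" "\<delta> < 1 / 2"
  shows "E powr (\<delta> - 1 / 2) \<le> weight \<delta> z"
proof -
  have "E powr (\<delta> - 1 / 2) \<le> snd z powr (\<delta> - 1 / 2)"
    using assms energy_simplex_bounds[OF assms(1)] by (intro powr_mono2') (auto simp: mem_energy_simplex)
  then show ?thesis unfolding weight_def by (simp add: add_increasing sum_nonneg)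
qed

lemma dominated_measurable: "f \<in> dominated E \<delta> \<Longrightarrow> f \<in> borel_measurable (state_space E)"
  by (simp add: dominated_def)

lemma dominatedE:
  assumes "f \<in> dominated E \<delta>"
  obtains b where "0 \<le> b" "\<And>z. z \<in> energy_simplex E \<Longrightarrow> \<bar>f z\<bar> \<le> b * weight \<delta> z"
proof -
  obtain b where b: "\<And>z. z \<in> energy_simplex E \<Longrightarrow> \<bar>f z\<bar> \<le> b * weight \<delta> z"
    using assms by (auto simp: dominated_def)
  have "\<bar>f z\<bar> \<le> max b 0 * weight \<delta> z" if "z \<in> energy_simplex E" for z
    using b[OF that] mult_right_mono[of b "max b 0" "weight \<delta> z"] weight_nonneg[of \<delta> z]
    by auto
  then show thesis by (intro that[of "max b 0"]) auto
qed

lemma weight_dominated: "weight \<delta> \<in> dominated E \<delta>"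
  unfolding dominated_def using weight_nonneg[of \<delta>] by (auto intro!: exI[of _ 1])

lemma dominated_linear:
  assumes "f \<in> dominated E \<delta>" "g \<in> dominated E \<delta>"
  shows "(\<lambda>z. a * f z + b * g z) \<in> dominated E \<delta>"
proof -
  note [measurable] = dominated_measurable[OF assms(1)] dominated_measurable[OF assms(2)]
  obtain p where p: "\<And>z. z \<in> energy_simplex E \<Longrightarrow> \<bar>f z\<bar> \<le> p * weight \<delta> z"
    using dominatedE[OF assms(1)] by metis
  obtain q where q: "\<And>z. z \<in> energy_simplex E \<Longrightarrow> \<bar>g z\<bar> \<le> q * weight \<delta> z"
    using dominatedE[OF assms(2)] by metis
  have "\<bar>a * f z + b * g z\<bar> \<le> (\<bar>a\<bar> * p + \<bar>b\<bar> * q) * weight \<delta> z" if "z \<in> energy_simplex E" for z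
  proof -
    have "\<bar>a * f z + b * g z\<bar> \<le> \<bar>a\<bar> * \<bar>f z\<bar> + \<bar>b\<bar> * \<bar>g z\<bar>"
      by (metis abs_mult abs_triangle_ineq)
    also have "\<dots> \<le> \<bar>a\<bar> * (p * weight \<delta> z) + \<bar>b\<bar> * (q * weight \<delta> z)"
      by (intro add_mono mult_left_mono p q that) auto
    finally show ?thesis by (simp add: algebra_simps)
  qed
  then show ?thesis unfolding dominated_def by (auto intro!: exI[of _ "\<bar>a\<bar> * p + \<bar>b\<bar> * q"])
qed

lemma bounded_dominated:
  assumes "f \<in> borel_measurable (state_space E)" "\<And>z. z \<in> energy_simplex E \<Longrightarrow> \<bar>f z\<bar> \<le> M"
    and "0 < E" "\<delta> < 1 / 2"
  shows "f \<in> dominated E \<delta>"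
proof -
  have "\<bar>f z\<bar> \<le> (M / E powr (\<delta> - 1 / 2)) * weight \<delta> z" if "z \<in> energy_simplex E" for z
  proof -
    have M: "0 \<le> M" using assms(2)[OF that] by linarith
    have "\<bar>f z\<bar> \<le> (M / E powr (\<delta> - 1 / 2)) * E powr (\<delta> - 1 / 2)"
      using assms(2)[OF that] assms(3) by simp
    also have "\<dots> \<le> (M / E powr (\<delta> - 1 / 2)) * weight \<delta> z"
      using M weight_ge[OF that assms(4)] by (intro mult_left_mono) auto
    finally show ?thesis .
  qed
  then show ?thesis unfolding dominated_def using assms(1) by blast
qed

lemma const_dominated: "0 < E \<Longrightarrow> \<delta> < 1 / 2 \<Longrightarrow> (\<lambda>_. c) \<in> dominated E \<delta>"
  by (rule bounded_dominated[where M="\<bar>c\<bar>"]) auto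

section \<open>The weight after a ring\<close>

lemma nn_integral_powr_01:
  assumes "0 < r"
  shows "(\<integral>\<^sup>+u. ennreal (u powr (r - 1)) \<partial>uniform01) = ennreal (1 / r)"
proof -
  have "((\<lambda>x. x powr (r - 1)) has_integral (1 powr (r - 1 + 1) / (r - 1 + 1))) {0..1::real}"
    using assms by (intro has_integral_powr_from_0) auto
  then have 1: "(\<integral>\<^sup>+u. ennreal (indicator {0..1} u * u powr (r - 1)) \<partial>lborel) = ennreal (1 / r)"
    using nn_integral_has_integral_lebesgue[of "{0..1::real}" "\<lambda>x. x powr (r - 1)"] by simp
  have "(\<integral>\<^sup>+u. ennreal (u powr (r - 1)) \<partial>uniform01) = (\<integral>\<^sup>+u. ennreal (u powr (r - 1)) * indicator {0<..<1} u \<partial>lborel)"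
    by (simp add: nn_integral_restrict_space)
  also have "\<dots> = (\<integral>\<^sup>+u. ennreal (indicator {0..1} u * u powr (r - 1)) \<partial>lborel)"
    using AE_lborel_singleton[of "0::real"] AE_lborel_singleton[of "1::real"]
    by (intro nn_integral_cong_AE) (auto elim!: eventually_elim2 simp: indicator_def)
  finally show ?thesis using 1 by simp
qed

lemma nn_integral_uniform01_reflect:
  assumes [measurable]: "f \<in> borel_measurable borel"
  shows "(\<integral>\<^sup>+u. f (1 - u) \<partial>uniform01) = (\<integral>\<^sup>+u. f u \<partial>uniform01)"
proof -
  have "(\<integral>\<^sup>+u. f u \<partial>uniform01) = (\<integral>\<^sup>+u. f u * indicator {0<..<1} u \<partial>lborel)"
    by (simp add: nn_integral_restrict_space)
  also have "\<dots> = (\<integral>\<^sup>+u. f (1 + (- 1) * u) * indicator {0<..<1} (1 + (- 1) * u :: real) \<partial>lborel)"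
    by (subst nn_integral_real_affine[where c="-1" and t=1]) auto
  also have "\<dots> = (\<integral>\<^sup>+u. f (1 - u) * indicator {0<..<1} u \<partial>lborel)"
    by (intro nn_integral_cong) (auto simp: indicator_def)
  also have "\<dots> = (\<integral>\<^sup>+u. f (1 - u) \<partial>uniform01)"
    by (simp add: nn_integral_restrict_space)
  finally show ?thesis by simp
qed

lemma borel_measurable_uniform01: "f \<in> borel_measurable borel \<Longrightarrow> f \<in> borel_measurable uniform01"
  by (intro measurable_restrict_space1) simp

lemma powr_01:
  assumes "0 < r"
  shows "integrable uniform01 (\<lambda>u. u powr (r - 1))" "(\<integral>u. u powr (r - 1) \<partial>uniform01) = 1 / r"
    "integrable uniform01 (\<lambda>u. (1 - u) powr (r - 1))" "(\<integral>u. (1 - u) powr (r - 1) \<partial>uniform01) = 1 / r"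
proof -
  have m: "(\<lambda>u::real. u powr (r - 1)) \<in> borel_measurable uniform01"
    "(\<lambda>u::real. (1 - u) powr (r - 1)) \<in> borel_measurable uniform01"
    by (rule borel_measurable_uniform01; measurable)+
  have 1: "(\<integral>\<^sup>+u. ennreal (u powr (r - 1)) \<partial>uniform01) = ennreal (1 / r)"
    by (rule nn_integral_powr_01[OF assms])
  have 2: "(\<integral>\<^sup>+u. ennreal ((1 - u) powr (r - 1)) \<partial>uniform01) = ennreal (1 / r)"
    using nn_integral_uniform01_reflect[of "\<lambda>u. ennreal (u powr (r - 1))"] 1 by simp
  show "integrable uniform01 (\<lambda>u. u powr (r - 1))" "integrable uniform01 (\<lambda>u. (1 - u) powr (r - 1))"
    using 1 2 m by (auto intro!: integrableI_nonneg)
  show "(\<integral>u. u powr (r - 1) \<partial>uniform01) = 1 / r" "(\<integral>u. (1 - u) powr (r - 1) \<partial>uniform01) = 1 / r"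
    using 1 2 m assms by (auto simp: integral_eq_nn_integral)
qed

lemma weight_exchange:
  "weight \<delta> (exchange i u z) = weight \<delta> z - fst z $ i powr (2 * \<delta> - 1) - snd z powr (\<delta> - 1 / 2)
     + (snd z + (1 - u\<^sup>2) * fst z $ i) powr (2 * \<delta> - 1) + (u\<^sup>2 * fst z $ i) powr (\<delta> - 1 / 2)"
  by (simp add: weight_def fst_exchange snd_exchange if_distrib[of "\<lambda>x. x powr _"] sum_replace_one)

lemma particle_term_le:
  fixes x y u r :: real
  assumes "0 < x" "0 < y" "0 < u" "u < 1" "r \<le> 0"
  shows "(y + (1 - u\<^sup>2) * x) powr r \<le> (1 - u) powr r * x powr r"
    "(y + (1 - u\<^sup>2) * x) powr r \<le> y powr r"
proof -
  have u: "u\<^sup>2 \<le> u" using assms by (simp add: power2_eq_square mult_left_le)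
  then have "(1 - u) * x \<le> (1 - u\<^sup>2) * x" using assms by (intro mult_right_mono) auto
  then have "(1 - u) * x \<le> y + (1 - u\<^sup>2) * x" using assms by linarith
  then have "(y + (1 - u\<^sup>2) * x) powr r \<le> ((1 - u) * x) powr r"
    using assms by (intro powr_mono2') auto
  then show "(y + (1 - u\<^sup>2) * x) powr r \<le> (1 - u) powr r * x powr r"
    using assms by (simp add: powr_mult)
  have "0 \<le> (1 - u\<^sup>2) * x" using assms u by (intro mult_nonneg_nonneg) auto
  then show "(y + (1 - u\<^sup>2) * x) powr r \<le> y powr r"
    using assms by (intro powr_mono2') auto
qed

lemma tank_term_eq:
  fixes x u \<delta> :: real
  assumes "0 < x" "0 < u"
  shows "(u\<^sup>2 * x) powr (\<delta> - 1 / 2) = u powr (2 * \<delta> - 1) * x powr (\<delta> - 1 / 2)"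
proof -
  have "(u\<^sup>2) powr (\<delta> - 1 / 2) = u powr (2 * \<delta> - 1)"
    using assms powr_powr[of u 2 "\<delta> - 1 / 2"] by (simp add: powr_numeral algebra_simps)
  then show ?thesis using assms by (simp add: powr_mult)
qed

text \<open>
  The new energy \<open>y + (1 - u\<^sup>2) * x\<close> of the particle is at least \<open>(1 - u) * x\<close> and at least \<open>y\<close>.  The first bound costs
  a factor \<open>1 / (2 * \<delta>)\<close> and is for a poor tank, the second shows the gain from a rich one.  The new tank energy
  \<open>u\<^sup>2 * x\<close> has a finite mean weight because \<open>2 * \<delta> - 1 > - 1\<close>.
\<close>

lemma ring_mean_weight:
  fixes z :: "'m::finite state" and i :: 'm
  assumes z: "z \<in> energy_simplex E" and \<delta>: "0 < \<delta>" "\<delta> < 1 / 2"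
  defines "x \<equiv> fst z $ i" and "y \<equiv> snd z"
  defines "rest \<equiv> weight \<delta> z - x powr (2 * \<delta> - 1) - y powr (\<delta> - 1 / 2)"
  shows integrable_weight_exchange: "integrable uniform01 (\<lambda>u. weight \<delta> (exchange i u z))"
    and ring_mean_weight_le: "ring_mean i (weight \<delta>) z \<le> rest
      + x powr (2 * \<delta> - 1) / (2 * \<delta>) + x powr (\<delta> - 1 / 2) / (2 * \<delta>)"
    and ring_mean_weight_le_tank: "ring_mean i (weight \<delta>) z \<le> rest
      + y powr (2 * \<delta> - 1) + x powr (\<delta> - 1 / 2) / (2 * \<delta>)"
proof -
  have xy: "0 < x" "0 < y" using z by (auto simp: mem_energy_simplex x_def y_def)
  have space: "AE u in uniform01. 0 < u \<and> u < 1"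
    by (intro AE_I2) (simp add: space_restrict_space)
  have m: "(\<lambda>u. weight \<delta> (exchange i u z)) \<in> borel_measurable uniform01"
    by (rule measurable_compose[OF measurable_exchange_at[OF z] measurable_weight])
  have 2: "0 < 2 * \<delta>" using \<delta> by simp
  note P = powr_01[OF 2]
  let ?f = "\<lambda>u. rest + (1 - u) powr (2 * \<delta> - 1) * x powr (2 * \<delta> - 1) + u powr (2 * \<delta> - 1) * x powr (\<delta> - 1 / 2)"
  let ?g = "\<lambda>u. rest + y powr (2 * \<delta> - 1) + u powr (2 * \<delta> - 1) * x powr (\<delta> - 1 / 2)"
  have f: "integrable uniform01 ?f" "integrable uniform01 ?g" using P by auto
  have le: "weight \<delta> (exchange i u z) \<le> ?f u" "weight \<delta> (exchange i u z) \<le> ?g u"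
    if "0 < u \<and> u < 1" for u
    using particle_term_le[of x y u "2 * \<delta> - 1"] tank_term_eq[of x u \<delta>] xy that \<delta>
    unfolding weight_exchange rest_def x_def y_def by auto
  show int: "integrable uniform01 (\<lambda>u. weight \<delta> (exchange i u z))"
  proof (rule Bochner_Integration.integrable_bound[OF f(1) m])
    show "AE u in uniform01. norm (weight \<delta> (exchange i u z)) \<le> norm (?f u)"
      using space
    proof eventually_elim
      case (elim u)
      show ?case using le(1)[OF elim] weight_nonneg[of \<delta> "exchange i u z"] by auto
    qed
  qed
  have "ring_mean i (weight \<delta>) z \<le> (\<integral>u. ?f u \<partial>uniform01)"
    unfolding ring_mean_def using space le(1) by (intro integral_mono_AE int f) auto
  also have "\<dots> = rest + x powr (2 * \<delta> - 1) / (2 * \<delta>) + x powr (\<delta> - 1 / 2) / (2 * \<delta>)"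
    using P uniform01.prob_space by simp
  finally show "ring_mean i (weight \<delta>) z \<le> rest
      + x powr (2 * \<delta> - 1) / (2 * \<delta>) + x powr (\<delta> - 1 / 2) / (2 * \<delta>)" .
  have "ring_mean i (weight \<delta>) z \<le> (\<integral>u. ?g u \<partial>uniform01)"
    unfolding ring_mean_def using space le(2) by (intro integral_mono_AE int f) auto
  also have "\<dots> = rest + y powr (2 * \<delta> - 1) + x powr (\<delta> - 1 / 2) / (2 * \<delta>)"
    using P uniform01.prob_space by simp
  finally show "ring_mean i (weight \<delta>) z \<le> rest
      + y powr (2 * \<delta> - 1) + x powr (\<delta> - 1 / 2) / (2 * \<delta>)" .
qed

section \<open>Positivity and linearity\<close>

lemma integrable_exchange:
  assumes f: "f \<in> dominated E \<delta>" and z: "z \<in> energy_simplex E" and \<delta>: "0 < \<delta>" "\<delta> < 1 / 2"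
  shows "integrable uniform01 (\<lambda>u. f (exchange i u z))"
proof -
  obtain b where b: "0 \<le> b" "\<And>z. z \<in> energy_simplex E \<Longrightarrow> \<bar>f z\<bar> \<le> b * weight \<delta> z"
    using f by (rule dominatedE) auto
  show ?thesis
  proof (rule Bochner_Integration.integrable_bound)
    show "integrable uniform01 (\<lambda>u. b * weight \<delta> (exchange i u z))"
      using integrable_weight_exchange[OF z \<delta>] by simp
    show "(\<lambda>u. f (exchange i u z)) \<in> borel_measurable uniform01"
      by (rule measurable_compose[OF measurable_exchange_at[OF z] dominated_measurable[OF f]])
    show "AE u in uniform01. norm (f (exchange i u z)) \<le> norm (b * weight \<delta> (exchange i u z))"
    proof (rule AE_I2)
      fix u assume "u \<in> space uniform01"
      then have "exchange i u z \<in> energy_simplex E"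
        using z by (intro exchange_in_simplex) (auto simp: space_restrict_space)
      then show "norm (f (exchange i u z)) \<le> norm (b * weight \<delta> (exchange i u z))"
        using b weight_nonneg[of \<delta> "exchange i u z"] by (fastforce simp: abs_mult)
    qed
  qed
qed

lemma ring_mean_mono:
  assumes "f \<in> dominated E \<delta>" "g \<in> dominated E \<delta>" "0 < \<delta>" "\<delta> < 1 / 2"
    and "\<And>w. w \<in> energy_simplex E \<Longrightarrow> f w \<le> g w" "z \<in> energy_simplex E"
  shows "ring_mean i f z \<le> ring_mean i g z"
  unfolding ring_mean_def
  using assms(1-4,6)
  by (intro integral_mono_AE integrable_exchange AE_I2 assms(5) exchange_in_simplex)
     (auto simp: space_restrict_space)

lemma ring_mean_linear:
  assumes "f \<in> dominated E \<delta>" "g \<in> dominated E \<delta>" "0 < \<delta>" "\<delta> < 1 / 2" "z \<in> energy_simplex E"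
  shows "ring_mean i (\<lambda>w. a * f w + b * g w) z = a * ring_mean i f z + b * ring_mean i g z"
  unfolding ring_mean_def using integrable_exchange[OF assms(1,5,3,4)] integrable_exchange[OF assms(2,5,3,4)]
  by simp

lemma ring_mean_const: "ring_mean i (\<lambda>_. c) z = c"
  unfolding ring_mean_def using uniform01.prob_space by simp

lemma measurable_ring_mean [measurable]:
  assumes [measurable]: "f \<in> borel_measurable (state_space E)"
  shows "ring_mean i f \<in> borel_measurable (state_space E)"
proof -
  have "(\<lambda>(z, u). f (exchange i u z)) \<in> borel_measurable (state_space E \<Otimes>\<^sub>M uniform01)"
    unfolding case_prod_unfold by measurable
  then show ?thesis unfolding ring_mean_def
    by (rule uniform01.borel_measurable_lebesgue_integral)
qed

lemma skeleton_mono: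
  fixes f g :: "'m::finite state \<Rightarrow> real"
  assumes "f \<in> dominated E \<delta>" "g \<in> dominated E \<delta>" "0 < \<delta>" "\<delta> < 1 / 2" "0 < E"
    and le: "\<And>w. w \<in> energy_simplex E \<Longrightarrow> f w \<le> g w" and z: "z \<in> energy_simplex E"
  shows "skeleton E f z \<le> skeleton E g z"
  unfolding skeleton_convex_form[OF assms(5)]
  using total_rate_le[OF z] max_rate_pos[OF assms(5), where 'm='m] z
  by (intro add_mono mult_left_mono le sum_mono ring_mean_mono[OF assms(1-4)] z)
     (auto simp: mem_energy_simplex intro!: divide_nonneg_pos less_imp_le)

lemma skeleton_linear:
  fixes f g :: "'m::finite state \<Rightarrow> real"
  assumes "f \<in> dominated E \<delta>" "g \<in> dominated E \<delta>" "0 < \<delta>" "\<delta> < 1 / 2" "z \<in> energy_simplex E"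
  shows "skeleton E (\<lambda>w. a * f w + b * g w) z = a * skeleton E f z + b * skeleton E g z"
proof -
  have "(\<Sum>i\<in>UNIV. sqrt (fst z $ i) * (ring_mean i (\<lambda>w. a * f w + b * g w) z - (a * f z + b * g z)))
     = a * (\<Sum>i\<in>UNIV. sqrt (fst z $ i) * (ring_mean i f z - f z)) + b * (\<Sum>i\<in>UNIV. sqrt (fst z $ i) * (ring_mean i g z - g z))"
    unfolding ring_mean_linear[OF assms] sum_distrib_left sum.distrib[symmetric]
    by (intro sum.cong) (auto simp: algebra_simps)
  then show ?thesis
    unfolding skeleton_def by (simp add: add_divide_distrib distrib_left)
qed

lemma skeleton_const: "skeleton E (\<lambda>_. c) z = c"
  by (simp add: skeleton_def ring_mean_const)

lemma measurable_skeleton [measurable]: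
  assumes [measurable]: "f \<in> borel_measurable (state_space E)"
  shows "skeleton E f \<in> borel_measurable (state_space E)"
  unfolding skeleton_def by measurable

section \<open>Drift of the weight\<close>

lemma powr_interpolate:
  fixes r q \<epsilon> :: real
  assumes "q < r" "r < 0" "0 < \<epsilon>"
  shows "\<exists>C\<ge>0. \<forall>y>0. y powr r \<le> \<epsilon> * y powr q + C"
proof -
  define y0 where "y0 = \<epsilon> powr (1 / (r - q))"
  have y0: "0 < y0" "y0 powr (r - q) = \<epsilon>" using assms by (auto simp: y0_def powr_powr)
  have "y powr r \<le> \<epsilon> * y powr q + y0 powr r" if y: "0 < y" for y
  proof (cases "y \<le> y0")
    case True
    have "y powr r = y powr (r - q) * y powr q" by (simp add: powr_add[symmetric])
    also have "\<dots> \<le> y0 powr (r - q) * y powr q"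
      using True y assms by (intro mult_right_mono powr_mono2) auto
    finally show ?thesis using y0 by (simp add: add_increasing2)
  next
    case False
    then have "y powr r \<le> y0 powr r" using y0 assms by (intro powr_mono2') auto
    then show ?thesis using assms by (simp add: add_increasing)
  qed
  then show ?thesis by (intro exI[of _ "y0 powr r"]) auto
qed

text \<open>
  If \<open>4 * x \<le> y\<close>, a ring at least halves the term \<open>x powr (2 * \<delta> - 1)\<close>, because the new energy is at least \<open>y\<close> and
  \<open>4 powr (2 * \<delta> - 1) \<le> 1 / 2\<close>.  If \<open>y < 4 * x\<close>, that term may grow, but then \<open>x powr (2 * \<delta> - 1 / 2)\<close> is at most
  \<open>2 * y powr (2 * \<delta> - 1 / 2)\<close>, which is less singular than the tank term \<open>y powr (\<delta> - 1 / 2)\<close>.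
\<close>

lemma one_ring_drift:
  fixes z :: "'m::finite state"
  assumes z: "z \<in> energy_simplex E" and \<delta>: "0 < \<delta>" "\<delta> < 1 / 4"
  shows "sqrt (fst z $ i) * (ring_mean i (weight \<delta>) z - weight \<delta> z)
    \<le> - (fst z $ i powr (2 * \<delta> - 1 / 2)) / 2 + snd z powr (2 * \<delta> - 1 / 2) / \<delta>
      + E powr \<delta> / (2 * \<delta>) - sqrt (fst z $ i) * snd z powr (\<delta> - 1 / 2)"
proof -
  define x y where "x = fst z $ i" and "y = snd z"
  have xy: "0 < x" "0 < y" "x \<le> E"
    using z energy_simplex_bounds[OF z] by (auto simp: mem_energy_simplex x_def y_def intro: less_imp_le)
  have sq: "sqrt x = x powr (1 / 2)" using xy by (simp add: powr_half_sqrt)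
  have s1: "sqrt x * x powr (2 * \<delta> - 1) = x powr (2 * \<delta> - 1 / 2)"
    unfolding sq by (simp add: powr_add[symmetric])
  have s2: "sqrt x * x powr (\<delta> - 1 / 2) = x powr \<delta>"
    unfolding sq by (simp add: powr_add[symmetric])
  have s3: "x powr \<delta> \<le> E powr \<delta>" using xy \<delta> by (intro powr_mono2) auto
  have \<delta>2: "\<delta> < 1 / 2" using \<delta> by simp
  define Q where "Q = ring_mean i (weight \<delta>) z - weight \<delta> z
     + x powr (2 * \<delta> - 1) + y powr (\<delta> - 1 / 2) - x powr (\<delta> - 1 / 2) / (2 * \<delta>)"
  have Q: "Q \<le> x powr (2 * \<delta> - 1) / (2 * \<delta>)" "Q \<le> y powr (2 * \<delta> - 1)"
    using ring_mean_weight_le[OF z \<delta>(1) \<delta>2, of i] ring_mean_weight_le_tank[OF z \<delta>(1) \<delta>2, of i]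
    by (auto simp: Q_def x_def y_def)
  have key: "sqrt x * (Q - x powr (2 * \<delta> - 1)) \<le> - (x powr (2 * \<delta> - 1 / 2)) / 2 + y powr (2 * \<delta> - 1 / 2) / \<delta>"
  proof (cases "4 * x \<le> y")
    case True
    have "y powr (2 * \<delta> - 1) \<le> (4 * x) powr (2 * \<delta> - 1)"
      using True xy \<delta> by (intro powr_mono2') auto
    also have "\<dots> = 4 powr (2 * \<delta> - 1) * x powr (2 * \<delta> - 1)"
      using xy by (simp add: powr_mult)
    also have "\<dots> \<le> (1 / 2) * x powr (2 * \<delta> - 1)"
    proof (rule mult_right_mono)
      have "4 powr (2 * \<delta> - 1) \<le> (4::real) powr (- (1 / 2))"
        using \<delta> by (intro powr_mono) auto
      also have "\<dots> = 1 / 2" by (simp add: powr_minus powr_half_sqrt)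
      finally show "4 powr (2 * \<delta> - 1) \<le> (1::real) / 2" .
    qed simp
    finally have "Q - x powr (2 * \<delta> - 1) \<le> - (x powr (2 * \<delta> - 1)) / 2" using Q(2) by linarith
    then have "sqrt x * (Q - x powr (2 * \<delta> - 1)) \<le> sqrt x * (- (x powr (2 * \<delta> - 1)) / 2)"
      using xy by (intro mult_left_mono) auto
    also have "\<dots> = - (x powr (2 * \<delta> - 1 / 2)) / 2" using s1 by simp
    finally have "sqrt x * (Q - x powr (2 * \<delta> - 1)) \<le> - (x powr (2 * \<delta> - 1 / 2)) / 2" .
    moreover have "0 \<le> y powr (2 * \<delta> - 1 / 2) / \<delta>" using \<delta> by simp
    ultimately show ?thesis by linarith
  next
    case False
    define X where "X = x powr (2 * \<delta> - 1 / 2)"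
    have "X \<le> (y / 4) powr (2 * \<delta> - 1 / 2)"
      unfolding X_def using False xy \<delta> by (intro powr_mono2') auto
    also have "\<dots> = y powr (2 * \<delta> - 1 / 2) * 4 powr (1 / 2 - 2 * \<delta>)"
      using xy by (simp add: powr_divide powr_diff field_simps)
    also have "\<dots> \<le> y powr (2 * \<delta> - 1 / 2) * 2"
    proof (rule mult_left_mono)
      have "4 powr (1 / 2 - 2 * \<delta>) \<le> (4::real) powr (1 / 2)"
        using \<delta> by (intro powr_mono) auto
      then show "4 powr (1 / 2 - 2 * \<delta>) \<le> (2::real)" by (simp add: powr_half_sqrt)
    qed simp
    finally have X: "X \<le> y powr (2 * \<delta> - 1 / 2) * 2" .
    have "sqrt x * (Q - x powr (2 * \<delta> - 1)) \<le> sqrt x * (x powr (2 * \<delta> - 1) / (2 * \<delta>) - x powr (2 * \<delta> - 1))"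
      using Q(1) xy by (intro mult_left_mono) auto
    also have "\<dots> = (sqrt x * x powr (2 * \<delta> - 1)) / (2 * \<delta>) - sqrt x * x powr (2 * \<delta> - 1)"
      by (simp add: right_diff_distrib)
    also have "\<dots> = X / (2 * \<delta>) - X" unfolding s1 X_def ..
    also have "\<dots> \<le> - X / 2 + X / (2 * \<delta>)" by (simp add: X_def)
    also have "X / (2 * \<delta>) \<le> y powr (2 * \<delta> - 1 / 2) / \<delta>"
      using X \<delta> by (simp add: field_simps)
    finally show ?thesis by (simp add: X_def)
  qed
  have "sqrt x * (ring_mean i (weight \<delta>) z - weight \<delta> z)
      = sqrt x * (Q - x powr (2 * \<delta> - 1)) - sqrt x * y powr (\<delta> - 1 / 2) + (sqrt x * x powr (\<delta> - 1 / 2)) / (2 * \<delta>)"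
    by (simp add: Q_def algebra_simps)
  also have "\<dots> \<le> (- (x powr (2 * \<delta> - 1 / 2)) / 2 + y powr (2 * \<delta> - 1 / 2) / \<delta>)
      - sqrt x * y powr (\<delta> - 1 / 2) + E powr \<delta> / (2 * \<delta>)"
    unfolding s2 using key s3 \<delta> by (intro add_mono diff_mono divide_right_mono) auto
  finally show ?thesis by (simp add: x_def y_def)
qed

lemma total_rate_ge:
  assumes z: "z \<in> energy_simplex E"
  shows "sqrt (E - snd z) \<le> total_rate z"
proof -
  have nn: "0 \<le> fst z $ i" for i using z by (auto simp: mem_energy_simplex intro: less_imp_le)
  have "E - snd z = (\<Sum>i\<in>UNIV. fst z $ i)" using z by (auto simp: mem_energy_simplex)
  moreover have "(\<Sum>i\<in>UNIV. fst z $ i) powr (1 / 2) \<le> (\<Sum>i\<in>UNIV. fst z $ i powr (1 / 2))"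
    using nn by (intro powr_sum_subadditive) auto
  ultimately show ?thesis
    using nn sum_nonneg[of UNIV "\<lambda>i. fst z $ i"] by (simp add: powr_half_sqrt total_rate_def)
qed

text \<open>
  In the sum of \<open>one_ring_drift\<close> over all particles the tank contributes \<open>- total_rate z * y powr (\<delta> - 1 / 2)\<close>.  The total
  rate is at least \<open>sqrt (E / 2)\<close> if \<open>y \<le> E / 2\<close>, so this absorbs all multiples of \<open>y powr (2 * \<delta> - 1 / 2)\<close>.
  The exponent \<open>\<alpha> = 1 - 1 / (2 - 4 * \<delta>)\<close> is the one for which \<open>(x powr (2 * \<delta> - 1)) powr \<alpha> = x powr (2 * \<delta> - 1 / 2)\<close>.
\<close>

lemma weight_drift:
  fixes E \<delta> :: real
  assumes E: "0 < E" and \<delta>: "0 < \<delta>" "\<delta> < 1 / 4"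
  shows "\<exists>c>0. \<exists>b>0. \<forall>z :: 'm::finite state \<in> energy_simplex E.
    skeleton E (weight \<delta>) z \<le> weight \<delta> z - c * weight \<delta> z powr (1 - 1 / (2 - 4 * \<delta>)) + b"
proof -
  define m where "m = real CARD('m)"
  have m: "0 < m" by (simp add: m_def)
  define \<kappa> where "\<kappa> = sqrt (E / 2)"
  have \<kappa>: "0 < \<kappa>" using E by (simp add: \<kappa>_def)
  obtain C where C: "0 \<le> C" and interp: "\<And>y. 0 < y \<Longrightarrow>
      y powr (2 * \<delta> - 1 / 2) \<le> (\<kappa> * \<delta> / (2 * m)) * y powr (\<delta> - 1 / 2) + C"
    using powr_interpolate[of "\<delta> - 1 / 2" "2 * \<delta> - 1 / 2" "\<kappa> * \<delta> / (2 * m)"] \<delta> \<kappa> m by auto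
  define \<alpha> where "\<alpha> = 1 - 1 / (2 - 4 * \<delta>)"
  have \<alpha>: "0 < \<alpha>" "\<alpha> \<le> 1" using \<delta> by (auto simp: \<alpha>_def field_simps)
  have \<alpha>x: "(2 * \<delta> - 1) * \<alpha> = 2 * \<delta> - 1 / 2" using \<delta> by (simp add: \<alpha>_def field_simps)
  define c where "c = min (1 / 2) (\<kappa> / 2)"
  have c: "0 < c" "c \<le> 1 / 2" "c \<le> \<kappa> / 2" using \<kappa> by (auto simp: c_def)
  define b where "b = c + m * C / \<delta> + m * (E powr \<delta> / (2 * \<delta>)) + \<kappa> * (E / 2) powr (\<delta> - 1 / 2)"
  have b: "0 < b" unfolding b_def using c C m \<delta> \<kappa> E by (intro add_pos_pos add_pos_nonneg) auto
  define \<Lambda> where "\<Lambda> = max_rate TYPE('m) E"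
  have \<Lambda>: "0 < \<Lambda>" using max_rate_pos[OF E] by (simp add: \<Lambda>_def)
  have "skeleton E (weight \<delta>) z \<le> weight \<delta> z - (c / \<Lambda>) * weight \<delta> z powr \<alpha> + b / \<Lambda>"
    if z: "z \<in> energy_simplex E" for z :: "'m state"
  proof -
    define y where "y = snd z"
    have y: "0 < y" using z by (simp add: mem_energy_simplex y_def)
    define T where "T = y powr (\<delta> - 1 / 2)"
    define X where "X = (\<Sum>i\<in>UNIV. fst z $ i powr (2 * \<delta> - 1 / 2))"
    have W: "weight \<delta> z powr \<alpha> \<le> X + (1 + T)"
    proof -
      have "weight \<delta> z powr \<alpha> \<le> (\<Sum>i\<in>UNIV. fst z $ i powr (2 * \<delta> - 1)) powr \<alpha> + T powr \<alpha>"
        unfolding weight_def T_def y_def using \<alpha> by (intro powr_add_subadditive sum_nonneg) auto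
      also have "(\<Sum>i\<in>UNIV. fst z $ i powr (2 * \<delta> - 1)) powr \<alpha> \<le> (\<Sum>i\<in>UNIV. (fst z $ i powr (2 * \<delta> - 1)) powr \<alpha>)"
        using \<alpha> by (intro powr_sum_subadditive) auto
      also have "\<dots> = X" by (simp add: X_def powr_powr \<alpha>x)
      also have "T powr \<alpha> \<le> 1 + T"
      proof -
        have "T powr \<alpha> \<le> (1 + T) powr \<alpha>" using \<alpha> by (intro powr_mono2) (auto simp: T_def)
        also have "\<dots> \<le> (1 + T) powr 1" using \<alpha> by (intro powr_mono) (auto simp: T_def)
        finally show ?thesis by (simp add: T_def)
      qed
      finally show ?thesis by simp
    qed
    have tank: "\<kappa> * (T - (E / 2) powr (\<delta> - 1 / 2)) \<le> total_rate z * T"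
    proof (cases "y \<le> E / 2")
      case True
      have "\<kappa> \<le> sqrt (E - y)" using True by (simp add: \<kappa>_def)
      also have "\<dots> \<le> total_rate z" using total_rate_ge[OF z] by (simp add: y_def)
      finally have "\<kappa> * T \<le> total_rate z * T" by (intro mult_right_mono) (auto simp: T_def)
      moreover have "0 \<le> \<kappa> * (E / 2) powr (\<delta> - 1 / 2)" using \<kappa> by simp
      ultimately show ?thesis by (simp add: right_diff_distrib)
    next
      case False
      then have "T \<le> (E / 2) powr (\<delta> - 1 / 2)" unfolding T_def using E \<delta> by (intro powr_mono2') auto
      then have "\<kappa> * (T - (E / 2) powr (\<delta> - 1 / 2)) \<le> 0" using \<kappa> by (simp add: mult_le_0_iff)
      also have "0 \<le> total_rate z * T"
        unfolding T_def total_rate_def using z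
        by (intro mult_nonneg_nonneg sum_nonneg) (auto simp: mem_energy_simplex intro: less_imp_le)
      finally show ?thesis .
    qed
    have "(\<Sum>i\<in>UNIV. sqrt (fst z $ i) * (ring_mean i (weight \<delta>) z - weight \<delta> z))
      \<le> (\<Sum>i\<in>UNIV. - (fst z $ i powr (2 * \<delta> - 1 / 2)) / 2 + y powr (2 * \<delta> - 1 / 2) / \<delta>
        + E powr \<delta> / (2 * \<delta>) - sqrt (fst z $ i) * T)"
      unfolding T_def y_def by (intro sum_mono one_ring_drift z \<delta>)
    also have "\<dots> = - X / 2 + m * (y powr (2 * \<delta> - 1 / 2) / \<delta>) + m * (E powr \<delta> / (2 * \<delta>)) - total_rate z * T"
      by (simp add: sum.distrib sum_subtractf X_def total_rate_def m_def sum_distrib_right sum_negf sum_divide_distrib)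
    also have "m * (y powr (2 * \<delta> - 1 / 2) / \<delta>) \<le> m * (((\<kappa> * \<delta> / (2 * m)) * T + C) / \<delta>)"
      unfolding T_def using interp[OF y] m \<delta> by (intro mult_left_mono divide_right_mono) auto
    also have "m * (((\<kappa> * \<delta> / (2 * m)) * T + C) / \<delta>) = \<kappa> / 2 * T + m * C / \<delta>"
      using m \<delta> by (simp add: field_simps)
    finally have 1: "(\<Sum>i\<in>UNIV. sqrt (fst z $ i) * (ring_mean i (weight \<delta>) z - weight \<delta> z))
      \<le> - (1 / 2) * X - (\<kappa> / 2) * T + (b - c)"
      using tank by (simp add: b_def right_diff_distrib)
    have "c * X \<le> (1 / 2) * X" "c * T \<le> (\<kappa> / 2) * T"
      using c by (auto intro!: mult_right_mono sum_nonneg simp: X_def T_def simp del: times_divide_eq_left)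
    moreover have "c * weight \<delta> z powr \<alpha> \<le> c * X + (c + c * T)"
      using mult_left_mono[OF W, of c] c by (simp add: distrib_left)
    ultimately have "(\<Sum>i\<in>UNIV. sqrt (fst z $ i) * (ring_mean i (weight \<delta>) z - weight \<delta> z))
      \<le> - c * weight \<delta> z powr \<alpha> + b"
      using 1 by linarith
    then have "(\<Sum>i\<in>UNIV. sqrt (fst z $ i) * (ring_mean i (weight \<delta>) z - weight \<delta> z)) / \<Lambda>
      \<le> (- c * weight \<delta> z powr \<alpha> + b) / \<Lambda>"
      using \<Lambda> by (intro divide_right_mono) auto
    then show ?thesis
      unfolding skeleton_def \<Lambda>_def[symmetric] by (simp add: add_divide_distrib diff_divide_distrib)
  qed
  moreover have "0 < c / \<Lambda>" "0 < b / \<Lambda>" using c b \<Lambda> by auto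
  ultimately show ?thesis unfolding \<alpha>_def by blast
qed


lemma skeleton_dominated:
  fixes f :: "'m::finite state \<Rightarrow> real"
  assumes E: "0 < E" and \<delta>: "0 < \<delta>" "\<delta> < 1 / 4" and f: "f \<in> dominated E \<delta>"
  shows "skeleton E f \<in> dominated E \<delta>"
proof -
  have \<delta>2: "\<delta> < 1 / 2" using \<delta> by simp
  obtain q where q: "0 \<le> q" "\<And>z. z \<in> energy_simplex E \<Longrightarrow> \<bar>f z\<bar> \<le> q * weight \<delta> z"
    using dominatedE[OF f] by metis
  obtain c b where "0 < c" and b: "0 < b" and drift: "\<And>z :: 'm state. z \<in> energy_simplex E \<Longrightarrow>
      skeleton E (weight \<delta>) z \<le> weight \<delta> z - c * weight \<delta> z powr (1 - 1 / (2 - 4 * \<delta>)) + b"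
    using weight_drift[OF E \<delta>, where 'm='m] by blast
  define w0 where "w0 = E powr (\<delta> - 1 / 2)"
  have w0: "0 < w0" using E by (simp add: w0_def)
  have "\<bar>skeleton E f z\<bar> \<le> (q * (1 + b / w0)) * weight \<delta> z" if z: "z \<in> energy_simplex E" for z
  proof -
    have bw: "b \<le> b / w0 * weight \<delta> z"
      using weight_ge[OF z \<delta>2] w0 b by (simp add: w0_def field_simps)
    have "0 \<le> c * weight \<delta> z powr (1 - 1 / (2 - 4 * \<delta>))" using \<open>0 < c\<close> by simp
    then have "skeleton E (weight \<delta>) z \<le> (1 + b / w0) * weight \<delta> z"
      using drift[OF z] bw unfolding distrib_right by linarith
    then have K: "q * skeleton E (weight \<delta>) z \<le> (q * (1 + b / w0)) * weight \<delta> z"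
      using q(1) by (simp add: mult_left_mono mult.assoc)
    have lin: "skeleton E (\<lambda>w. a * weight \<delta> w + 0 * weight \<delta> w) z = a * skeleton E (weight \<delta>) z" for a
      using skeleton_linear[OF weight_dominated weight_dominated \<delta>(1) \<delta>2 z, of a 0] by simp
    have up: "skeleton E f z \<le> skeleton E (\<lambda>w. q * weight \<delta> w + 0 * weight \<delta> w) z"
      using q by (intro skeleton_mono[OF f dominated_linear[OF weight_dominated weight_dominated] \<delta>(1) \<delta>2 E _ z])
        (fastforce simp: abs_le_iff)
    have low: "skeleton E (\<lambda>w. (- q) * weight \<delta> w + 0 * weight \<delta> w) z \<le> skeleton E f z"
      using q by (intro skeleton_mono[OF dominated_linear[OF weight_dominated weight_dominated] f \<delta>(1) \<delta>2 E _ z])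
        (fastforce simp: abs_le_iff)
    show ?thesis using up low K unfolding lin by (simp add: abs_le_iff)
  qed
  then show ?thesis
    unfolding dominated_def using measurable_skeleton[OF dominated_measurable[OF f]] by blast
qed

context
  fixes E \<delta> :: real
  assumes E: "0 < E" and \<delta>: "0 < \<delta>" "\<delta> < 1 / 4"
begin

lemma less_half: "\<delta> < 1 / 2" using \<delta> by simp

lemma skeleton_power_dominated:
  "f \<in> dominated E \<delta> \<Longrightarrow> (skeleton E ^^ n) f \<in> dominated E \<delta>"
  by (induction n) (auto intro: skeleton_dominated[OF E \<delta>])

lemma skeleton_power_mono:
  assumes "f \<in> dominated E \<delta>" "g \<in> dominated E \<delta>" "\<And>w. w \<in> energy_simplex E \<Longrightarrow> f w \<le> g w"
    and "z \<in> energy_simplex E"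
  shows "(skeleton E ^^ n) f z \<le> (skeleton E ^^ n) g z"
  using assms(4)
proof (induction n arbitrary: z)
  case (Suc n)
  show ?case unfolding funpow.simps o_def
    by (intro skeleton_mono[OF skeleton_power_dominated[OF assms(1)] skeleton_power_dominated[OF assms(2)] \<delta>(1) less_half E]
        Suc)
qed (simp add: assms(3))

lemma skeleton_power_cong:
  assumes "f \<in> dominated E \<delta>" "g \<in> dominated E \<delta>" "\<And>w. w \<in> energy_simplex E \<Longrightarrow> f w = g w"
    and "z \<in> energy_simplex E"
  shows "(skeleton E ^^ n) f z = (skeleton E ^^ n) g z"
  using skeleton_power_mono[OF assms(1,2) _ assms(4), of n] skeleton_power_mono[OF assms(2,1) _ assms(4), of n] assms(3)
  by (simp add: order_antisym)

lemma skeleton_power_linear: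
  assumes f: "f \<in> dominated E \<delta>" and g: "g \<in> dominated E \<delta>" and z: "z \<in> energy_simplex E"
  shows "(skeleton E ^^ n) (\<lambda>w. a * f w + b * g w) z = a * (skeleton E ^^ n) f z + b * (skeleton E ^^ n) g z"
  using z
proof (induction n arbitrary: z)
  case (Suc n)
  note dom = skeleton_power_dominated
  have "skeleton E ((skeleton E ^^ n) (\<lambda>w. a * f w + b * g w)) z
      = (skeleton E ^^ 1) (\<lambda>w. a * (skeleton E ^^ n) f w + b * (skeleton E ^^ n) g w) z"
    using skeleton_power_cong[OF dom[OF dominated_linear[OF f g]] dominated_linear[OF dom[OF f] dom[OF g]] Suc.IH Suc.prems, of 1]
    by simp
  then show ?case
    using skeleton_linear[OF dom[OF f] dom[OF g] \<delta>(1) less_half Suc.prems] by simp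
qed simp

lemma skeleton_power_const:
  fixes z :: "'m::finite state" shows "(skeleton E ^^ n) (\<lambda>_. c) z = c"
proof -
  have "(skeleton E ^^ n) (\<lambda>_ :: 'm state. c) = (\<lambda>_. c)"
  proof (induction n)
    case (Suc n)
    then show ?case by (auto simp: skeleton_const)
  qed simp
  then show ?thesis by simp
qed

lemma skeleton_power_bounded:
  assumes f: "f \<in> borel_measurable (state_space E)" and M: "\<And>w. w \<in> energy_simplex E \<Longrightarrow> \<bar>f w\<bar> \<le> M"
    and z: "z \<in> energy_simplex E"
  shows "\<bar>(skeleton E ^^ n) f z\<bar> \<le> M"
proof -
  have dom: "f \<in> dominated E \<delta>" by (rule bounded_dominated[OF f M E less_half])
  have M2: "f w \<le> M" "- M \<le> f w" if "w \<in> energy_simplex E" for w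
    using M[OF that] by (auto simp: abs_le_iff)
  have "(skeleton E ^^ n) f z \<le> (skeleton E ^^ n) (\<lambda>_. M) z"
    using M2 by (intro skeleton_power_mono[OF dom const_dominated[OF E less_half] _ z])
  moreover have "(skeleton E ^^ n) (\<lambda>_. - M) z \<le> (skeleton E ^^ n) f z"
    using M2 by (intro skeleton_power_mono[OF const_dominated[OF E less_half] dom _ z])
  ultimately show ?thesis by (simp add: skeleton_power_const abs_le_iff)
qed

text \<open>
  Only the last of the \<open>n\<close> steps has to provide the gain; each of the others costs at most \<open>b\<close>.
\<close>

lemma skeleton_power_drift:
  assumes n: "0 < n"
  shows "\<exists>c>0. \<exists>b>0. \<forall>z :: 'm::finite state \<in> energy_simplex E.
    (skeleton E ^^ n) (weight \<delta>) z
      \<le> weight \<delta> z - c * weight \<delta> z powr (1 - 1 / (2 - 4 * \<delta>)) + b"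
proof -
  obtain c b where c: "0 < c" and b: "0 < b" and drift: "\<And>z :: 'm state. z \<in> energy_simplex E \<Longrightarrow>
      skeleton E (weight \<delta>) z \<le> weight \<delta> z - c * weight \<delta> z powr (1 - 1 / (2 - 4 * \<delta>)) + b"
    using weight_drift[OF E \<delta>, where 'm='m] by blast
  have affine: "(\<lambda>w. 1 * weight \<delta> w + 1 * a) \<in> dominated E \<delta>" for a
    by (rule dominated_linear[OF weight_dominated const_dominated[OF E less_half]])
  have K_affine: "skeleton E (\<lambda>w. 1 * weight \<delta> w + 1 * a) z = skeleton E (weight \<delta>) z + a"
    if "z \<in> energy_simplex E" for a and z :: "'m state"
    using skeleton_linear[OF weight_dominated const_dominated[OF E less_half, of a] \<delta>(1) less_half that, of 1 1]
    by (simp add: skeleton_const)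
  have growth: "(skeleton E ^^ k) (weight \<delta>) z \<le> 1 * weight \<delta> z + 1 * (real k * b)"
    if "z \<in> energy_simplex E" for k and z :: "'m state"
    using that
  proof (induction k arbitrary: z)
    case (Suc k)
    have "skeleton E ((skeleton E ^^ k) (weight \<delta>)) z
        \<le> skeleton E (\<lambda>w. 1 * weight \<delta> w + 1 * (real k * b)) z"
      by (intro skeleton_mono[OF skeleton_power_dominated[OF weight_dominated] affine \<delta>(1) less_half E] Suc)
    also have "\<dots> = skeleton E (weight \<delta>) z + real k * b" by (rule K_affine[OF Suc.prems])
    also have "skeleton E (weight \<delta>) z \<le> weight \<delta> z + b"
    proof -
      have "0 \<le> c * weight \<delta> z powr (1 - 1 / (2 - 4 * \<delta>))" using c by simp
      then show ?thesis using drift[OF Suc.prems] by linarith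
    qed
    finally show ?case by (simp add: algebra_simps)
  qed simp
  obtain k where k: "n = Suc k" using n by (cases n) auto
  have "(skeleton E ^^ n) (weight \<delta>) z
      \<le> weight \<delta> z - c * weight \<delta> z powr (1 - 1 / (2 - 4 * \<delta>)) + (b + real k * b)"
    if z: "z \<in> energy_simplex E" for z :: "'m state"
  proof -
    have "skeleton E ((skeleton E ^^ k) (weight \<delta>)) z
        \<le> skeleton E (\<lambda>w. 1 * weight \<delta> w + 1 * (real k * b)) z"
      by (intro skeleton_mono[OF skeleton_power_dominated[OF weight_dominated] affine \<delta>(1) less_half E] growth z)
    also have "\<dots> = skeleton E (weight \<delta>) z + real k * b" by (rule K_affine[OF z])
    finally show ?thesis using drift[OF z] by (simp add: k)
  qed
  moreover have "0 < b + real k * b" using b by (intro add_pos_nonneg) auto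
  ultimately show ?thesis using c by blast
qed

end

section \<open>Overlap of distributions\<close>

text \<open>
  A ring of particle \<open>i\<close> in terms of the energy \<open>w\<close> that it leaves in the tank.  In this parameter a ring is a
  translation, so that successive rings compose without Jacobians.
\<close>

definition ring_to :: "'m::finite \<Rightarrow> real \<Rightarrow> 'm state \<Rightarrow> 'm state" where
  "ring_to i w z = (\<chi> j. if j = i then snd z + fst z $ i - w else fst z $ j, w)"

lemma fst_ring_to: "fst (ring_to i w z) $ j = (if j = i then snd z + fst z $ i - w else fst z $ j)"
  and snd_ring_to: "snd (ring_to i w z) = w"
  by (auto simp: ring_to_def)

lemma exchange_eq_ring_to: "exchange i u z = ring_to i (u\<^sup>2 * fst z $ i) z"
  by (intro prod_eqI vec_eq_iff[THEN iffD2])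
     (auto simp: fst_exchange snd_exchange fst_ring_to snd_ring_to algebra_simps)

lemma ring_to_eq_exchange:
  assumes "0 < w" "w < fst z $ i"
  shows "ring_to i w z = exchange i (sqrt (w / fst z $ i)) z"
  using assms by (simp add: exchange_eq_ring_to)

lemma ring_to_in_simplex:
  assumes "z \<in> energy_simplex E" "0 < w" "w < fst z $ i"
  shows "ring_to i w z \<in> energy_simplex E"
  unfolding ring_to_eq_exchange[OF assms(2,3)]
  using assms by (intro exchange_in_simplex) auto

text \<open>
  For \<open>u\<close> uniform on \<open>(0, 1)\<close>, the energy \<open>w = u\<^sup>2 * x\<close> has density \<open>1 / (2 * sqrt (w * x))\<close> on \<open>(0, x)\<close>, which is at least
  \<open>1 / (2 * E)\<close>.
\<close>

lemma ring_mean_ge: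
  fixes z :: "'m::finite state"
  assumes z: "z \<in> energy_simplex E" and g[measurable]: "g \<in> borel_measurable (state_space E)"
    and g0: "\<And>w. w \<in> energy_simplex E \<Longrightarrow> 0 \<le> g w" and gM: "\<And>w. w \<in> energy_simplex E \<Longrightarrow> g w \<le> M"
    and w0: "0 \<le> w0" "w0 + \<eta> \<le> fst z $ i"
  shows "(\<integral>\<^sup>+\<tau>. ennreal (g (ring_to i (w0 + \<tau>) z)) * indicator {0<..<\<eta>} \<tau> \<partial>lborel)
    \<le> ennreal (2 * E * ring_mean i g z)"
    and "(\<lambda>\<tau>. ennreal (g (ring_to i (w0 + \<tau>) z)) * indicator {0<..<\<eta>} \<tau>) \<in> borel_measurable borel"
proof -
  define x where "x = fst z $ i"
  have x: "0 < x" "x \<le> E" using z energy_simplex_bounds[OF z] by (auto simp: mem_energy_simplex x_def intro: less_imp_le)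
  define G where "G w = ennreal (g (ring_to i w z)) * indicator {0<..<x} w" for w
  have "(\<lambda>w. sqrt (w / x)) \<in> restrict_space lborel {0<..<x} \<rightarrow>\<^sub>M lborel"
    by (intro measurable_restrict_space1) simp
  then have "(\<lambda>w. sqrt (w / x)) \<in> restrict_space lborel {0<..<x} \<rightarrow>\<^sub>M uniform01"
    using x by (intro measurable_restrict_space2) (auto simp: space_restrict_space)
  then have "(\<lambda>w. exchange i (sqrt (w / x)) z) \<in> restrict_space lborel {0<..<x} \<rightarrow>\<^sub>M state_space E"
    by (rule measurable_compose[OF _ measurable_exchange_at[OF z]])
  then have "(\<lambda>w. ennreal (g (exchange i (sqrt (w / x)) z))) \<in> borel_measurable (restrict_space lborel {0<..<x})"
    by measurable
  then have "(\<lambda>w. ennreal (g (exchange i (sqrt (w / x)) z)) * indicator {0<..<x} w) \<in> borel_measurable lborel"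
    by (subst (asm) borel_measurable_restrict_space_iff_ennreal) auto
  also have "(\<lambda>w. ennreal (g (exchange i (sqrt (w / x)) z)) * indicator {0<..<x} w) = G"
    by (auto simp: G_def fun_eq_iff indicator_def ring_to_eq_exchange x_def)
  finally have G[measurable]: "G \<in> borel_measurable borel" by simp
  have shift: "ennreal (g (ring_to i (w0 + \<tau>) z)) * indicator {0<..<\<eta>} \<tau> = G (w0 + 1 * \<tau>) * indicator {0<..<\<eta>} \<tau>" for \<tau>
    using w0 by (auto simp: G_def indicator_def x_def)
  show "(\<lambda>\<tau>. ennreal (g (ring_to i (w0 + \<tau>) z)) * indicator {0<..<\<eta>} \<tau>) \<in> borel_measurable borel"
    unfolding shift by measurable
  have "(\<integral>\<^sup>+\<tau>. ennreal (g (ring_to i (w0 + \<tau>) z)) * indicator {0<..<\<eta>} \<tau> \<partial>lborel)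
      \<le> (\<integral>\<^sup>+\<tau>. G (w0 + 1 * \<tau>) \<partial>lborel)"
    unfolding shift by (intro nn_integral_mono) (auto simp: indicator_def)
  also have "\<dots> = (\<integral>\<^sup>+w. G w \<partial>lborel)"
    by (subst nn_integral_real_affine[OF G, of 1 w0]) auto
  also have "\<dots> = (\<integral>\<^sup>+w. G w * indicator {x * 0\<^sup>2..x * 1\<^sup>2} w \<partial>lborel)"
    by (intro nn_integral_cong) (auto simp: G_def indicator_def)
  also have "\<dots> = (\<integral>\<^sup>+u. G (x * u\<^sup>2) * ennreal (x * (2 * u)) * indicator {0..1} u \<partial>lborel)"
    using x by (intro nn_integral_substitution_aux)
      (auto intro!: derivative_eq_intros continuous_intros)
  also have "\<dots> \<le> (\<integral>\<^sup>+u. ennreal (2 * x) * (ennreal (g (exchange i u z)) * indicator {0<..<1} u) \<partial>lborel)"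
  proof (intro nn_integral_mono_AE)
    show "AE u in lborel. G (x * u\<^sup>2) * ennreal (x * (2 * u)) * indicator {0..1} u
        \<le> ennreal (2 * x) * (ennreal (g (exchange i u z)) * indicator {0<..<1} u)"
      using AE_lborel_singleton[of "0::real"] AE_lborel_singleton[of "1::real"]
    proof eventually_elim
      case (elim u)
      show ?case
      proof (cases "0 < u \<and> u < 1")
        case True
        then have "x * (2 * u) \<le> 2 * x" "u\<^sup>2 < 1" using x by (auto simp: power_less_one_iff)
        then have "G (x * u\<^sup>2) = ennreal (g (exchange i u z))" "ennreal (x * (2 * u)) \<le> ennreal (2 * x)"
          using True x by (auto simp: G_def exchange_eq_ring_to x_def mult.commute intro!: ennreal_leI)
        moreover have "ennreal (g (exchange i u z)) * ennreal (x * (2 * u)) \<le> ennreal (g (exchange i u z)) * ennreal (2 * x)"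
          using calculation(2) by (rule mult_left_mono) simp
        ultimately show ?thesis using True by (simp add: mult.commute)
      qed (use elim in \<open>auto simp: indicator_def\<close>)
    qed
  qed
  also have "\<dots> = ennreal (2 * x) * (\<integral>\<^sup>+u. ennreal (g (exchange i u z)) \<partial>uniform01)"
  proof -
    have "(\<lambda>u. ennreal (g (exchange i u z))) \<in> borel_measurable uniform01"
      using measurable_compose[OF measurable_exchange_at[OF z] g] by measurable
    then have "(\<lambda>u. ennreal (g (exchange i u z)) * indicator {0<..<1} u) \<in> borel_measurable lborel"
      by (subst (asm) borel_measurable_restrict_space_iff_ennreal) auto
    then show ?thesis by (subst nn_integral_cmult) (auto simp: nn_integral_restrict_space)
  qed
  also have "(\<integral>\<^sup>+u. ennreal (g (exchange i u z)) \<partial>uniform01) = ennreal (ring_mean i g z)"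
    unfolding ring_mean_def
  proof (rule nn_integral_eq_integral)
    have "norm (g (exchange i u z)) \<le> M" if "u \<in> space uniform01" for u
      using g0 gM exchange_in_simplex[OF z, of u i] that by (auto simp: space_restrict_space)
    then show "integrable uniform01 (\<lambda>u. g (exchange i u z))"
      by (intro uniform01.integrable_const_bound[of _ M] AE_I2 measurable_compose[OF measurable_exchange_at[OF z] g])
    show "AE u in uniform01. 0 \<le> g (exchange i u z)"
      using exchange_in_simplex[OF z, of _ i] g0 by (intro AE_I2) (auto simp: space_restrict_space)
  qed
  also have "ennreal (2 * x) * ennreal (ring_mean i g z) \<le> ennreal (2 * E * ring_mean i g z)"
  proof -
    have "0 \<le> ring_mean i g z" unfolding ring_mean_def
      using exchange_in_simplex[OF z, of _ i] g0 by (intro integral_nonneg_AE AE_I2) (auto simp: space_restrict_space)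
    then show ?thesis using x by (subst ennreal_mult[symmetric]) (auto intro!: ennreal_leI mult_right_mono)
  qed
  finally show "(\<integral>\<^sup>+\<tau>. ennreal (g (ring_to i (w0 + \<tau>) z)) * indicator {0<..<\<eta>} \<tau> \<partial>lborel)
    \<le> ennreal (2 * E * ring_mean i g z)" .
qed

definition bounded_nonneg :: "real \<Rightarrow> ('m::finite state \<Rightarrow> real) set" where
  "bounded_nonneg E = {g \<in> borel_measurable (state_space E).
     (\<forall>w\<in>energy_simplex E. 0 \<le> g w) \<and> (\<exists>M. \<forall>w\<in>energy_simplex E. g w \<le> M)}"

text \<open>
  The two states may use windows for \<open>w\<close> at different positions.  This is what allows a ring to bring different
  energies to a common value.
\<close>

lemma ring_overlap:
  fixes z z' :: "'m::finite state"
  assumes E: "0 < E" and z: "z \<in> energy_simplex E" "z' \<in> energy_simplex E"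
    and g: "g1 \<in> bounded_nonneg E" "g2 \<in> bounded_nonneg E"
    and w0: "0 \<le> w0" "w0 + \<eta> \<le> fst z $ i" "0 \<le> w0'" "w0' + \<eta> \<le> fst z' $ i" and \<eta>: "0 < \<eta>" and q: "0 \<le> q"
    and overlap: "\<And>\<tau>. 0 < \<tau> \<Longrightarrow> \<tau> < \<eta> \<Longrightarrow> q \<le> g1 (ring_to i (w0 + \<tau>) z) + g2 (ring_to i (w0' + \<tau>) z')"
  shows "sqrt \<eta> / max_rate TYPE('m) E / (2 * E) * \<eta> * q \<le> skeleton E g1 z + skeleton E g2 z'"
proof -
  define \<Lambda> where "\<Lambda> = max_rate TYPE('m) E"
  have \<Lambda>: "0 < \<Lambda>" using max_rate_pos[OF E] by (simp add: \<Lambda>_def)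
  have ge: "sqrt \<eta> / \<Lambda> * ring_mean i g z \<le> skeleton E g z \<and> 0 \<le> ring_mean i g z"
    if g: "g \<in> bounded_nonneg E" and z: "z \<in> energy_simplex E" and x: "\<eta> \<le> fst z $ i" for g and z :: "'m state"
  proof -
    have nn: "0 \<le> ring_mean j g z" for j unfolding ring_mean_def
      using exchange_in_simplex[OF z, of _ j] g by (intro integral_nonneg_AE AE_I2) (auto simp: space_restrict_space bounded_nonneg_def)
    have sq: "0 \<le> sqrt (fst z $ j)" for j using z by (auto simp: mem_energy_simplex intro: less_imp_le)
    have "sqrt \<eta> / \<Lambda> * ring_mean i g z \<le> sqrt (fst z $ i) / \<Lambda> * ring_mean i g z"
      using x \<Lambda> nn by (intro mult_right_mono divide_right_mono) auto
    also have "\<dots> \<le> (\<Sum>j\<in>UNIV. sqrt (fst z $ j) / \<Lambda> * ring_mean j g z)"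
      using nn sq \<Lambda> by (intro member_le_sum) auto
    also have "\<dots> \<le> skeleton E g z"
      unfolding skeleton_convex_form[OF E] \<Lambda>_def[symmetric]
      using total_rate_le[OF z] \<Lambda> g z by (simp add: \<Lambda>_def bounded_nonneg_def)
    finally show ?thesis using nn by simp
  qed
  obtain M1 M2 where M: "\<And>w. w \<in> energy_simplex E \<Longrightarrow> g1 w \<le> M1" "\<And>w. w \<in> energy_simplex E \<Longrightarrow> g2 w \<le> M2"
    using g unfolding bounded_nonneg_def by blast
  have m: "g1 \<in> borel_measurable (state_space E)" "g2 \<in> borel_measurable (state_space E)"
    "\<And>w. w \<in> energy_simplex E \<Longrightarrow> 0 \<le> g1 w" "\<And>w. w \<in> energy_simplex E \<Longrightarrow> 0 \<le> g2 w"
    using g by (auto simp: bounded_nonneg_def)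
  note R1 = ring_mean_ge[OF z(1) m(1,3) M(1) w0(1,2)]
  note R2 = ring_mean_ge[OF z(2) m(2,4) M(2) w0(3,4)]
  have x: "\<eta> \<le> fst z $ i" "\<eta> \<le> fst z' $ i" using w0 by linarith+
  note G1 = ge[OF g(1) z(1) x(1)] and G2 = ge[OF g(2) z(2) x(2)]
  have "ennreal (q * \<eta>) = (\<integral>\<^sup>+\<tau>. ennreal q * indicator {0<..<\<eta>} \<tau> \<partial>lborel)"
    using \<eta> q by (simp add: nn_integral_cmult_indicator ennreal_mult)
  also have "\<dots> \<le> (\<integral>\<^sup>+\<tau>. ennreal (g1 (ring_to i (w0 + \<tau>) z)) * indicator {0<..<\<eta>} \<tau>
      + ennreal (g2 (ring_to i (w0' + \<tau>) z')) * indicator {0<..<\<eta>} \<tau> \<partial>lborel)"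
  proof (intro nn_integral_mono)
    fix \<tau>
    show "ennreal q * indicator {0<..<\<eta>} \<tau> \<le> ennreal (g1 (ring_to i (w0 + \<tau>) z)) * indicator {0<..<\<eta>} \<tau>
      + ennreal (g2 (ring_to i (w0' + \<tau>) z')) * indicator {0<..<\<eta>} \<tau>"
    proof (cases "\<tau> \<in> {0<..<\<eta>}")
      case True
      have "0 \<le> g1 (ring_to i (w0 + \<tau>) z)" "0 \<le> g2 (ring_to i (w0' + \<tau>) z')"
        using True w0 z by (auto intro!: m ring_to_in_simplex)
      then show ?thesis using True overlap[of \<tau>] by (simp add: ennreal_plus[symmetric] del: ennreal_plus)
    qed simp
  qed
  also have "\<dots> = (\<integral>\<^sup>+\<tau>. ennreal (g1 (ring_to i (w0 + \<tau>) z)) * indicator {0<..<\<eta>} \<tau> \<partial>lborel)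
      + (\<integral>\<^sup>+\<tau>. ennreal (g2 (ring_to i (w0' + \<tau>) z')) * indicator {0<..<\<eta>} \<tau> \<partial>lborel)"
    using R1(2) R2(2) by (intro nn_integral_add) auto
  also have "\<dots> \<le> ennreal (2 * E * ring_mean i g1 z) + ennreal (2 * E * ring_mean i g2 z')"
    using R1(1) R2(1) by (intro add_mono)
  also have "\<dots> = ennreal (2 * E * (ring_mean i g1 z + ring_mean i g2 z'))"
    using G1 G2 E by (simp add: ennreal_plus[symmetric] distrib_left del: ennreal_plus)
  finally have "q * \<eta> \<le> 2 * E * (ring_mean i g1 z + ring_mean i g2 z')"
    using G1 G2 E by (subst (asm) ennreal_le_iff) auto
  then have "\<eta> * q / (2 * E) \<le> ring_mean i g1 z + ring_mean i g2 z'"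
    using E by (simp add: field_simps)
  then have "sqrt \<eta> / \<Lambda> * (\<eta> * q / (2 * E)) \<le> sqrt \<eta> / \<Lambda> * (ring_mean i g1 z + ring_mean i g2 z')"
    using \<Lambda> \<eta> by (intro mult_left_mono) auto
  also have "\<dots> \<le> skeleton E g1 z + skeleton E g2 z'"
    using G1 G2 by (simp add: distrib_left)
  finally show ?thesis by (simp add: \<Lambda>_def)
qed

lemma skeleton_power_bounded_nonneg:
  fixes g :: "'m::finite state \<Rightarrow> real"
  assumes E: "0 < E" and g: "g \<in> bounded_nonneg E"
  shows "(skeleton E ^^ n) g \<in> bounded_nonneg E"
proof -
  have \<delta>: "0 < (1/8::real)" "1/8 < (1/4::real)" by auto
  have m: "g \<in> borel_measurable (state_space E)" and g0: "\<And>w. w \<in> energy_simplex E \<Longrightarrow> 0 \<le> g w"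
    using g by (auto simp: bounded_nonneg_def)
  obtain M where M: "\<And>w. w \<in> energy_simplex E \<Longrightarrow> g w \<le> M"
    using g by (auto simp: bounded_nonneg_def)
  have gM: "\<bar>g w\<bar> \<le> M" if "w \<in> energy_simplex E" for w
    using M[OF that] g0[OF that] by simp
  have dom: "g \<in> dominated E (1/8)" by (rule bounded_dominated[OF m gM E]) auto
  have meas: "(skeleton E ^^ n) g \<in> borel_measurable (state_space E)"
    by (rule dominated_measurable[OF skeleton_power_dominated[OF E \<delta> dom]])
  have "0 \<le> (skeleton E ^^ n) g z" if "z \<in> energy_simplex E" for z
    using skeleton_power_mono[OF E \<delta> const_dominated[OF E, of "1/8" 0] dom _ that, of n] g0
    by (simp add: skeleton_power_const[OF E \<delta>])
  moreover have "(skeleton E ^^ n) g z \<le> M" if "z \<in> energy_simplex E" for z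
    using skeleton_power_bounded[OF E \<delta> m gM that, of n] by simp
  ultimately show ?thesis unfolding bounded_nonneg_def using meas by blast
qed

text \<open>
  Particle \<open>h\<close> is a hub.  Ringing \<open>h\<close> sets the tank of both states to the same value \<open>v < \<eta>\<close>.  Ringing \<open>j\<close> next sets the
  energy of \<open>j\<close> in both states to the same value \<open>2 * \<eta> - \<tau>\<close> between \<open>\<eta>\<close> and \<open>2 * \<eta>\<close>.  When this has been done for all
  \<open>j\<close> on the list, a last ring of \<open>h\<close> makes the states equal, because the energy of \<open>h\<close> is what remains of the
  total.  The hub stays able to ring: refreshed particles started at \<open>2 * \<eta>\<close> or more and end below, so hub and tank
  together never fall under \<open>2 * \<eta>\<close>.
\<close>

lemma refresh_overlap:
  fixes z z' :: "'m::finite state"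
  assumes E: "0 < E" and \<eta>: "0 < \<eta>" and dist: "distinct js" "h \<notin> set js"
    and z: "z \<in> energy_simplex E" "z' \<in> energy_simplex E"
    and hub: "\<eta> \<le> fst z $ h" "\<eta> \<le> fst z' $ h" "2 * \<eta> \<le> fst z $ h + snd z" "2 * \<eta> \<le> fst z' $ h + snd z'"
    and others: "\<And>j. j \<in> set js \<Longrightarrow> 2 * \<eta> \<le> fst z $ j" "\<And>j. j \<in> set js \<Longrightarrow> 2 * \<eta> \<le> fst z' $ j"
    and agree: "\<And>j. j \<noteq> h \<Longrightarrow> j \<notin> set js \<Longrightarrow> fst z $ j = fst z' $ j"
    and g: "g1 \<in> bounded_nonneg E" "g2 \<in> bounded_nonneg E" "\<And>w. w \<in> energy_simplex E \<Longrightarrow> 1 \<le> g1 w + g2 w"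
  shows "(sqrt \<eta> / max_rate TYPE('m) E / (2 * E) * \<eta>) ^ (2 * length js + 1)
    \<le> (skeleton E ^^ (2 * length js + 1)) g1 z + (skeleton E ^^ (2 * length js + 1)) g2 z'"
  using dist z hub others agree
proof (induction js arbitrary: z z')
  case Nil
  have eq: "ring_to h (0 + \<tau>) z = ring_to h (0 + \<tau>) z'" for \<tau>
  proof -
    have "snd z + (fst z $ h + (\<Sum>j\<in>UNIV - {h}. fst z $ j)) = snd z' + (fst z' $ h + (\<Sum>j\<in>UNIV - {h}. fst z' $ j))"
      using Nil.prems(3,4) by (simp add: mem_energy_simplex sum.remove[of UNIV h, symmetric])
    moreover have "(\<Sum>j\<in>UNIV - {h}. fst z $ j) = (\<Sum>j\<in>UNIV - {h}. fst z' $ j)"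
      using Nil.prems by (intro sum.cong) auto
    ultimately have "snd z + fst z $ h = snd z' + fst z' $ h" by simp
    then show ?thesis using Nil.prems by (auto simp: ring_to_def vec_eq_iff)
  qed
  have "sqrt \<eta> / max_rate TYPE('m) E / (2 * E) * \<eta> * 1 \<le> skeleton E g1 z + skeleton E g2 z'"
  proof (rule ring_overlap[OF E Nil.prems(3,4) g(1,2), of 0 \<eta> h 0])
    fix \<tau> assume "0 < \<tau>" "\<tau> < \<eta>"
    then have "ring_to h (0 + \<tau>) z' \<in> energy_simplex E"
      using Nil.prems by (intro ring_to_in_simplex) auto
    then show "1 \<le> g1 (ring_to h (0 + \<tau>) z) + g2 (ring_to h (0 + \<tau>) z')"
      unfolding eq by (rule g(3))
  qed (use Nil.prems \<eta> in auto)
  then show ?case by simp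
next
  case (Cons i js)
  define \<kappa> where "\<kappa> = sqrt \<eta> / max_rate TYPE('m) E / (2 * E) * \<eta>"
  have \<kappa>: "0 \<le> \<kappa>" using \<eta> E max_rate_pos[OF E, where 'm='m] by (simp add: \<kappa>_def)
  define N where "N = 2 * length js + 1"
  define f1 f2 where "f1 = (skeleton E ^^ N) g1" and "f2 = (skeleton E ^^ N) g2"
  have f: "f1 \<in> bounded_nonneg E" "f2 \<in> bounded_nonneg E"
    using g skeleton_power_bounded_nonneg[OF E] by (auto simp: f1_def f2_def)
  have Kf: "skeleton E f1 \<in> bounded_nonneg E" "skeleton E f2 \<in> bounded_nonneg E"
    using f skeleton_power_bounded_nonneg[OF E, of _ 1] by auto
  have ih: "i \<noteq> h" "i \<notin> set js" "distinct js" "h \<notin> set js" using Cons.prems by auto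
  have "\<kappa> * (\<kappa> * \<kappa> ^ N) \<le> skeleton E (skeleton E f1) z + skeleton E (skeleton E f2) z'"
  proof (rule ring_overlap[OF E Cons.prems(3,4) Kf, of 0 \<eta> h 0, folded \<kappa>_def])
    fix v assume v: "0 < v" "v < \<eta>"
    define y y' where "y = ring_to h v z" and "y' = ring_to h v z'"
    have y: "y \<in> energy_simplex E" "y' \<in> energy_simplex E"
      unfolding y_def y'_def using v Cons.prems by (auto intro!: ring_to_in_simplex)
    have yi: "fst y $ i = fst z $ i" "fst y' $ i = fst z' $ i" "snd y = v" "snd y' = v"
      using ih by (auto simp: y_def y'_def fst_ring_to snd_ring_to)
    have big: "2 * \<eta> \<le> fst z $ i" "2 * \<eta> \<le> fst z' $ i" using Cons.prems by auto
    have "\<kappa> * \<kappa> ^ N \<le> skeleton E f1 y + skeleton E f2 y'"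
    proof (rule ring_overlap[OF E y f, of "v + fst z $ i - 2 * \<eta>" \<eta> i "v + fst z' $ i - 2 * \<eta>", folded \<kappa>_def])
      fix \<tau> assume \<tau>: "0 < \<tau>" "\<tau> < \<eta>"
      have total: "4 * \<eta> \<le> snd z + (fst z $ h + (fst z $ i + \<tau>))"
        "4 * \<eta> \<le> snd z' + (fst z' $ h + (fst z' $ i + \<tau>))"
        using Cons.prems(7,8) big \<tau> by linarith+
      show "\<kappa> ^ N \<le> f1 (ring_to i (v + fst z $ i - 2 * \<eta> + \<tau>) y) + f2 (ring_to i (v + fst z' $ i - 2 * \<eta> + \<tau>) y')"
        unfolding f1_def f2_def N_def \<kappa>_def
      proof (rule Cons.IH[OF ih(3,4)])
        show "ring_to i (v + fst z $ i - 2 * \<eta> + \<tau>) y \<in> energy_simplex E"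
          "ring_to i (v + fst z' $ i - 2 * \<eta> + \<tau>) y' \<in> energy_simplex E"
          using y yi big v \<tau> by (auto intro!: ring_to_in_simplex)
      next
        fix j assume "j \<noteq> h" "j \<notin> set js"
        then show "fst (ring_to i (v + fst z $ i - 2 * \<eta> + \<tau>) y) $ j
            = fst (ring_to i (v + fst z' $ i - 2 * \<eta> + \<tau>) y') $ j"
          using yi Cons.prems(11)[of j] by (auto simp: fst_ring_to y_def y'_def)
      qed (use ih Cons.prems v \<tau> total in \<open>auto simp: fst_ring_to snd_ring_to y_def y'_def\<close>)
    qed (use v \<eta> yi big \<kappa> in auto)
    then show "\<kappa> * \<kappa> ^ N \<le> skeleton E f1 (ring_to h (0 + v) z) + skeleton E f2 (ring_to h (0 + v) z')"
      by (simp add: y_def y'_def)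
  qed (use Cons.prems \<eta> \<kappa> in auto)
  then show ?case by (simp add: \<kappa>_def f1_def f2_def N_def)
qed


lemma weight_le_imp_energy_ge:
  assumes z: "z \<in> energy_simplex E" and \<delta>: "0 < \<delta>" "\<delta> < 1 / 2" and d: "weight \<delta> z \<le> d" "0 < d"
  shows "d powr (1 / (2 * \<delta> - 1)) \<le> fst z $ i"
proof -
  have x: "0 < fst z $ i" using z by (simp add: mem_energy_simplex)
  have "fst z $ i powr (2 * \<delta> - 1) \<le> (\<Sum>k\<in>UNIV. fst z $ k powr (2 * \<delta> - 1))"
    by (intro member_le_sum) auto
  also have "\<dots> \<le> weight \<delta> z" by (simp add: weight_def)
  finally have "fst z $ i powr (2 * \<delta> - 1) \<le> d" using d by simp
  then have "d powr (1 / (2 * \<delta> - 1)) \<le> (fst z $ i powr (2 * \<delta> - 1)) powr (1 / (2 * \<delta> - 1))"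
    using \<delta> x by (intro powr_mono2') auto
  also have "\<dots> = fst z $ i" using \<delta> x by (simp add: powr_powr)
  finally show ?thesis .
qed

text \<open>
  The distributions after \<open>n\<close> steps share mass \<open>\<epsilon>\<close>.  In this dual form no common component has to be exhibited.
\<close>

definition overlapping :: "real \<Rightarrow> nat \<Rightarrow> real \<Rightarrow> 'm::finite state \<Rightarrow> 'm state \<Rightarrow> bool" where
  "overlapping E n \<epsilon> z z' \<longleftrightarrow> (\<forall>g1\<in>bounded_nonneg E. \<forall>g2\<in>bounded_nonneg E.
     (\<forall>w\<in>energy_simplex E. 1 \<le> g1 w + g2 w) \<longrightarrow> \<epsilon> \<le> (skeleton E ^^ n) g1 z + (skeleton E ^^ n) g2 z')"

lemma skeleton_overlap:
  fixes E \<delta> :: real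
  assumes E: "0 < E" and \<delta>: "0 < \<delta>" "\<delta> < 1 / 2"
  shows "\<exists>N>0. \<forall>d. \<exists>\<epsilon>>0. \<forall>z\<in>energy_simplex E. \<forall>z' :: 'm::finite state \<in> energy_simplex E.
    weight \<delta> z \<le> d \<longrightarrow> weight \<delta> z' \<le> d \<longrightarrow> overlapping E N \<epsilon> z z'"
proof -
  obtain h :: 'm where True by simp
  obtain js where js: "set js = UNIV - {h}" "distinct js"
    using finite_distinct_list[of "UNIV - {h}"] by auto
  have "\<exists>\<epsilon>>0. \<forall>z\<in>energy_simplex E. \<forall>z' :: 'm state \<in> energy_simplex E.
    weight \<delta> z \<le> d \<longrightarrow> weight \<delta> z' \<le> d \<longrightarrow> overlapping E (2 * length js + 1) \<epsilon> z z'" for d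
  proof -
    define \<eta> where "\<eta> = (max d 1) powr (1 / (2 * \<delta> - 1)) / 2"
    have \<eta>: "0 < \<eta>" by (simp add: \<eta>_def)
    define \<kappa> where "\<kappa> = sqrt \<eta> / max_rate TYPE('m) E / (2 * E) * \<eta>"
    have \<kappa>: "0 < \<kappa>" using \<eta> E max_rate_pos[OF E, where 'm='m] by (simp add: \<kappa>_def)
    have big: "2 * \<eta> \<le> fst z $ i" if "z \<in> energy_simplex E" "weight \<delta> z \<le> d" for z :: "'m state" and i
      using weight_le_imp_energy_ge[OF that(1) \<delta>, of "max d 1" i] that by (simp add: \<eta>_def)
    show ?thesis
    proof (intro exI[of _ "\<kappa> ^ (2 * length js + 1)"] conjI ballI impI)
      fix z z' :: "'m state"
      assume z: "z \<in> energy_simplex E" "z' \<in> energy_simplex E"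
        and d: "weight \<delta> z \<le> d" "weight \<delta> z' \<le> d"
      have "0 < snd z" "0 < snd z'" using z by (auto simp: mem_energy_simplex)
      then have hub: "\<eta> \<le> fst z $ h" "\<eta> \<le> fst z' $ h" "2 * \<eta> \<le> fst z $ h + snd z" "2 * \<eta> \<le> fst z' $ h + snd z'"
        using big[OF z(1) d(1), of h] big[OF z(2) d(2), of h] \<eta> by linarith+
      show "overlapping E (2 * length js + 1) (\<kappa> ^ (2 * length js + 1)) z z'"
        unfolding overlapping_def \<kappa>_def using js z \<eta> big[OF z(1) d(1)] big[OF z(2) d(2)] hub
        by (intro ballI impI refresh_overlap[OF E \<eta>, where h=h]) auto
    qed (use \<kappa> in simp)
  qed
  then show ?thesis by (intro exI[of _ "2 * length js + 1"]) auto
qed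

section \<open>Decay of oscillations along the jump chain\<close>

text \<open>
  Subtracting a constant turns a bound on differences into a bound on one function, which can be integrated
  against each of two distributions separately.  The constant is half \<open>a0\<close> below the largest \<open>c\<close> with
  \<open>c \<le> a0 + a1 * V w + g w\<close> for all \<open>w\<close>.
\<close>

lemma oscillation_centre:
  fixes g V :: "'a \<Rightarrow> real"
  assumes osc: "osc_bounded S V a0 a1 g"
    and bdd: "\<And>w. w \<in> S \<Longrightarrow> B \<le> g w" and a1: "0 \<le> a1" and V: "\<And>w. w \<in> S \<Longrightarrow> 0 \<le> V w" and a0: "0 \<le> a0"
  shows "\<exists>c. \<forall>w\<in>S. \<bar>g w - c\<bar> \<le> a0 / 2 + a1 * V w"
proof (cases "S = {}")
  case False
  define c where "c = (INF w\<in>S. a0 + a1 * V w + g w)"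
  have "bdd_below ((\<lambda>w. a0 + a1 * V w + g w) ` S)"
  proof (rule bdd_belowI2)
    fix w assume "w \<in> S"
    then show "B \<le> a0 + a1 * V w + g w"
      using bdd V a1 a0 mult_nonneg_nonneg[of a1 "V w"] by fastforce
  qed
  then have le: "c \<le> a0 + a1 * V w + g w" if "w \<in> S" for w
    unfolding c_def using that by (rule cINF_lower)
  have ge: "g w - a1 * V w \<le> c" if w: "w \<in> S" for w
    unfolding c_def
  proof (rule cINF_greatest[OF False])
    fix w' assume "w' \<in> S"
    then show "g w - a1 * V w \<le> a0 + a1 * V w' + g w'"
      using osc w by (fastforce simp: osc_bounded_def abs_le_iff algebra_simps)
  qed
  have "\<bar>g w - (c - a0 / 2)\<bar> \<le> a0 / 2 + a1 * V w" if "w \<in> S" for w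
    using le[OF that] ge[OF that] by (simp add: abs_le_iff)
  then show ?thesis by blast
qed simp

context
  fixes E \<delta> :: real
  assumes E: "0 < E" and \<delta>: "0 < \<delta>" "\<delta> < 1 / 4"
begin

lemma skeleton_power_affine_weight:
  assumes z: "z \<in> energy_simplex E"
  shows "(skeleton E ^^ n) (\<lambda>w. a0 * 1 + a1 * weight \<delta> w) z = a0 + a1 * (skeleton E ^^ n) (weight \<delta>) z"
proof -
  have "\<delta> < 1 / 2" using \<delta> by simp
  then show ?thesis
    using skeleton_power_linear[OF E \<delta> const_dominated[OF E, where c=1] weight_dominated z, where a=a0 and b=a1 and n=n]
    by (simp add: skeleton_power_const[OF E \<delta>])
qed

lemma skeleton_oscillation_far:
  fixes g :: "'m::finite state \<Rightarrow> real"
  assumes g: "g \<in> borel_measurable (state_space E)" "\<And>w. w \<in> energy_simplex E \<Longrightarrow> \<bar>g w\<bar> \<le> M"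
    and a: "0 \<le> a0" "0 \<le> a1"
    and osc: "osc_bounded (energy_simplex E) (weight \<delta>) a0 a1 g"
    and z: "z \<in> energy_simplex E" "z' \<in> energy_simplex E"
  shows "\<bar>(skeleton E ^^ n) g z - (skeleton E ^^ n) g z'\<bar>
    \<le> a0 + a1 * ((skeleton E ^^ n) (weight \<delta>) z + (skeleton E ^^ n) (weight \<delta>) z')"
proof -
  let ?K = "skeleton E ^^ n" and ?V = "weight \<delta> :: 'm state \<Rightarrow> real"
  have \<delta>2: "\<delta> < 1 / 2" using \<delta> by simp
  have dom: "g \<in> dominated E \<delta>" by (rule bounded_dominated[OF g E \<delta>2])
  have "- M \<le> g w" if "w \<in> energy_simplex E" for w using g(2)[OF that] by linarith
  then obtain c where c: "\<forall>w\<in>energy_simplex E. \<bar>g w - c\<bar> \<le> a0 / 2 + a1 * ?V w"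
    using oscillation_centre[where g=g and S="energy_simplex E" and B="- M" and V="?V", OF osc] a weight_nonneg by blast
  have aff: "(\<lambda>w. b0 * 1 + b1 * ?V w) \<in> dominated E \<delta>" for b0 b1
    by (rule dominated_linear[OF const_dominated[OF E \<delta>2] weight_dominated])
  have "?K g x \<le> ?K (\<lambda>w. (c + a0 / 2) * 1 + a1 * ?V w) x" if "x \<in> energy_simplex E" for x
    using c that by (intro skeleton_power_mono[OF E \<delta> dom aff]) (auto simp: abs_le_iff algebra_simps)
  moreover have "?K (\<lambda>w. (c - a0 / 2) * 1 + (- a1) * ?V w) x \<le> ?K g x" if "x \<in> energy_simplex E" for x
    using c that by (intro skeleton_power_mono[OF E \<delta> aff dom]) (auto simp: abs_le_iff algebra_simps)
  ultimately have up_low: "?K g x \<le> (c + a0 / 2) + a1 * ?K ?V x" "(c - a0 / 2) + (- a1) * ?K ?V x \<le> ?K g x"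
    if "x \<in> energy_simplex E" for x
    using that unfolding skeleton_power_affine_weight[OF that, symmetric] by blast+
  have "\<bar>?K g x - c\<bar> \<le> a0 / 2 + a1 * ?K ?V x" if "x \<in> energy_simplex E" for x
    using up_low[OF that] by (simp add: abs_le_iff)
  from this[OF z(1)] this[OF z(2)] show ?thesis by (simp add: abs_le_iff distrib_left)
qed

text \<open>
  With the centre \<open>c\<close> of \<open>g\<close>, both functions \<open>a0 / 2 + a1 * V - (g - c)\<close> and \<open>a0 / 2 + a1 * V + (g - c)\<close> are nonnegative and
  their sum is at least \<open>a0\<close>.  By the overlap, the mean of the first from \<open>z\<close> plus the mean of the second from
  \<open>z'\<close> is at least \<open>\<epsilon> * a0\<close>.  Without the overlap it is only known to be nonnegative.
\<close>

lemma skeleton_oscillation_near: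
  fixes g :: "'m::finite state \<Rightarrow> real"
  assumes g: "g \<in> borel_measurable (state_space E)" "\<And>w. w \<in> energy_simplex E \<Longrightarrow> \<bar>g w\<bar> \<le> M"
    and a: "0 < a0" "0 \<le> a1"
    and osc: "osc_bounded (energy_simplex E) (weight \<delta>) a0 a1 g"
    and z: "z \<in> energy_simplex E" "z' \<in> energy_simplex E"
    and overlap: "overlapping E n \<epsilon> z z'"
  shows "(skeleton E ^^ n) g z - (skeleton E ^^ n) g z'
    \<le> (1 - \<epsilon>) * a0 + a1 * ((skeleton E ^^ n) (weight \<delta>) z + (skeleton E ^^ n) (weight \<delta>) z')"
proof -
  let ?K = "skeleton E ^^ n" and ?V = "weight \<delta> :: 'm state \<Rightarrow> real"
  have \<delta>2: "\<delta> < 1 / 2" using \<delta> by simp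
  have dom: "g \<in> dominated E \<delta>" by (rule bounded_dominated[OF g E \<delta>2])
  have "- M \<le> g w" if "w \<in> energy_simplex E" for w using g(2)[OF that] by linarith
  then obtain c where c: "\<forall>w\<in>energy_simplex E. \<bar>g w - c\<bar> \<le> a0 / 2 + a1 * ?V w"
    using oscillation_centre[where g=g and S="energy_simplex E" and B="- M" and V="?V", OF osc] a weight_nonneg by fastforce
  have aff: "(\<lambda>w. b0 * 1 + b1 * ?V w) \<in> dominated E \<delta>" for b0 b1
    by (rule dominated_linear[OF const_dominated[OF E \<delta>2] weight_dominated])
  define up where "up s w = 1 * ((a0 / 2 - s * c) * 1 + a1 * ?V w) + s * g w" for s w
  have up_dom: "up s \<in> dominated E \<delta>" for s
    unfolding up_def by (rule dominated_linear[OF aff dom])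
  have up_nonneg: "0 \<le> up 1 w" "0 \<le> up (- 1) w" if "w \<in> energy_simplex E" for w
    using c that by (auto simp: up_def abs_le_iff algebra_simps)
  have K_up: "?K (up s) x = a0 / 2 - s * c + a1 * ?K ?V x + s * ?K g x" if "x \<in> energy_simplex E" for s x
    unfolding up_def skeleton_power_linear[OF E \<delta> aff dom that] skeleton_power_affine_weight[OF that] by simp
  \<comment> \<open>Truncation at \<open>a0\<close> gives bounded test functions and keeps the sum at least \<open>a0\<close>.\<close>
  define cut where "cut s w = min (up s w / a0) 1" for s w
  have cut_nonneg: "cut s \<in> bounded_nonneg E" if "s = 1 \<or> s = - 1" for s
    using dominated_measurable[OF up_dom[of s]] up_nonneg a that
    unfolding bounded_nonneg_def cut_def by (auto intro!: exI[of _ 1])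
  have cut_dom: "cut s \<in> dominated E \<delta>" if "s = 1 \<or> s = - 1" for s
  proof (rule bounded_dominated[OF _ _ E \<delta>2, where M=1])
    show "cut s \<in> borel_measurable (state_space E)"
      using cut_nonneg[OF that] by (simp add: bounded_nonneg_def)
    show "\<bar>cut s w\<bar> \<le> 1" if "w \<in> energy_simplex E" for w
      using up_nonneg[OF that] a \<open>s = 1 \<or> s = - 1\<close> by (auto simp: cut_def)
  qed
  have K_cut: "a0 * ?K (cut s) x \<le> ?K (up s) x" if "s = 1 \<or> s = - 1" "x \<in> energy_simplex E" for s x
  proof -
    have "?K (\<lambda>w. a0 * cut s w + 0 * cut s w) x \<le> ?K (up s) x"
    proof (intro skeleton_power_mono[OF E \<delta> dominated_linear[OF cut_dom[OF that(1)] cut_dom[OF that(1)]] up_dom] that)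
      fix w
      have "a0 * cut s w \<le> a0 * (up s w / a0)" using a unfolding cut_def by (intro mult_left_mono) auto
      then show "a0 * cut s w + 0 * cut s w \<le> up s w" using a by simp
    qed
    then show ?thesis
      using skeleton_power_linear[OF E \<delta> cut_dom[OF that(1)] cut_dom[OF that(1)] that(2), of n a0 0] by simp
  qed
  have sum1: "1 \<le> cut (- 1) w + cut 1 w" if w: "w \<in> energy_simplex E" for w
  proof -
    have V: "0 \<le> a1 * ?V w" using a weight_nonneg[of \<delta> w] by simp
    have "up (- 1) w + up 1 w = a0 + 2 * (a1 * ?V w)" by (simp add: up_def algebra_simps)
    then have "a0 \<le> up (- 1) w + up 1 w" using V by linarith
    then have "1 \<le> up (- 1) w / a0 + up 1 w / a0"
      using a by (simp add: add_divide_distrib[symmetric] pos_le_divide_eq)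
    moreover have "0 \<le> up (- 1) w / a0" "0 \<le> up 1 w / a0" using up_nonneg[OF w] a by auto
    ultimately show ?thesis by (simp add: cut_def min_def)
  qed
  have "\<epsilon> \<le> ?K (cut (- 1)) z + ?K (cut 1) z'"
    using sum1 overlap cut_nonneg[of 1] cut_nonneg[of "- 1"] unfolding overlapping_def by blast
  then have "a0 * \<epsilon> \<le> a0 * ?K (cut (- 1)) z + a0 * ?K (cut 1) z'"
    using mult_left_mono[of \<epsilon> "?K (cut (- 1)) z + ?K (cut 1) z'" a0] a by (simp add: distrib_left)
  also have "\<dots> \<le> ?K (up (- 1)) z + ?K (up 1) z'"
    using z by (intro add_mono K_cut) auto
  also have "\<dots> = a0 + a1 * (?K ?V z + ?K ?V z') - (?K g z - ?K g z')"
    unfolding K_up[OF z(1)] K_up[OF z(2)] by (simp add: algebra_simps)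
  finally show ?thesis by (simp add: algebra_simps)
qed

text \<open>
  The contraction is applied to the power \<open>K ^^ N\<close> for which the overlap holds; the \<open>n mod N\<close> steps left over are
  absorbed into \<open>f\<close>, whose bound they preserve.
\<close>

theorem skeleton_oscillation_decay:
  "\<exists>C\<ge>0. \<forall>(f :: 'm::finite state \<Rightarrow> real) M n z z'. f \<in> borel_measurable (state_space E) \<longrightarrow>
     (\<forall>w\<in>energy_simplex E. \<bar>f w\<bar> \<le> M) \<longrightarrow> z \<in> energy_simplex E \<longrightarrow> z' \<in> energy_simplex E \<longrightarrow>
     \<bar>(skeleton E ^^ n) f z - (skeleton E ^^ n) f z'\<bar>
       \<le> M * C * (1 + weight \<delta> z + weight \<delta> z') / (real n + 1) powr (2 - 4 * \<delta>)"
proof -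
  let ?S = "energy_simplex E :: 'm state set" and ?V = "weight \<delta> :: 'm state \<Rightarrow> real"
  define p where "p = 2 - 4 * \<delta>"
  have p: "1 < p" using \<delta> by (simp add: p_def)
  have \<delta>2: "\<delta> < 1 / 2" using \<delta> by simp
  obtain N where N: "0 < N" and overlap: "\<forall>d. \<exists>\<epsilon>>0. \<forall>z\<in>?S. \<forall>z'\<in>?S.
    ?V z \<le> d \<longrightarrow> ?V z' \<le> d \<longrightarrow> overlapping E N \<epsilon> z z'"
    using skeleton_overlap[OF E \<delta>(1) \<delta>2, where 'm='m] by (elim exE conjE)
  define R where "R = (skeleton E ^^ N :: ('m state \<Rightarrow> real) \<Rightarrow> 'm state \<Rightarrow> real)"
  define B where "B g \<longleftrightarrow> g \<in> borel_measurable (state_space E) \<and> (\<exists>M. \<forall>w\<in>?S. \<bar>g w\<bar> \<le> M)"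
    for g :: "'m state \<Rightarrow> real"
  obtain c b where c: "0 < c" and b: "0 < b" and drift: "\<forall>z\<in>?S. R ?V z \<le> ?V z - c * ?V z powr (1 - 1 / p) + b"
    using skeleton_power_drift[OF E \<delta> N, where 'm='m] unfolding R_def p_def by (elim exE conjE)
  have power_B: "B ((skeleton E ^^ n) f)" if "B f" for n f
    using that unfolding B_def
    by (meson E \<delta> \<delta>2 bounded_dominated dominated_measurable skeleton_power_bounded skeleton_power_dominated)
  have far: "\<bar>R g z - R g z'\<bar> \<le> a0 + a1 * (R ?V z + R ?V z')"
    if "B g" "0 \<le> a0" "0 \<le> a1" "osc_bounded ?S ?V a0 a1 g" "z \<in> ?S" "z' \<in> ?S" for g a0 a1 z z'
    using that unfolding B_def R_def by (elim conjE exE) (rule skeleton_oscillation_far; blast)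
  have near: "\<exists>\<epsilon>>0. \<forall>g a0 a1 z z'. B g \<longrightarrow> 0 \<le> a0 \<longrightarrow> 0 \<le> a1 \<longrightarrow> osc_bounded ?S ?V a0 a1 g \<longrightarrow>
        z \<in> ?S \<longrightarrow> z' \<in> ?S \<longrightarrow> ?V z \<le> d \<longrightarrow> ?V z' \<le> d \<longrightarrow>
        \<bar>R g z - R g z'\<bar> \<le> (1 - \<epsilon>) * a0 + a1 * (R ?V z + R ?V z')" for d
  proof -
    obtain \<epsilon> where \<epsilon>: "0 < \<epsilon>" and ov: "\<forall>z\<in>?S. \<forall>z'\<in>?S. ?V z \<le> d \<longrightarrow> ?V z' \<le> d \<longrightarrow> overlapping E N \<epsilon> z z'"
      using overlap[THEN spec, of d] by (elim exE conjE)
    show ?thesis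
    proof (intro exI[of _ \<epsilon>] conjI \<epsilon> allI impI)
      fix g a0 a1 z z'
      assume g: "B g" and a: "0 \<le> a0" "0 \<le> a1"
        and osc: "osc_bounded ?S ?V a0 a1 g"
        and z: "z \<in> ?S" "z' \<in> ?S" and d: "?V z \<le> d" "?V z' \<le> d"
      obtain M where M: "g \<in> borel_measurable (state_space E)" "\<And>w. w \<in> ?S \<Longrightarrow> \<bar>g w\<bar> \<le> M"
        using g unfolding B_def by blast
      show "\<bar>R g z - R g z'\<bar> \<le> (1 - \<epsilon>) * a0 + a1 * (R ?V z + R ?V z')"
      proof (cases "a0 = 0")
        case True
        then show ?thesis using far[OF g a osc z] by simp
      next
        case False
        then have a0: "0 < a0" using a by simp
        have one: "R g x - R g x' \<le> (1 - \<epsilon>) * a0 + a1 * (R ?V x + R ?V x')"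
          if "x \<in> ?S" "x' \<in> ?S" "?V x \<le> d" "?V x' \<le> d" for x x'
          unfolding R_def
          by (rule skeleton_oscillation_near[OF M a0 a(2) osc that(1,2)])
             (auto intro!: ov[rule_format] that)
        from one[OF z d] one[OF z(2,1) d(2,1)] show ?thesis by (simp add: abs_le_iff add.commute)
      qed
    qed
  qed
  have "\<exists>C\<ge>0. \<forall>f M n z z'. B f \<longrightarrow> (\<forall>w\<in>?S. \<bar>f w\<bar> \<le> M) \<longrightarrow> 0 < n \<longrightarrow> z \<in> ?S \<longrightarrow> z' \<in> ?S \<longrightarrow>
        \<bar>(R ^^ n) f z - (R ^^ n) f z'\<bar> \<le> M * C * (1 + ?V z + ?V z') / real n powr p"
  proof (rule weighted_oscillation_decay[OF p c b])
    show "0 \<le> ?V z" for z by (rule weight_nonneg)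
    show "B (R g)" if "B g" for g unfolding R_def by (rule power_B[OF that])
    show "R ?V z \<le> ?V z - c * ?V z powr (1 - 1 / p) + b" if "z \<in> ?S" for z
      using drift that by blast
  qed (fact far near)+
  then obtain C where C: "0 \<le> C" and decay: "\<forall>f M n z z'. B f \<longrightarrow> (\<forall>w\<in>?S. \<bar>f w\<bar> \<le> M) \<longrightarrow> 0 < n \<longrightarrow> z \<in> ?S \<longrightarrow> z' \<in> ?S \<longrightarrow>
        \<bar>(R ^^ n) f z - (R ^^ n) f z'\<bar> \<le> M * C * (1 + ?V z + ?V z') / real n powr p"
    by (elim exE conjE)
  define C' where "C' = (C + 2) * (2 * real N) powr p"
  have C': "0 \<le> C'" using C by (simp add: C'_def)
  have bound: "\<bar>(skeleton E ^^ n) f z - (skeleton E ^^ n) f z'\<bar> \<le> M * C' * (1 + ?V z + ?V z') / (real n + 1) powr p"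
    if f: "f \<in> borel_measurable (state_space E)" "\<forall>w\<in>?S. \<bar>f w\<bar> \<le> M" and z: "z \<in> ?S" "z' \<in> ?S" for f M n z z'
  proof -
    define U where "U = 1 + ?V z + ?V z'"
    have U: "1 \<le> U" using weight_nonneg[of \<delta> z] weight_nonneg[of \<delta> z'] by (simp add: U_def)
    have M: "0 \<le> M" using f(2) z by force
    define q r where "q = n div N" and "r = n mod N"
    have r: "r < N" using N by (simp add: r_def)
    have n: "n = N * q + r" by (simp add: q_def r_def)
    define f' where "f' = (skeleton E ^^ r) f"
    have f': "B f'" "\<forall>w\<in>?S. \<bar>f' w\<bar> \<le> M"
      using power_B[of f r] f skeleton_power_bounded[OF E \<delta> f(1), of M _ r] unfolding f'_def B_def by blast+
    have split: "(skeleton E ^^ n) f = (R ^^ q) f'"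
      unfolding n R_def f'_def by (simp add: funpow_add funpow_mult)
    show ?thesis
    proof (cases "q = 0")
      case True
      have "real n + 1 \<le> 2 * real N" using True n r by simp
      then have small: "(real n + 1) powr p \<le> (2 * real N) powr p" using p by (intro powr_mono2) auto
      have "\<bar>(skeleton E ^^ n) f z - (skeleton E ^^ n) f z'\<bar> \<le> M * 2"
      proof -
        have "(skeleton E ^^ n) f = f'" using split True by simp
        moreover have "\<bar>f' z\<bar> \<le> M" "\<bar>f' z'\<bar> \<le> M" using f'(2) z by auto
        ultimately show ?thesis by (simp add: abs_le_iff)
      qed
      also have "\<dots> \<le> M * 2 * ((2 * real N) powr p / (real n + 1) powr p)"
        using M small mult_left_mono[of 1 "(2 * real N) powr p / (real n + 1) powr p" "M * 2"] by simp
      also have "\<dots> = M * (2 * (2 * real N) powr p) * 1 / (real n + 1) powr p" by simp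
      also have "\<dots> \<le> M * C' * U / (real n + 1) powr p"
        using M U C unfolding C'_def by (intro divide_right_mono mult_mono mult_left_mono mult_right_mono) auto
      finally show ?thesis by (simp add: U_def)
    next
      case False
      have "real n + 1 \<le> real N * real q + real N" using n r by (simp flip: of_nat_mult of_nat_add)
      also have "\<dots> \<le> 2 * real N * real q"
      proof -
        have "real N * 1 \<le> real N * real q" using False by (intro mult_left_mono) auto
        then show ?thesis by simp
      qed
      finally have "(real n + 1) powr p \<le> (2 * real N * real q) powr p" using p by (intro powr_mono2) auto
      then have large: "(real n + 1) powr p \<le> (2 * real N) powr p * real q powr p" by (simp add: powr_mult)
      have pos: "0 < (real n + 1) powr p" "0 < real q powr p" using False by auto
      have "\<bar>(skeleton E ^^ n) f z - (skeleton E ^^ n) f z'\<bar> \<le> M * C * U / real q powr p"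
        unfolding split U_def using decay[rule_format, OF f'(1) _ _ z] f'(2) False by blast
      also have "\<dots> \<le> M * C * U * (2 * real N) powr p / (real n + 1) powr p"
      proof -
        have "1 / real q powr p \<le> (2 * real N) powr p / (real n + 1) powr p"
          using large pos by (simp add: field_simps)
        then have "M * C * U * (1 / real q powr p) \<le> M * C * U * ((2 * real N) powr p / (real n + 1) powr p)"
          using M C U by (intro mult_left_mono) auto
        then show ?thesis by simp
      qed
      also have "\<dots> = M * (C * (2 * real N) powr p) * U / (real n + 1) powr p" by (simp add: mult_ac)
      also have "\<dots> \<le> M * C' * U / (real n + 1) powr p"
        using M U C unfolding C'_def by (intro divide_right_mono mult_mono mult_left_mono mult_right_mono) auto
      finally show ?thesis by (simp add: U_def)
    qed
  qed
  show ?thesis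
    using C' bound unfolding p_def by blast
qed

end


section \<open>Poisson averages\<close>

text \<open>
  The mean of \<open>c\<close> at a Poisson variable of parameter \<open>s\<close>, written as a power series so that it can be differentiated
  termwise.
\<close>

definition poisson_mean :: "(nat \<Rightarrow> real) \<Rightarrow> real \<Rightarrow> real" where
  "poisson_mean c s = exp (- s) * (\<Sum>n. c n / fact n * s ^ n)"

lemma summable_poisson_terms:
  fixes c :: "nat \<Rightarrow> real"
  assumes "\<And>n. \<bar>c n\<bar> \<le> M"
  shows "summable (\<lambda>n. \<bar>c n / fact n * s ^ n\<bar>)"
proof (rule summable_comparison_test')
  show "summable (\<lambda>n. M * (\<bar>s\<bar> ^ n /\<^sub>R fact n))"
    by (intro summable_mult summable_exp_generic)
  show "norm \<bar>c n / fact n * s ^ n\<bar> \<le> M * (\<bar>s\<bar> ^ n /\<^sub>R fact n)" if "0 \<le> n" for n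
    using mult_right_mono[OF assms[of n], of "\<bar>s\<bar> ^ n / fact n"]
    by (simp add: abs_mult power_abs divide_inverse mult_ac)
qed

lemma poisson_mean_mono:
  fixes c d :: "nat \<Rightarrow> real"
  assumes "\<And>n. \<bar>c n\<bar> \<le> M" "\<And>n. \<bar>d n\<bar> \<le> M'" "\<And>n. c n \<le> d n" "0 \<le> s"
  shows "poisson_mean c s \<le> poisson_mean d s"
  unfolding poisson_mean_def
  using assms summable_rabs_cancel[OF summable_poisson_terms[of c M s]]
    summable_rabs_cancel[OF summable_poisson_terms[of d M' s]]
  by (intro mult_left_mono suminf_le mult_right_mono divide_right_mono) auto

lemma poisson_mean_const: "poisson_mean (\<lambda>_. a) s = a"
proof -
  have "(\<Sum>n. a / fact n * s ^ n) = a * (\<Sum>n. s ^ n /\<^sub>R fact n)"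
    by (subst suminf_mult[symmetric, OF summable_exp_generic]) (simp add: divide_inverse mult_ac)
  also have "\<dots> = a * exp s" by (simp add: exp_def)
  finally show ?thesis by (simp add: poisson_mean_def exp_minus)
qed

lemma poisson_mean_bound:
  assumes "\<And>n. \<bar>c n\<bar> \<le> M" "0 \<le> s"
  shows "\<bar>poisson_mean c s\<bar> \<le> M"
proof -
  have M: "c n \<le> M" "- M \<le> c n" for n using assms(1)[of n] by (auto simp: abs_le_iff)
  have "\<bar>- M\<bar> \<le> \<bar>M\<bar>" by simp
  then show ?thesis
    using poisson_mean_mono[of c M "\<lambda>_. M" "\<bar>M\<bar>" s] poisson_mean_mono[of "\<lambda>_. - M" "\<bar>M\<bar>" c M s] assms M
    by (simp add: poisson_mean_const abs_le_iff)
qed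

lemma poisson_mean_0: "poisson_mean c 0 = c 0"
  using powser_zero[of "\<lambda>n. c n / fact n"] by (simp add: poisson_mean_def)

lemma poisson_mean_linear:
  fixes c d :: "nat \<Rightarrow> real"
  assumes "\<And>n. \<bar>c n\<bar> \<le> M" "\<And>n. \<bar>d n\<bar> \<le> M'"
  shows "poisson_mean (\<lambda>n. a * c n + b * d n) s = a * poisson_mean c s + b * poisson_mean d s"
proof -
  note sc = summable_rabs_cancel[OF summable_poisson_terms[of c M s, OF assms(1)]]
  note sd = summable_rabs_cancel[OF summable_poisson_terms[of d M' s, OF assms(2)]]
  have "(\<Sum>n. (a * c n + b * d n) / fact n * s ^ n)
      = (\<Sum>n. a * (c n / fact n * s ^ n) + b * (d n / fact n * s ^ n))"
    by (intro suminf_cong) (simp add: algebra_simps add_divide_distrib)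
  also have "\<dots> = a * (\<Sum>n. c n / fact n * s ^ n) + b * (\<Sum>n. d n / fact n * s ^ n)"
    unfolding suminf_add[OF summable_mult[OF sc, of a] summable_mult[OF sd, of b], symmetric]
      suminf_mult[OF sc] suminf_mult[OF sd] ..
  finally show ?thesis by (simp add: poisson_mean_def algebra_simps)
qed

lemma poisson_mean_sum:
  fixes c :: "'i \<Rightarrow> nat \<Rightarrow> real"
  assumes "finite I" "\<And>i n. i \<in> I \<Longrightarrow> \<bar>c i n\<bar> \<le> M"
  shows "poisson_mean (\<lambda>n. \<Sum>i\<in>I. r i * c i n) s = (\<Sum>i\<in>I. r i * poisson_mean (c i) s)"
  using assms
proof (induction I rule: finite_induct)
  case empty
  show ?case by (simp add: poisson_mean_const)
next
  case (insert i I)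
  have b: "\<bar>\<Sum>i\<in>I. r i * c i n\<bar> \<le> (\<Sum>i\<in>I. \<bar>r i\<bar> * M)" for n
    using insert.prems by (intro sum_abs[THEN order_trans] sum_mono) (auto simp: abs_mult intro!: mult_left_mono)
  have "poisson_mean (\<lambda>n. r i * c i n + 1 * (\<Sum>i\<in>I. r i * c i n)) s
      = r i * poisson_mean (c i) s + 1 * poisson_mean (\<lambda>n. \<Sum>i\<in>I. r i * c i n) s"
    using insert.prems b by (intro poisson_mean_linear) auto
  then show ?case using insert by simp
qed

lemma DERIV_poisson_mean:
  assumes "\<And>n. \<bar>c n\<bar> \<le> M"
  shows "(poisson_mean c has_real_derivative (poisson_mean (\<lambda>n. c (Suc n)) s - poisson_mean c s)) (at s)"
proof -
  define p where "p = (\<lambda>s. \<Sum>n. c n / fact n * s ^ n)"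
  have "((\<lambda>s. \<Sum>n. c n / fact n * s ^ n) has_field_derivative (\<Sum>n. diffs (\<lambda>n. c n / fact n) n * s ^ n)) (at s)"
    using summable_rabs_cancel[OF summable_poisson_terms[OF assms]]
    by (intro termdiffs_strong_converges_everywhere)
  moreover have "diffs (\<lambda>n. c n / fact n) n = c (Suc n) / fact n" for n
  proof -
    have "(fact (Suc n) :: real) = (1 + real n) * fact n" by simp
    moreover have "1 + real n \<noteq> 0" by (simp add: add_eq_0_iff)
    ultimately show ?thesis by (simp add: diffs_def)
  qed
  ultimately have "(p has_real_derivative (\<Sum>n. c (Suc n) / fact n * s ^ n)) (at s)"
    by (simp add: p_def)
  then have "((\<lambda>s. exp (- s) * p s) has_real_derivative
      (exp (- s) * (\<Sum>n. c (Suc n) / fact n * s ^ n) - exp (- s) * p s)) (at s)"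
    by (auto intro!: derivative_eq_intros)
  then show ?thesis by (simp add: poisson_mean_def[abs_def] p_def)
qed

lemma isCont_poisson_mean:
  assumes "\<And>n. \<bar>c n\<bar> \<le> M"
  shows "isCont (poisson_mean c) s"
  by (rule DERIV_isCont[OF DERIV_poisson_mean[OF assms]])

text \<open>
  The mean of \<open>1 / ((n + 1) * (n + 2))\<close> is at most \<open>1 / s\<^sup>2\<close>, because the weights turn into the Poisson weights shifted by
  two.  The general exponent is reduced to this one by splitting at \<open>n + 1 = s\<close>: with \<open>x = 1 / (n + 1)\<close>, either
  \<open>x powr p \<le> s powr - p\<close> or \<open>x powr p \<le> s powr (2 - p) * x\<^sup>2\<close>.
\<close>

lemma poisson_mean_inverse_power_le:
  fixes p s :: real
  assumes p: "0 \<le> p" "p \<le> 2" and s: "0 < s"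
  shows "poisson_mean (\<lambda>n. 1 / (real n + 1) powr p) s \<le> 3 * s powr - p"
proof -
  define c where "c n = 1 / ((real n + 1) * (real n + 2))" for n
  have c: "\<bar>c n\<bar> \<le> 1" for n
  proof -
    have "1 * 1 \<le> (real n + 1) * (real n + 2)" by (intro mult_mono) auto
    then show ?thesis by (simp add: c_def)
  qed
  have d: "\<bar>1 / (real n + 1) powr p\<bar> \<le> 1" for n
    using p by (simp add: ge_one_powr_ge_zero)
  have two: "poisson_mean c s \<le> s powr - 2"
  proof -
    have "summable (\<lambda>n. s ^ n /\<^sub>R fact n)" by (rule summable_exp_generic)
    then have "(\<Sum>n. s ^ (n + 2) /\<^sub>R fact (n + 2)) \<le> (\<Sum>n. s ^ n /\<^sub>R fact n)"
      using suminf_minus_initial_segment[of "\<lambda>n. s ^ n /\<^sub>R fact n" 2] s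
      by (simp add: sum_nonneg)
    also have "\<dots> = exp s" by (simp add: exp_def)
    finally have e: "(\<Sum>n. s ^ (n + 2) /\<^sub>R fact (n + 2)) \<le> exp s" .
    have rescaled: "s\<^sup>2 * (c n / fact n * s ^ n) = s ^ (n + 2) /\<^sub>R fact (n + 2)" for n
    proof -
      have "(fact (n + 2) :: real) = (real n + 1) * (real n + 2) * fact n"
        by (simp add: algebra_simps)
      then show ?thesis by (simp add: c_def divide_inverse power_add power2_eq_square mult_ac)
    qed
    have "s\<^sup>2 * (\<Sum>n. c n / fact n * s ^ n) = (\<Sum>n. s ^ (n + 2) /\<^sub>R fact (n + 2))"
      using suminf_mult[OF summable_rabs_cancel[OF summable_poisson_terms[of c 1 s, OF c]], of "s\<^sup>2"] rescaled by simp
    then have "s\<^sup>2 * poisson_mean c s \<le> exp (- s) * exp s"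
      using mult_left_mono[OF e, of "exp (- s)"] by (simp add: poisson_mean_def mult_ac)
    then have "poisson_mean c s \<le> 1 / s\<^sup>2"
      using s by (simp add: exp_add[symmetric] field_simps)
    also have "\<dots> = s powr - 2" using s by (simp add: powr_minus divide_inverse powr_numeral)
    finally show ?thesis .
  qed
  have le: "1 / (real n + 1) powr p \<le> s powr - p * 1 + (2 * s powr (2 - p)) * c n" for n
  proof (cases "s \<le> real n + 1")
    case True
    then have "(real n + 1) powr - p \<le> s powr - p" using s p by (intro powr_mono2') auto
    moreover have "0 \<le> (2 * s powr (2 - p)) * c n" by (simp add: c_def)
    ultimately show ?thesis using powr_minus_divide[of "real n + 1" p] by linarith
  next
    case False
    define x where "x = real n + 1"
    have x: "1 \<le> x" "x < s" using False by (auto simp: x_def)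
    have "1 / x powr p = x powr (2 - p) / x\<^sup>2"
      using x by (simp add: powr_diff powr_numeral)
    also have "\<dots> \<le> s powr (2 - p) / x\<^sup>2"
      using x p by (intro divide_right_mono powr_mono2) auto
    also have "\<dots> \<le> s powr (2 - p) * (2 * c n)"
    proof -
      have "x * (x + 1) \<le> x * (2 * x)" using x by (intro mult_left_mono) auto
      then have "2 / (x * (2 * x)) \<le> 2 / (x * (x + 1))"
        using x by (intro divide_left_mono mult_pos_pos) auto
      then have "1 / x\<^sup>2 \<le> 2 * (1 / (x * (x + 1)))"
        using x by (simp add: power2_eq_square)
      also have "\<dots> = 2 * c n" by (simp add: c_def x_def add.commute)
      finally have "s powr (2 - p) * (1 / x\<^sup>2) \<le> s powr (2 - p) * (2 * c n)" by (intro mult_left_mono) auto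
      then show ?thesis by simp
    qed
    also have "\<dots> \<le> s powr - p * 1 + (2 * s powr (2 - p)) * c n" by simp
    finally show ?thesis by (simp add: x_def)
  qed
  have bd: "\<bar>s powr - p * 1 + (2 * s powr (2 - p)) * c n\<bar> \<le> s powr - p + 2 * s powr (2 - p)" for n
  proof -
    have "0 \<le> c n" "c n \<le> 1" using c[of n] by (auto simp: c_def)
    then have "0 \<le> (2 * s powr (2 - p)) * c n" "(2 * s powr (2 - p)) * c n \<le> 2 * s powr (2 - p)"
      by (auto intro!: mult_left_le)
    moreover have "0 \<le> s powr - p" by simp
    ultimately show ?thesis by linarith
  qed
  have "poisson_mean (\<lambda>n. 1 / (real n + 1) powr p) s
      \<le> poisson_mean (\<lambda>n. s powr - p * 1 + (2 * s powr (2 - p)) * c n) s"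
    using s by (intro poisson_mean_mono[OF d bd le]) auto
  also have "\<dots> = s powr - p * poisson_mean (\<lambda>_. 1) s + (2 * s powr (2 - p)) * poisson_mean c s"
    by (rule poisson_mean_linear[where M=1 and M'=1]) (use c in auto)
  also have "\<dots> \<le> s powr - p + (2 * s powr (2 - p)) * s powr - 2"
    using two by (simp add: poisson_mean_const mult_left_mono)
  also have "\<dots> = 3 * s powr - p" by (simp add: powr_add[symmetric])
  finally show ?thesis .
qed

section \<open>The uniformised semigroup\<close>

text \<open>
  The skeleton run along a Poisson clock of rate \<^const>\<open>max_rate\<close>.
\<close>

definition uniformised :: "real \<Rightarrow> ('m::finite state \<Rightarrow> real) \<Rightarrow> real \<Rightarrow> 'm state \<Rightarrow> real" where
  "uniformised E \<zeta> t z = poisson_mean (\<lambda>n. (skeleton E ^^ n) \<zeta> z) (max_rate TYPE('m) E * t)"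

abbreviation exponential :: "real \<Rightarrow> real measure" where
  "exponential l \<equiv> density lborel (\<lambda>s. ennreal (exponential_density l s))"

lemma total_rate_pos: "z \<in> energy_simplex E \<Longrightarrow> 0 < total_rate z"
  unfolding total_rate_def by (intro sum_pos) (auto simp: mem_energy_simplex)

lemma integral_exponential:
  assumes "0 < l" and [measurable]: "f \<in> borel_measurable borel"
  shows "(\<integral>s. f s \<partial>exponential l) = (\<integral>s. exponential_density l s * f s \<partial>lborel)"
  using assms by (subst integral_density) (auto simp: exponential_density_nonneg)

lemma emeasure_exponential_gt:
  assumes l: "0 < l" and a: "0 \<le> a"
  shows "emeasure (exponential l) {a<..} = ennreal (exp (- (l * a)))"
    and "measure (exponential l) {..a} = 1 - exp (- (l * a))"
proof -
  interpret prob_space "exponential l" by (rule prob_space_exponential_density[OF l])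
  have e: "emeasure (exponential l) {..a} = ennreal (1 - exp (- (l * a)))"
    using emeasure_erlang_density[OF l, of 0 a] l a by (simp add: erlang_CDF_0)
  have le: "exp (- (l * a)) \<le> 1" using l a by simp
  show m: "measure (exponential l) {..a} = 1 - exp (- (l * a))"
    using e le by (simp add: measure_def)
  have "prob (space (exponential l) - {..a}) = 1 - prob {..a}"
    by (rule prob_compl) simp
  moreover have "space (exponential l) - {..a} = {a<..}" by auto
  ultimately have "prob {a<..} = exp (- (l * a))" using m by simp
  then show "emeasure (exponential l) {a<..} = ennreal (exp (- (l * a)))"
    by (simp add: emeasure_eq_measure)
qed

context
  fixes E M :: real and \<zeta> :: "'m::finite state \<Rightarrow> real"
  assumes E: "0 < E" and \<zeta>: "\<zeta> \<in> borel_measurable (state_space E)"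
    and M: "\<And>w. w \<in> energy_simplex E \<Longrightarrow> \<bar>\<zeta> w\<bar> \<le> M"
begin

lemma skeleton_iterates:
  shows skeleton_iterates_bound: "\<And>z n. z \<in> energy_simplex E \<Longrightarrow> \<bar>(skeleton E ^^ n) \<zeta> z\<bar> \<le> M"
    and skeleton_iterates_measurable: "\<And>n. (skeleton E ^^ n) \<zeta> \<in> borel_measurable (state_space E)"
    and skeleton_iterates_dominated: "\<And>n. (skeleton E ^^ n) \<zeta> \<in> dominated E (1 / 8)"
proof -
  show d: "(skeleton E ^^ n) \<zeta> \<in> dominated E (1 / 8)" for n
    by (rule skeleton_power_dominated[OF E]) (auto intro: bounded_dominated[OF \<zeta> M E])
  show "(skeleton E ^^ n) \<zeta> \<in> borel_measurable (state_space E)" for n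
    by (rule dominated_measurable[OF d])
  show "\<bar>(skeleton E ^^ n) \<zeta> z\<bar> \<le> M" if "z \<in> energy_simplex E" for z n
    by (rule skeleton_power_bounded[OF E, of "1 / 8", OF _ _ \<zeta> M that]) auto
qed

lemma ring_mean_iterates_bound:
  assumes z: "z \<in> energy_simplex E"
  shows "\<bar>ring_mean i ((skeleton E ^^ n) \<zeta>) z\<bar> \<le> M"
proof -
  have c: "(\<lambda>_. a) \<in> dominated E (1 / 8)" for a by (rule const_dominated[OF E]) auto
  have b: "(skeleton E ^^ n) \<zeta> w \<le> M" "- M \<le> (skeleton E ^^ n) \<zeta> w" if "w \<in> energy_simplex E" for w
    using skeleton_iterates_bound[OF that, of n] by (auto simp: abs_le_iff)
  show ?thesis
    using ring_mean_mono[OF skeleton_iterates_dominated c, of n M z i]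
      ring_mean_mono[OF c skeleton_iterates_dominated, of "- M" n z i] b z
    by (simp add: abs_le_iff ring_mean_const)
qed

lemma measurable_uniformised [measurable]: "uniformised E \<zeta> t \<in> borel_measurable (state_space E)"
  using skeleton_iterates_measurable unfolding uniformised_def poisson_mean_def by measurable

lemma uniformised_bound:
  assumes "z \<in> energy_simplex E" "0 \<le> t"
  shows "\<bar>uniformised E \<zeta> t z\<bar> \<le> M"
  unfolding uniformised_def
  using skeleton_iterates_bound[OF assms(1)] assms(2) max_rate_pos[OF E, where 'm='m]
  by (intro poisson_mean_bound) auto

lemma ring_mean_uniformised:
  assumes z: "z \<in> energy_simplex E"
  shows "ring_mean i (uniformised E \<zeta> t) z
     = poisson_mean (\<lambda>n. ring_mean i ((skeleton E ^^ n) \<zeta>) z) (max_rate TYPE('m) E * t)"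
proof -
  let ?s = "max_rate TYPE('m) E * t"
  have U: "exchange i u z \<in> energy_simplex E" if "u \<in> space uniform01" for u
    using that z by (intro exchange_in_simplex) (auto simp: space_restrict_space)
  have m: "(\<lambda>u. (skeleton E ^^ n) \<zeta> (exchange i u z)) \<in> borel_measurable uniform01" for n
    by (rule measurable_compose[OF measurable_exchange_at[OF z] skeleton_iterates_measurable])
  have int: "integrable uniform01 (\<lambda>u. (skeleton E ^^ n) \<zeta> (exchange i u z))" for n
    using skeleton_iterates_bound[OF U] m by (intro uniform01.integrable_const_bound[of _ M] AE_I2) auto
  let ?t = "\<lambda>n u. (skeleton E ^^ n) \<zeta> (exchange i u z) / fact n * ?s ^ n"
  have "(\<integral>u. (\<Sum>n. ?t n u) \<partial>uniform01) = (\<Sum>n. \<integral>u. ?t n u \<partial>uniform01)"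
  proof (rule integral_suminf)
    show "integrable uniform01 (?t n)" for n using int[of n] by simp
    show "AE u in uniform01. summable (\<lambda>n. norm (?t n u))"
      using summable_poisson_terms[where M=M and s="?s"] skeleton_iterates_bound[OF U]
      by (intro AE_I2) auto
    have "(\<integral>u. norm (?t n u) \<partial>uniform01) = (\<integral>u. \<bar>(skeleton E ^^ n) \<zeta> (exchange i u z)\<bar> \<partial>uniform01) / fact n * \<bar>?s\<bar> ^ n" for n
      by (simp add: abs_mult power_abs)
    moreover have "summable (\<lambda>n. \<bar>(\<integral>u. \<bar>(skeleton E ^^ n) \<zeta> (exchange i u z)\<bar> \<partial>uniform01) / fact n * \<bar>?s\<bar> ^ n\<bar>)"
    proof (rule summable_poisson_terms)
      fix n
      have "(\<integral>u. \<bar>(skeleton E ^^ n) \<zeta> (exchange i u z)\<bar> \<partial>uniform01) \<le> (\<integral>u. M \<partial>uniform01)"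
        using int[of n] skeleton_iterates_bound[OF U]
        by (intro integral_mono_AE AE_I2) auto
      then show "\<bar>\<integral>u. \<bar>(skeleton E ^^ n) \<zeta> (exchange i u z)\<bar> \<partial>uniform01\<bar> \<le> M"
        using uniform01.prob_space by simp
    qed
    ultimately show "summable (\<lambda>n. \<integral>u. norm (?t n u) \<partial>uniform01)"
      by (simp add: summable_rabs_cancel)
  qed
  then show ?thesis
    by (simp add: ring_mean_def uniformised_def poisson_mean_def)
qed

lemma DERIV_uniformised:
  assumes z: "z \<in> energy_simplex E"
  shows "((\<lambda>t. uniformised E \<zeta> t z) has_real_derivative
     (\<Sum>i\<in>UNIV. sqrt (fst z $ i) * ring_mean i (uniformised E \<zeta> t) z) - total_rate z * uniformised E \<zeta> t z) (at t)"
proof -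
  define \<Lambda> where "\<Lambda> = max_rate TYPE('m) E"
  have \<Lambda>: "0 < \<Lambda>" using max_rate_pos[OF E] by (simp add: \<Lambda>_def)
  define c where "c n = (skeleton E ^^ n) \<zeta> z" for n
  have c: "\<bar>c n\<bar> \<le> M" for n using skeleton_iterates_bound[OF z] by (simp add: c_def)
  define d where "d i n = ring_mean i ((skeleton E ^^ n) \<zeta>) z" for i n
  have d: "\<bar>d i n\<bar> \<le> M" for i n using ring_mean_iterates_bound[OF z] by (simp add: d_def)
  have Suc: "c (Suc n) = (1 - total_rate z / \<Lambda>) * c n + 1 * (\<Sum>i\<in>UNIV. (sqrt (fst z $ i) / \<Lambda>) * d i n)" for n
    unfolding c_def d_def \<Lambda>_def by (simp add: skeleton_convex_form[OF E])
  have bs: "\<bar>\<Sum>i\<in>UNIV. (sqrt (fst z $ i) / \<Lambda>) * d i n\<bar> \<le> (\<Sum>i\<in>UNIV. \<bar>sqrt (fst z $ i) / \<Lambda>\<bar> * M)" for n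
  proof (intro sum_abs[THEN order_trans] sum_mono)
    show "\<bar>sqrt (fst z $ i) / \<Lambda> * d i n\<bar> \<le> \<bar>sqrt (fst z $ i) / \<Lambda>\<bar> * M" for i
      unfolding abs_mult by (intro mult_left_mono d) auto
  qed
  have eq: "poisson_mean (\<lambda>n. c (Suc n)) s
      = (1 - total_rate z / \<Lambda>) * poisson_mean c s + (\<Sum>i\<in>UNIV. (sqrt (fst z $ i) / \<Lambda>) * poisson_mean (d i) s)" for s
    unfolding Suc poisson_mean_linear[OF c bs] using d by (subst poisson_mean_sum[where M=M]) auto
  have "((\<lambda>t. poisson_mean c (\<Lambda> * t)) has_real_derivative
      (poisson_mean (\<lambda>n. c (Suc n)) (\<Lambda> * t) - poisson_mean c (\<Lambda> * t)) * \<Lambda>) (at t)"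
    by (rule DERIV_chain2[OF DERIV_poisson_mean[OF c]]) (auto intro!: derivative_eq_intros)
  also have "(poisson_mean (\<lambda>n. c (Suc n)) (\<Lambda> * t) - poisson_mean c (\<Lambda> * t)) * \<Lambda>
      = (\<Sum>i\<in>UNIV. sqrt (fst z $ i) * poisson_mean (d i) (\<Lambda> * t)) - total_rate z * poisson_mean c (\<Lambda> * t)"
    unfolding eq using \<Lambda> by (simp add: algebra_simps sum_distrib_right sum_distrib_left)
  finally show ?thesis
    unfolding ring_mean_uniformised[OF z] by (simp add: uniformised_def \<Lambda>_def c_def[abs_def] d_def[abs_def])
qed

lemma isCont_uniformised:
  assumes z: "z \<in> energy_simplex E"
  shows "isCont (\<lambda>t. uniformised E \<zeta> t z) t" "isCont (\<lambda>t. ring_mean i (uniformised E \<zeta> t) z) t"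
proof -
  show "isCont (\<lambda>t. uniformised E \<zeta> t z) t" by (rule DERIV_isCont[OF DERIV_uniformised[OF z]])
  show "isCont (\<lambda>t. ring_mean i (uniformised E \<zeta> t) z) t"
    unfolding ring_mean_uniformised[OF z]
    by (rule isCont_o2[OF _ isCont_poisson_mean[OF ring_mean_iterates_bound[OF z]]]) (intro continuous_intros)
qed

text \<open>
  The function \<open>s \<mapsto> exp (- l * s) * uniformised E \<zeta> (t - s) z\<close>, with \<open>l\<close> the total rate at \<open>z\<close>, has derivative
  \<open>- exp (- l * s) * (\<Sum>i. sqrt (x i) * ring_mean i (uniformised E \<zeta> (t - s)) z)\<close>.  Integrating it from \<open>0\<close> to \<open>t\<close> gives the part
  \<open>s \<le> t\<close> of the equation; the part \<open>s > t\<close> has mass \<open>exp (- l * t)\<close>.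
\<close>

lemma uniformised_first_jump:
  assumes z: "z \<in> energy_simplex E" and t: "0 \<le> t"
  shows "uniformised E \<zeta> t z = (\<Sum>i\<in>UNIV. sqrt (fst z $ i) / total_rate z *
    (\<integral>s. (if t < s then \<zeta> z else ring_mean i (uniformised E \<zeta> (t - s)) z) \<partial>exponential (total_rate z)))"
proof -
  define l where "l = total_rate z"
  have l: "0 < l" using total_rate_pos[OF z] by (simp add: l_def)
  interpret X: prob_space "exponential l" by (rule prob_space_exponential_density[OF l])
  define G where "G i s = ring_mean i (uniformised E \<zeta> s) z" for i s
  have G_cont: "isCont (G i) s" for i s unfolding G_def by (rule isCont_uniformised[OF z])
  have G_comp: "isCont (\<lambda>s. G i (t - s)) s" for i s
    by (rule isCont_o2[OF _ G_cont]) (intro continuous_intros)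
  have [measurable]: "(\<lambda>s. G i (t - s)) \<in> borel_measurable borel" for i
    using G_comp by (intro borel_measurable_continuous_onI continuous_at_imp_continuous_on) auto
  define f where "f s = exp (- (l * s)) * (\<Sum>i\<in>UNIV. sqrt (fst z $ i) * G i (t - s))" for s
  have f_int: "has_bochner_integral lborel (\<lambda>s. f s * indicator {0..t} s)
      (- exp (- (l * t)) * uniformised E \<zeta> (t - t) z - (- exp (- (l * 0)) * uniformised E \<zeta> (t - 0) z))"
  proof (rule has_bochner_integral_FTC_Icc_real[OF t])
    fix s
    have "((\<lambda>s. uniformised E \<zeta> (t - s) z) has_real_derivative
        ((\<Sum>i\<in>UNIV. sqrt (fst z $ i) * G i (t - s)) - l * uniformised E \<zeta> (t - s) z) * (-1)) (at s)"
      unfolding G_def l_def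
      by (rule DERIV_chain2[OF DERIV_uniformised[OF z]]) (auto intro!: derivative_eq_intros)
    then show "((\<lambda>s. - exp (- (l * s)) * uniformised E \<zeta> (t - s) z) has_real_derivative f s) (at s)"
      by (auto intro!: derivative_eq_intros simp: f_def algebra_simps)
    show "isCont f s" unfolding f_def by (intro continuous_intros G_comp)
  qed
  have u0: "uniformised E \<zeta> 0 z = \<zeta> z" by (simp add: uniformised_def poisson_mean_0)
  have f_eq: "(\<integral>s. f s * indicator {0..t} s \<partial>lborel) = uniformised E \<zeta> t z - exp (- (l * t)) * \<zeta> z"
    using f_int u0 by (simp add: has_bochner_integral_iff)
  have meas: "(\<lambda>s. if t < s then \<zeta> z else G i (t - s)) \<in> borel_measurable borel" for i by measurable
  have bnd: "\<bar>G i s\<bar> \<le> M" if "0 \<le> s" for i s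
    unfolding G_def ring_mean_uniformised[OF z]
    using that max_rate_pos[OF E, where 'm='m] ring_mean_iterates_bound[OF z] by (intro poisson_mean_bound) auto
  have int: "integrable (exponential l) (\<lambda>s. if t < s then \<zeta> z else G i (t - s))" for i
    using bnd M[OF z] meas by (intro X.integrable_const_bound[of _ M] AE_I2) auto
  have "(\<Sum>i\<in>UNIV. sqrt (fst z $ i) / l * (\<integral>s. (if t < s then \<zeta> z else G i (t - s)) \<partial>exponential l))
      = (\<integral>s. (\<Sum>i\<in>UNIV. sqrt (fst z $ i) / l * (if t < s then \<zeta> z else G i (t - s))) \<partial>exponential l)"
    using int by (subst Bochner_Integration.integral_sum) auto
  also have "\<dots> = (\<integral>s. \<zeta> z * indicator {t<..} s + (\<Sum>i\<in>UNIV. sqrt (fst z $ i) / l * G i (t - s)) * indicator {..t} s \<partial>exponential l)"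
  proof (intro Bochner_Integration.integral_cong refl)
    fix s
    have "(\<Sum>i\<in>UNIV. sqrt (fst z $ i) / l * \<zeta> z) = \<zeta> z"
      using l by (simp add: l_def total_rate_def sum_distrib_right[symmetric] sum_divide_distrib[symmetric])
    then show "(\<Sum>i\<in>UNIV. sqrt (fst z $ i) / l * (if t < s then \<zeta> z else G i (t - s)))
      = \<zeta> z * indicator {t<..} s + (\<Sum>i\<in>UNIV. sqrt (fst z $ i) / l * G i (t - s)) * indicator {..t} s"
      by (cases "t < s") auto
  qed
  also have "\<dots> = (\<integral>s. \<zeta> z * indicator {t<..} s \<partial>exponential l)
      + (\<integral>s. (\<Sum>i\<in>UNIV. sqrt (fst z $ i) / l * G i (t - s)) * indicator {..t} s \<partial>exponential l)"
  proof (rule Bochner_Integration.integral_add)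
    show "integrable (exponential l) (\<lambda>s. \<zeta> z * indicator {t<..} s)"
      by (intro X.integrable_const_bound[of _ "\<bar>\<zeta> z\<bar>"] AE_I2) (auto simp: indicator_def)
    have "integrable (exponential l) (\<lambda>s. \<Sum>i\<in>UNIV. sqrt (fst z $ i) / l * (G i (t - s) * indicator {..t} s))"
    proof (intro Bochner_Integration.integrable_sum integrable_mult_right)
      fix i
      have "0 \<le> M" using M[OF z] by linarith
      then show "integrable (exponential l) (\<lambda>s. G i (t - s) * indicator {..t} s)"
        using bnd by (intro X.integrable_const_bound[of _ M] AE_I2) (auto simp: indicator_def)
    qed
    then show "integrable (exponential l) (\<lambda>s. (\<Sum>i\<in>UNIV. sqrt (fst z $ i) / l * G i (t - s)) * indicator {..t} s)"
      by (simp add: sum_distrib_right mult.assoc)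
  qed
  also have "(\<integral>s. \<zeta> z * indicator {t<..} s \<partial>exponential l) = \<zeta> z * exp (- (l * t))"
    using emeasure_exponential_gt(1)[OF l t] by (simp add: measure_def)
  also have "(\<integral>s. (\<Sum>i\<in>UNIV. sqrt (fst z $ i) / l * G i (t - s)) * indicator {..t} s \<partial>exponential l)
      = (\<integral>s. f s * indicator {0..t} s \<partial>lborel)"
  proof (subst integral_exponential[OF l])
    have "exponential_density l s * ((\<Sum>i\<in>UNIV. sqrt (fst z $ i) / l * G i (t - s)) * indicator {..t} s)
        = f s * indicator {0..t} s" for s
      using l by (auto simp: exponential_density_def f_def indicator_def sum_divide_distrib[symmetric] mult_ac)
    then show "(\<integral>s. exponential_density l s * ((\<Sum>i\<in>UNIV. sqrt (fst z $ i) / l * G i (t - s)) * indicator {..t} s) \<partial>lborel)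
        = (\<integral>s. f s * indicator {0..t} s \<partial>lborel)" by simp
  qed measurable
  finally show ?thesis unfolding f_eq l_def G_def by simp
qed

end


section \<open>The first ring\<close>

abbreviation exponential_clocks :: "('m::finite \<Rightarrow> real) measure" where
  "exponential_clocks \<equiv> Pi\<^sub>M UNIV (\<lambda>_. exponential 1)"

interpretation exponential1: prob_space "exponential 1"
  by (rule prob_space_exponential_density) simp

interpretation exponential_clocks: prob_space "exponential_clocks :: ('m::finite \<Rightarrow> real) measure"
  by (rule prob_space_PiM) (rule exponential1.prob_space_axioms)

lemma measurable_clock:
  assumes f: "f \<in> N \<rightarrow>\<^sub>M state_space E" and e: "e \<in> N \<rightarrow>\<^sub>M exponential_clocks"
  shows "(\<lambda>x. clock (f x) (e x) i) \<in> borel_measurable N"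
proof -
  have "(\<lambda>x. e x i) \<in> N \<rightarrow>\<^sub>M exponential 1"
    by (rule measurable_compose[OF e measurable_component_singleton]) simp
  then have "(\<lambda>x. e x i) \<in> borel_measurable N" by simp
  moreover have "(\<lambda>x. fst (f x) $ i) \<in> borel_measurable N"
    by (rule measurable_compose[OF f measurable_energies(1)])
  ultimately show ?thesis unfolding clock_def by simp
qed

lemma measurable_waiting_time:
  assumes "f \<in> N \<rightarrow>\<^sub>M state_space E" and "e \<in> N \<rightarrow>\<^sub>M exponential_clocks"
  shows "(\<lambda>x. waiting_time (f x) (e x)) \<in> borel_measurable N"
proof -
  have "(\<lambda>x. Min ((\<lambda>i. clock (f x) (e x) i) ` UNIV)) \<in> borel_measurable N"
    by (intro borel_measurable_Min measurable_clock[OF assms]) auto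
  then show ?thesis by (simp add: waiting_time_def)
qed

text \<open>
  The particle that rings is a fixed choice from the set \<open>A\<close> of minimisers of the clocks, and \<open>A\<close> takes finitely many
  values.
\<close>

lemma measurable_ringing:
  fixes e :: "'a \<Rightarrow> 'm::finite \<Rightarrow> real"
  assumes "f \<in> N \<rightarrow>\<^sub>M state_space E" and "e \<in> N \<rightarrow>\<^sub>M exponential_clocks"
  shows "(\<lambda>x. ringing (f x) (e x)) \<in> N \<rightarrow>\<^sub>M count_space UNIV"
proof -
  note [measurable] = measurable_clock[OF assms]
  define A where "A x = {i. \<forall>j. \<not> clock (f x) (e x) j < clock (f x) (e x) i}" for x
  have "A \<in> N \<rightarrow>\<^sub>M count_space (UNIV :: 'm set set)"
  proof (subst measurable_count_space_eq2_countable, intro conjI ballI)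
    fix B :: "'m set"
    have "A -` {B} \<inter> space N = {x \<in> space N. \<forall>i. (i \<in> B) = (\<forall>j. \<not> clock (f x) (e x) j < clock (f x) (e x) i)}"
      by (auto simp: A_def)
    also have "\<dots> \<in> sets N" by measurable
    finally show "A -` {B} \<inter> space N \<in> sets N" .
  qed auto
  then have "(\<lambda>x. SOME i. i \<in> A x) \<in> N \<rightarrow>\<^sub>M count_space UNIV"
    by (rule measurable_compose) simp
  then show ?thesis by (simp add: A_def ringing_def arg_min_def is_arg_min_def)
qed

definition rings_first :: "'m::finite state \<Rightarrow> 'm \<Rightarrow> ('m \<Rightarrow> real) \<Rightarrow> bool" where
  "rings_first z i e \<longleftrightarrow> (\<forall>j. j \<noteq> i \<longrightarrow> clock z e i < clock z e j)"

lemma rings_first_imp: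
  assumes "rings_first z i e"
  shows "ringing z e = i" "waiting_time z e = clock z e i" "rings_first z j e \<longleftrightarrow> j = i"
proof -
  have le: "clock z e i \<le> clock z e j" for j
    using assms by (cases "j = i") (auto simp: rings_first_def intro: less_imp_le)
  show "ringing z e = i" unfolding ringing_def arg_min_def is_arg_min_def
  proof (rule some_equality)
    show "True \<and> (\<nexists>y. True \<and> clock z e y < clock z e i)"
      using le by (simp add: not_less)
    show "j = i" if "True \<and> (\<nexists>y. True \<and> clock z e y < clock z e j)" for j
      using that assms unfolding rings_first_def by blast
  qed
  show "waiting_time z e = clock z e i" unfolding waiting_time_def
    using le by (intro Min_eqI) auto
  show "rings_first z j e \<longleftrightarrow> j = i"
    using assms unfolding rings_first_def by (metis less_asym')
qed

text \<open>
  Given that the clock of \<open>i\<close> shows \<open>s\<close>, all other clocks show more with probability \<open>exp (- (l - r i) * s)\<close>, where \<open>r i\<close> is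
  the rate of \<open>i\<close> and \<open>l\<close> the total rate.  Together with the density \<open>r i * exp (- r i * s)\<close> this is \<open>r i / l\<close> times the
  exponential density of rate \<open>l\<close>.
\<close>

lemma nn_integral_rings_first:
  fixes z :: "'m::finite state" and g :: "real \<Rightarrow> ennreal"
  assumes z: "z \<in> energy_simplex E" and g[measurable]: "g \<in> borel_measurable borel"
  shows "(\<integral>\<^sup>+e. indicator {e. rings_first z i e} e * g (clock z e i) \<partial>exponential_clocks)
    = ennreal (sqrt (fst z $ i) / total_rate z) * (\<integral>\<^sup>+s. g s \<partial>exponential (total_rate z))"
proof -
  interpret product_sigma_finite "\<lambda>_ :: 'm. exponential 1" by standard
  define r where "r j = sqrt (fst z $ j)" for j
  have r: "0 < r j" for j using z by (simp add: r_def mem_energy_simplex)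
  define l where "l = total_rate z"
  have l: "l = r i + (\<Sum>j\<in>UNIV - {i}. r j)"
    unfolding l_def total_rate_def r_def by (rule sum.remove) auto
  then have l0: "0 < l" using r[of i] by (simp add: add_pos_nonneg sum_nonneg less_imp_le r)
  define f where "f e = (\<Prod>j\<in>UNIV - {i}. indicator {w. e i / r i < w / r j} (e j)) * g (e i / r i)" for e
  have f_eq: "indicator {e. rings_first z i e} e * g (clock z e i) = f e" for e
  proof (cases "rings_first z i e")
    case True
    then show ?thesis by (simp add: f_def clock_def r_def rings_first_def)
  next
    case False
    then obtain j where "j \<noteq> i" "\<not> e i / r i < e j / r j" by (auto simp: rings_first_def clock_def r_def)
    then have "(\<Prod>j\<in>UNIV - {i}. indicator {w. e i / r i < w / r j} (e j) :: ennreal) = 0"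
      by (intro prod_zero finite bexI[of _ j]) (auto simp: indicator_def)
    then show ?thesis using False by (simp add: f_def)
  qed
  have comp: "(\<lambda>e. e j) \<in> borel_measurable (exponential_clocks :: ('m \<Rightarrow> real) measure)" for j
    using measurable_component_singleton[of j UNIV "\<lambda>_. exponential 1"] by simp
  have f[measurable]: "f \<in> borel_measurable exponential_clocks"
    using comp [measurable] unfolding f_def indicator_def by measurable
  have tail: "emeasure (exponential 1) {w. y / r i < w / r j} = ennreal (exp (- (r j * y / r i)))" if "0 \<le> y" for y j
  proof -
    have "{w. y / r i < w / r j} = {r j * y / r i <..}"
      using r[of i] r[of j] by (auto simp: field_simps)
    then show ?thesis using emeasure_exponential_gt(1)[of 1 "r j * y / r i"] r[of i] r[of j] that by simp
  qed
  have inner: "(\<integral>\<^sup>+x. f (x(i := y)) \<partial>Pi\<^sub>M (UNIV - {i}) (\<lambda>_. exponential 1))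
      = ennreal (exp (- ((l - r i) * y / r i))) * g (y / r i)" if y: "0 \<le> y" for y
  proof -
    have prod_meas: "(\<lambda>x. \<Prod>j\<in>UNIV - {i}. indicator {w. y / r i < w / r j} (x j) :: ennreal)
        \<in> borel_measurable (Pi\<^sub>M (UNIV - {i}) (\<lambda>_. exponential 1))"
    proof (intro borel_measurable_prod_ennreal)
      fix j assume j: "j \<in> UNIV - {i}"
      have "indicator {w. y / r i < w / r j} \<in> borel_measurable (exponential 1)" by simp
      then show "(\<lambda>x. indicator {w. y / r i < w / r j} (x j) :: ennreal) \<in> borel_measurable (Pi\<^sub>M (UNIV - {i}) (\<lambda>_. exponential 1))"
        by (rule measurable_compose[OF measurable_component_singleton[OF j]])
    qed
    have "f (x(i := y)) = (\<Prod>j\<in>UNIV - {i}. indicator {w. y / r i < w / r j} (x j)) * g (y / r i)" for x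
      unfolding f_def by (intro arg_cong2[where f="(*)"] prod.cong) auto
    then have "(\<integral>\<^sup>+x. f (x(i := y)) \<partial>Pi\<^sub>M (UNIV - {i}) (\<lambda>_. exponential 1))
      = (\<integral>\<^sup>+x. (\<Prod>j\<in>UNIV - {i}. indicator {w. y / r i < w / r j} (x j)) \<partial>Pi\<^sub>M (UNIV - {i}) (\<lambda>_. exponential 1)) * g (y / r i)"
      using prod_meas by (simp add: nn_integral_multc)
    also have "(\<integral>\<^sup>+x. (\<Prod>j\<in>UNIV - {i}. indicator {w. y / r i < w / r j} (x j)) \<partial>Pi\<^sub>M (UNIV - {i}) (\<lambda>_. exponential 1))
      = (\<Prod>j\<in>UNIV - {i}. integral\<^sup>N (exponential 1) (indicator {w. y / r i < w / r j}))"
      by (rule product_nn_integral_prod) auto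
    also have "\<dots> = (\<Prod>j\<in>UNIV - {i}. ennreal (exp (- (r j * y / r i))))"
      using tail[OF y] by (intro prod.cong) auto
    also have "\<dots> = ennreal (exp (\<Sum>j\<in>UNIV - {i}. - (r j * y / r i)))"
      by (simp add: prod_ennreal exp_sum)
    also have "(\<Sum>j\<in>UNIV - {i}. - (r j * y / r i)) = - ((l - r i) * y / r i)"
      by (simp add: l sum_negf sum_distrib_right sum_divide_distrib)
    finally show ?thesis .
  qed
  have ins: "insert i (UNIV - {i}) = UNIV" by auto
  have "(\<integral>\<^sup>+e. indicator {e. rings_first z i e} e * g (clock z e i) \<partial>exponential_clocks)
      = (\<integral>\<^sup>+y. (\<integral>\<^sup>+x. f (x(i := y)) \<partial>Pi\<^sub>M (UNIV - {i}) (\<lambda>_. exponential 1)) \<partial>exponential 1)"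
    unfolding f_eq using product_nn_integral_insert_rev[of "UNIV - {i}" i f] f by (simp add: ins)
  also have "\<dots> = (\<integral>\<^sup>+y. ennreal (exp (- ((l - r i) * y / r i))) * g (y / r i) \<partial>exponential 1)"
  proof (rule nn_integral_cong_AE)
    show "AE y in exponential 1. (\<integral>\<^sup>+x. f (x(i := y)) \<partial>Pi\<^sub>M (UNIV - {i}) (\<lambda>_. exponential 1))
      = ennreal (exp (- ((l - r i) * y / r i))) * g (y / r i)"
      using inner by (subst AE_density) (auto simp: exponential_density_def)
  qed
  also have "\<dots> = (\<integral>\<^sup>+y. ennreal (exponential_density 1 y) * (ennreal (exp (- ((l - r i) * y / r i))) * g (y / r i)) \<partial>lborel)"
    by (rule nn_integral_density) auto
  also have "\<dots> = ennreal (r i) * (\<integral>\<^sup>+s. ennreal (exponential_density 1 (0 + r i * s)) * (ennreal (exp (- ((l - r i) * (0 + r i * s) / r i))) * g ((0 + r i * s) / r i)) \<partial>lborel)"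
    using r[of i] by (subst nn_integral_real_affine[where c="r i" and t=0]) auto
  also have "\<dots> = (\<integral>\<^sup>+s. ennreal (r i / l) * (ennreal (exponential_density l s) * g s) \<partial>lborel)"
  proof (subst nn_integral_cmult[symmetric])
    have "ennreal (r i) * (ennreal (exponential_density 1 (0 + r i * s)) * (ennreal (exp (- ((l - r i) * (0 + r i * s) / r i))) * g ((0 + r i * s) / r i)))
        = ennreal (r i / l) * (ennreal (exponential_density l s) * g s)" for s
    proof (cases "0 \<le> s")
      case True
      have "r i * (exp (- (r i * s)) * exp (- ((l - r i) * s))) = r i / l * (l * exp (- (s * l)))"
        using l0 by (simp add: exp_add[symmetric] algebra_simps)
      then have "ennreal (r i) * (ennreal (exp (- (r i * s))) * ennreal (exp (- ((l - r i) * s))))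
          = ennreal (r i / l) * ennreal (l * exp (- (s * l)))"
        using r[of i] l0 by (simp add: ennreal_mult[symmetric])
      then have "(ennreal (r i) * (ennreal (exp (- (r i * s))) * ennreal (exp (- ((l - r i) * s))))) * g s
          = (ennreal (r i / l) * ennreal (l * exp (- (s * l)))) * g s" by simp
      then show ?thesis using True r[of i] by (simp add: exponential_density_def mult.assoc mult_less_0_iff)
    next
      case False
      then have "r i * s < 0" using r[of i] by (simp add: mult_less_0_iff)
      then show ?thesis using False by (simp add: exponential_density_def)
    qed
    then show "(\<integral>\<^sup>+s. ennreal (r i) * (ennreal (exponential_density 1 (0 + r i * s)) * (ennreal (exp (- ((l - r i) * (0 + r i * s) / r i))) * g ((0 + r i * s) / r i))) \<partial>lborel)
      = (\<integral>\<^sup>+s. ennreal (r i / l) * (ennreal (exponential_density l s) * g s) \<partial>lborel)" by simp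
  qed measurable
  also have "\<dots> = ennreal (r i / l) * (\<integral>\<^sup>+s. g s \<partial>exponential l)"
    by (simp add: nn_integral_cmult nn_integral_density)
  finally show ?thesis by (simp add: r_def l_def)
qed

lemma measurable_rings_first:
  assumes "z \<in> energy_simplex E"
  shows "{e \<in> space exponential_clocks. rings_first z i e} \<in> sets exponential_clocks"
proof -
  have [measurable]: "(\<lambda>e. clock z e j) \<in> borel_measurable exponential_clocks" for j
    by (rule measurable_clock[where f="\<lambda>_. z" and E=E]) (use assms in auto)
  show ?thesis unfolding rings_first_def by measurable
qed

text \<open>
  Ties need no separate treatment: the probabilities of the disjoint events \<open>rings_first z i\<close> add up to one.
\<close>

lemma AE_rings_first:
  fixes z :: "'m::finite state"
  assumes z: "z \<in> energy_simplex E"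
  shows "AE e in exponential_clocks. \<exists>i. rings_first z i e"
proof -
  have l: "0 < total_rate z" by (rule total_rate_pos[OF z])
  interpret X: prob_space "exponential (total_rate z)" by (rule prob_space_exponential_density[OF l])
  have [measurable]: "{e. rings_first z i e} \<in> sets exponential_clocks" for i
    using measurable_rings_first[OF z, of i] by (simp add: space_PiM)
  have "emeasure exponential_clocks {e. \<exists>i. rings_first z i e}
      = emeasure exponential_clocks (\<Union>i. {e. rings_first z i e})"
    by (intro arg_cong2[where f=emeasure]) auto
  also have "\<dots> = (\<Sum>i\<in>UNIV. emeasure exponential_clocks {e. rings_first z i e})"
    by (subst sum_emeasure) (auto simp: disjoint_family_on_def rings_first_imp(3))
  also have "\<dots> = (\<Sum>i\<in>UNIV. ennreal (sqrt (fst z $ i) / total_rate z))"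
    using nn_integral_rings_first[OF z, where g="\<lambda>_. 1"] X.emeasure_space_1 by simp
  also have "\<dots> = ennreal (\<Sum>i\<in>UNIV. sqrt (fst z $ i) / total_rate z)"
    using z l by (intro sum_ennreal) (auto simp: mem_energy_simplex intro: less_imp_le)
  also have "(\<Sum>i\<in>UNIV. sqrt (fst z $ i) / total_rate z) = 1"
    using l by (simp add: sum_divide_distrib[symmetric] total_rate_def)
  finally have "exponential_clocks.prob {e :: 'm \<Rightarrow> real. \<exists>i. rings_first z i e} = 1"
    by (simp add: measure_def)
  moreover have "{e. \<exists>i. rings_first z i e} = (\<Union>i. {e. rings_first z i e})" by auto
  then have "{e. \<exists>i. rings_first z i e} \<in> sets exponential_clocks" by simp
  ultimately show ?thesis
    using exponential_clocks.prob_eq_1[of "{e. \<exists>i. rings_first z i e}"] by simp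
qed

text \<open>
  The particle that rings first and its waiting time are independent, with weights \<open>sqrt (x i) / total_rate z\<close> and
  the exponential law of rate \<open>total_rate z\<close>.
\<close>

lemma first_ring_law:
  fixes z :: "'m::finite state" and G :: "'m \<Rightarrow> real \<Rightarrow> real"
  assumes z: "z \<in> energy_simplex E" and G[measurable]: "\<And>i. G i \<in> borel_measurable borel"
    and M: "\<And>i s. \<bar>G i s\<bar> \<le> M"
  shows "(\<integral>e. G (ringing z e) (waiting_time z e) \<partial>exponential_clocks)
    = (\<Sum>i\<in>UNIV. sqrt (fst z $ i) / total_rate z * (\<integral>s. G i s \<partial>exponential (total_rate z)))"
proof -
  have l: "0 < total_rate z" by (rule total_rate_pos[OF z])
  interpret X: prob_space "exponential (total_rate z)" by (rule prob_space_exponential_density[OF l])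
  have z': "(\<lambda>_. z) \<in> exponential_clocks \<rightarrow>\<^sub>M state_space E" using z by auto
  note [measurable] = measurable_ringing[OF z' measurable_ident_sets[OF refl]]
    measurable_waiting_time[OF z' measurable_ident_sets[OF refl]] measurable_clock[OF z' measurable_ident_sets[OF refl]]
  have R[measurable]: "{e. rings_first z i e} \<in> sets exponential_clocks" for i
    using measurable_rings_first[OF z, of i] by (simp add: space_PiM)
  have pq: "0 \<le> sqrt (fst z $ i) / total_rate z" for i
    using z l by (auto simp: mem_energy_simplex intro: less_imp_le)
  have pos: "(\<integral>e. H (ringing z e) (waiting_time z e) \<partial>exponential_clocks)
    = (\<Sum>i\<in>UNIV. sqrt (fst z $ i) / total_rate z * (\<integral>s. H i s \<partial>exponential (total_rate z)))"
    if [measurable]: "\<And>i. H i \<in> borel_measurable borel" and H: "\<And>i s. 0 \<le> H i s" "\<And>i s. H i s \<le> C" for H C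
  proof -
    have [measurable]: "(\<lambda>e. H (ringing z e) (waiting_time z e)) \<in> borel_measurable exponential_clocks"
      by (rule measurable_compose_countable[where f="\<lambda>i e. H i (waiting_time z e)"]) auto
    have "(\<integral>\<^sup>+e. ennreal (H (ringing z e) (waiting_time z e)) \<partial>exponential_clocks)
       = (\<integral>\<^sup>+e. (\<Sum>i\<in>UNIV. indicator {e. rings_first z i e} e * ennreal (H i (clock z e i))) \<partial>exponential_clocks)"
    proof (rule nn_integral_cong_AE)
      show "AE e in exponential_clocks. ennreal (H (ringing z e) (waiting_time z e))
          = (\<Sum>i\<in>UNIV. indicator {e. rings_first z i e} e * ennreal (H i (clock z e i)))"
        using AE_rings_first[OF z]
      proof eventually_elim
        case (elim e)
        then obtain i where i: "rings_first z i e" by blast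
        have "(\<Sum>j\<in>UNIV. indicator {e. rings_first z j e} e * ennreal (H j (clock z e j)))
            = (\<Sum>j\<in>UNIV. if j = i then ennreal (H i (clock z e i)) else 0)"
          by (intro sum.cong) (auto simp: rings_first_imp(3)[OF i] indicator_def)
        then show ?case by (simp add: rings_first_imp[OF i])
      qed
    qed
    also have "\<dots> = (\<Sum>i\<in>UNIV. \<integral>\<^sup>+e. indicator {e. rings_first z i e} e * ennreal (H i (clock z e i)) \<partial>exponential_clocks)"
      by (rule nn_integral_sum) measurable
    also have "\<dots> = (\<Sum>i\<in>UNIV. ennreal (sqrt (fst z $ i) / total_rate z) * (\<integral>\<^sup>+s. ennreal (H i s) \<partial>exponential (total_rate z)))"
      by (intro sum.cong refl nn_integral_rings_first[OF z]) measurable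
    also have "\<dots> = (\<Sum>i\<in>UNIV. ennreal (sqrt (fst z $ i) / total_rate z * (\<integral>s. H i s \<partial>exponential (total_rate z))))"
    proof (intro sum.cong refl)
      fix i
      have eq: "(\<integral>\<^sup>+s. ennreal (H i s) \<partial>exponential (total_rate z)) = ennreal (\<integral>s. H i s \<partial>exponential (total_rate z))"
        using H by (intro nn_integral_eq_integral X.integrable_const_bound[of _ C] AE_I2) auto
      have nn: "0 \<le> (\<integral>s. H i s \<partial>exponential (total_rate z))" using H by simp
      show "ennreal (sqrt (fst z $ i) / total_rate z) * (\<integral>\<^sup>+s. ennreal (H i s) \<partial>exponential (total_rate z))
          = ennreal (sqrt (fst z $ i) / total_rate z * (\<integral>s. H i s \<partial>exponential (total_rate z)))"
        unfolding eq by (rule ennreal_mult[OF pq nn, symmetric])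
    qed
    also have "\<dots> = ennreal (\<Sum>i\<in>UNIV. sqrt (fst z $ i) / total_rate z * (\<integral>s. H i s \<partial>exponential (total_rate z)))"
      using pq H by (intro sum_ennreal mult_nonneg_nonneg) auto
    finally have eq: "(\<integral>\<^sup>+e. ennreal (H (ringing z e) (waiting_time z e)) \<partial>exponential_clocks) = \<dots>" .
    have nn: "0 \<le> (\<Sum>i\<in>UNIV. sqrt (fst z $ i) / total_rate z * (\<integral>s. H i s \<partial>exponential (total_rate z)))"
      using pq H by (intro sum_nonneg mult_nonneg_nonneg integral_nonneg_AE) auto
    have "(\<integral>e. H (ringing z e) (waiting_time z e) \<partial>exponential_clocks)
        = enn2real (\<integral>\<^sup>+e. ennreal (H (ringing z e) (waiting_time z e)) \<partial>exponential_clocks)"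
      using H by (intro integral_eq_nn_integral AE_I2) auto
    then show ?thesis unfolding eq by (simp only: enn2real_ennreal[OF nn])
  qed
  have GM: "0 \<le> G i s + M" "G i s + M \<le> 2 * M" for i s using M[of i s] by (auto simp: abs_le_iff)
  have intG: "integrable (exponential (total_rate z)) (G i)" for i
    using M by (intro X.integrable_const_bound[of _ M] AE_I2) auto
  have [measurable]: "(\<lambda>e. G (ringing z e) (waiting_time z e)) \<in> borel_measurable exponential_clocks"
    by (rule measurable_compose_countable[where f="\<lambda>i e. G i (waiting_time z e)"]) auto
  have intR: "integrable exponential_clocks (\<lambda>e. G (ringing z e) (waiting_time z e))"
    using M by (intro exponential_clocks.integrable_const_bound[of _ M] AE_I2) auto
  have sum1: "(\<Sum>i\<in>UNIV. sqrt (fst z $ i) / total_rate z) = 1"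
    using l by (simp add: sum_divide_distrib[symmetric] total_rate_def)
  have "(\<integral>e. G (ringing z e) (waiting_time z e) \<partial>exponential_clocks) + M
      = (\<integral>e. G (ringing z e) (waiting_time z e) + M \<partial>exponential_clocks)"
    using intR exponential_clocks.prob_space[where 'm='m] by (subst Bochner_Integration.integral_add) auto
  also have "\<dots> = (\<Sum>i\<in>UNIV. sqrt (fst z $ i) / total_rate z * (\<integral>s. G i s + M \<partial>exponential (total_rate z)))"
    by (rule pos[of "\<lambda>i s. G i s + M" "2 * M"]) (auto simp: GM)
  also have "\<dots> = (\<Sum>i\<in>UNIV. sqrt (fst z $ i) / total_rate z * (\<integral>s. G i s \<partial>exponential (total_rate z)))
      + (\<Sum>i\<in>UNIV. sqrt (fst z $ i) / total_rate z) * M"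
    using intG X.prob_space by (simp add: distrib_left sum.distrib sum_distrib_right)
  finally show ?thesis unfolding sum1 by simp
qed


section \<open>Paths\<close>

lemma jump_noise_eq: "jump_noise = exponential_clocks \<Otimes>\<^sub>M uniform01"
  by (simp add: jump_noise_def)

interpretation noise_pair: pair_prob_space "exponential_clocks :: ('m::finite \<Rightarrow> real) measure" uniform01 ..

lemma prob_space_jump_noise: "prob_space (jump_noise :: (('m::finite \<Rightarrow> real) \<times> real) measure)"
  unfolding jump_noise_eq by (rule noise_pair.prob_space_axioms)

interpretation jump_noise: prob_space "jump_noise :: (('m::finite \<Rightarrow> real) \<times> real) measure"
  by (rule prob_space_jump_noise)

interpretation noise_space: prob_space "noise_space :: (('m::finite \<Rightarrow> real) \<times> real) stream measure"
  unfolding noise_space_def by (rule jump_noise.prob_space_stream_space)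

lemma integral_noise_space:
  fixes f :: "(('m::finite \<Rightarrow> real) \<times> real) stream \<Rightarrow> real"
  assumes f[measurable]: "f \<in> borel_measurable noise_space" and M: "\<And>\<omega>. \<omega> \<in> space noise_space \<Longrightarrow> \<bar>f \<omega>\<bar> \<le> M"
  shows "(\<integral>\<omega>. f \<omega> \<partial>noise_space) = (\<integral>x. (\<integral>\<omega>. f (x ## \<omega>) \<partial>noise_space) \<partial>jump_noise)"
proof -
  interpret P: pair_prob_space "jump_noise :: (('m \<Rightarrow> real) \<times> real) measure" "noise_space :: (('m \<Rightarrow> real) \<times> real) stream measure" ..
  have Cons[measurable]: "(\<lambda>p. fst p ## snd p) \<in> jump_noise \<Otimes>\<^sub>M noise_space \<rightarrow>\<^sub>M (noise_space :: (('m \<Rightarrow> real) \<times> real) stream measure)"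
    unfolding noise_space_def by measurable
  have eq: "noise_space = distr (jump_noise \<Otimes>\<^sub>M noise_space) noise_space (\<lambda>p. fst p ## snd p :: (('m \<Rightarrow> real) \<times> real) stream)"
  proof (rule measure_eqI)
    fix A :: "(('m \<Rightarrow> real) \<times> real) stream set" assume A: "A \<in> sets noise_space"
    have "emeasure (distr (jump_noise \<Otimes>\<^sub>M noise_space) noise_space (\<lambda>p. fst p ## snd p)) A
        = (\<integral>\<^sup>+p. indicator A (fst p ## snd p) \<partial>(jump_noise \<Otimes>\<^sub>M noise_space))"
    proof -
      have "emeasure (distr (jump_noise \<Otimes>\<^sub>M noise_space) noise_space (\<lambda>p. fst p ## snd p)) A
          = (\<integral>\<^sup>+\<omega>. indicator A \<omega> \<partial>distr (jump_noise \<Otimes>\<^sub>M noise_space) noise_space (\<lambda>p. fst p ## snd p))"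
        using A by simp
      also have "\<dots> = (\<integral>\<^sup>+p. indicator A (fst p ## snd p) \<partial>(jump_noise \<Otimes>\<^sub>M noise_space))"
        using A by (intro nn_integral_distr[OF Cons]) simp
      finally show ?thesis .
    qed
    also have "\<dots> = (\<integral>\<^sup>+x. \<integral>\<^sup>+\<omega>. indicator A (x ## \<omega>) \<partial>noise_space \<partial>jump_noise)"
      using A by (subst noise_space.nn_integral_fst[symmetric]) auto
    also have "\<dots> = (\<integral>\<^sup>+\<omega>. indicator A \<omega> \<partial>noise_space)"
      using A unfolding noise_space_def by (subst jump_noise.nn_integral_stream_space) auto
    finally show "emeasure noise_space A = emeasure (distr (jump_noise \<Otimes>\<^sub>M noise_space) noise_space (\<lambda>p. fst p ## snd p)) A"
      using A by simp
  qed simp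
  have sp: "fst p ## snd p \<in> space noise_space" if "p \<in> space (jump_noise \<Otimes>\<^sub>M (noise_space :: (('m \<Rightarrow> real) \<times> real) stream measure))" for p
    using measurable_space[OF Cons that] .
  have int: "integrable (jump_noise \<Otimes>\<^sub>M noise_space) (\<lambda>p. f (fst p ## snd p))"
    using M sp by (intro P.P.integrable_const_bound[of _ M] AE_I2) auto
  have "(\<integral>\<omega>. f \<omega> \<partial>noise_space) = (\<integral>p. f (fst p ## snd p) \<partial>(jump_noise \<Otimes>\<^sub>M noise_space))"
    by (subst eq) (rule integral_distr[OF Cons f])
  also have "\<dots> = (\<integral>x. (\<integral>\<omega>. f (fst (x, \<omega>) ## snd (x, \<omega>)) \<partial>noise_space) \<partial>jump_noise)"
    by (rule P.integral_fst'[OF int, symmetric])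
  finally show ?thesis by simp
qed

lemma integral_jump_noise:
  fixes f :: "('m::finite \<Rightarrow> real) \<times> real \<Rightarrow> real"
  assumes f[measurable]: "f \<in> borel_measurable jump_noise" and M: "\<And>x. x \<in> space jump_noise \<Longrightarrow> \<bar>f x\<bar> \<le> M"
  shows "(\<integral>x. f x \<partial>jump_noise) = (\<integral>e. (\<integral>u. f (e, u) \<partial>uniform01) \<partial>exponential_clocks)"
proof -
  have "integrable (exponential_clocks \<Otimes>\<^sub>M uniform01) f"
    using f M unfolding jump_noise_eq by (intro noise_pair.P.integrable_const_bound[of _ M] AE_I2) auto
  then show ?thesis unfolding jump_noise_eq by (rule noise_pair.integral_fst'[symmetric])
qed

lemma (in prob_space) integral_abs_le:
  fixes f :: "'a \<Rightarrow> real"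
  assumes "\<And>x. x \<in> space M \<Longrightarrow> \<bar>f x\<bar> \<le> B" "0 \<le> B"
  shows "\<bar>\<integral>x. f x \<partial>M\<bar> \<le> B"
proof (cases "integrable M f")
  case True
  have "\<bar>\<integral>x. f x \<partial>M\<bar> \<le> (\<integral>x. \<bar>f x\<bar> \<partial>M)" by (rule integral_abs_bound)
  also have "\<dots> \<le> (\<integral>x. B \<partial>M)"
    using True assms by (intro integral_mono_AE AE_I2) auto
  finally show ?thesis by (simp add: prob_space)
qed (simp add: not_integrable_integral_eq assms)

lemma post_jump_Suc_shift:
  "post_jump z (x ## \<omega>) (Suc n) = post_jump (exchange (ringing z (fst x)) (snd x) z) \<omega> n"
  by (induction n) auto

lemma jump_time_Suc_shift:
  "jump_time z (x ## \<omega>) (Suc n) = waiting_time z (fst x) + jump_time (exchange (ringing z (fst x)) (snd x) z) \<omega> n"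
  unfolding jump_time_def sum.lessThan_Suc_shift
  by (simp add: post_jump_Suc_shift del: post_jump.simps(2))

lemma process_before_first_jump:
  assumes "t < waiting_time z (fst x)"
  shows "process z (x ## \<omega>) t = z"
proof -
  have "(LEAST n. t < jump_time z (x ## \<omega>) (Suc n)) = 0"
    using assms by (intro Least_eq_0) (simp add: jump_time_def)
  then show ?thesis by (simp add: process_def)
qed

lemma process_after_first_jump:
  assumes t: "waiting_time z (fst x) \<le> t"
    and ex: "t - waiting_time z (fst x) < jump_time (exchange (ringing z (fst x)) (snd x) z) \<omega> (Suc n)"
  shows "process z (x ## \<omega>) t = process (exchange (ringing z (fst x)) (snd x) z) \<omega> (t - waiting_time z (fst x))"
proof -
  define z' where "z' = exchange (ringing z (fst x)) (snd x) z"
  have shift: "t < jump_time z (x ## \<omega>) (Suc (Suc k)) \<longleftrightarrow> t - waiting_time z (fst x) < jump_time z' \<omega> (Suc k)" for k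
    unfolding jump_time_Suc_shift z'_def by auto
  have "(LEAST k. t < jump_time z (x ## \<omega>) (Suc k)) = Suc (LEAST k. t < jump_time z (x ## \<omega>) (Suc (Suc k)))"
  proof (rule Least_Suc)
    show "t < jump_time z (x ## \<omega>) (Suc (Suc n))" using ex unfolding shift z'_def .
    show "\<not> t < jump_time z (x ## \<omega>) (Suc 0)" using t by (simp add: jump_time_def)
  qed
  then show ?thesis
    unfolding process_def shift by (simp add: post_jump_Suc_shift z'_def del: post_jump.simps(2))
qed

lemma measurable_post_jump:
  fixes Z :: "'a \<Rightarrow> 'm::finite state"
  assumes Z: "Z \<in> N \<rightarrow>\<^sub>M state_space E" and W[measurable]: "W \<in> N \<rightarrow>\<^sub>M noise_space"
  shows "(\<lambda>x. post_jump (Z x) (W x) n) \<in> N \<rightarrow>\<^sub>M state_space E"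
proof (induction n)
  case 0
  show ?case using Z by simp
next
  case (Suc n)
  note [measurable] = Suc
  have nth[measurable]: "(\<lambda>x. W x !! n) \<in> N \<rightarrow>\<^sub>M jump_noise"
    by (rule measurable_compose[OF W]) (simp add: noise_space_def)
  have fst: "(\<lambda>x. fst (W x !! n)) \<in> N \<rightarrow>\<^sub>M exponential_clocks"
    by (rule measurable_compose[OF nth]) (simp add: jump_noise_eq)
  have snd: "(\<lambda>x. snd (W x !! n)) \<in> N \<rightarrow>\<^sub>M uniform01"
    by (rule measurable_compose[OF nth]) (simp add: jump_noise_eq)
  show ?case unfolding post_jump.simps
  proof (rule measurable_compose_countable[OF _ measurable_ringing[OF Suc fst]])
    fix i
    show "(\<lambda>x. exchange i (snd (W x !! n)) (post_jump (Z x) (W x) n)) \<in> N \<rightarrow>\<^sub>M state_space E"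
      using measurable_compose[OF measurable_Pair[OF Suc snd] measurable_exchange[of i E]] by simp
  qed
qed

lemma measurable_jump_time:
  fixes Z :: "'a \<Rightarrow> 'm::finite state"
  assumes Z: "Z \<in> N \<rightarrow>\<^sub>M state_space E" and W[measurable]: "W \<in> N \<rightarrow>\<^sub>M noise_space"
  shows "(\<lambda>x. jump_time (Z x) (W x) n) \<in> borel_measurable N"
  unfolding jump_time_def
proof (intro borel_measurable_sum)
  fix k
  have nth[measurable]: "(\<lambda>x. W x !! k) \<in> N \<rightarrow>\<^sub>M jump_noise"
    by (rule measurable_compose[OF W]) (simp add: noise_space_def)
  have "(\<lambda>x. fst (W x !! k)) \<in> N \<rightarrow>\<^sub>M exponential_clocks"
    by (rule measurable_compose[OF nth]) (simp add: jump_noise_eq)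
  then show "(\<lambda>x. waiting_time (post_jump (Z x) (W x) k) (fst (W x !! k))) \<in> borel_measurable N"
    by (intro measurable_waiting_time[OF measurable_post_jump[OF Z W]])
qed

lemma measurable_process:
  fixes Z :: "'a \<Rightarrow> 'm::finite state"
  assumes Z: "Z \<in> N \<rightarrow>\<^sub>M state_space E" and W: "W \<in> N \<rightarrow>\<^sub>M noise_space" and T[measurable]: "T \<in> borel_measurable N"
  shows "(\<lambda>x. process (Z x) (W x) (T x)) \<in> N \<rightarrow>\<^sub>M state_space E"
proof -
  note [measurable] = measurable_jump_time[OF Z W]
  show ?thesis unfolding process_def
    by (rule measurable_compose_countable[OF measurable_post_jump[OF Z W]]) measurable
qed

section \<open>Identification of the semigroup\<close>

text \<open>
  One of the first \<open>n\<close> jumps happens after time \<open>t\<close>.  The single condition \<open>t < jump_time z \<omega> n\<close> would be equivalent only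
  almost surely: waiting times are negative on a null set of noises.  In the present form the shift law below holds
  for every noise.
\<close>

definition covers :: "'m::finite state \<Rightarrow> (('m \<Rightarrow> real) \<times> real) stream \<Rightarrow> real \<Rightarrow> nat \<Rightarrow> bool" where
  "covers z \<omega> t n \<longleftrightarrow> (\<exists>k<n. t < jump_time z \<omega> (Suc k))"

text \<open>
  Paths that need more than \<open>n\<close> jumps to pass time \<open>t\<close> count as \<open>0\<close>.  The recursion in \<open>n\<close> then needs no knowledge
  about explosion.
\<close>

definition truncated :: "('m::finite state \<Rightarrow> real) \<Rightarrow> nat \<Rightarrow> real \<Rightarrow> 'm state \<Rightarrow> real" where
  "truncated \<zeta> n t z = (\<integral>\<omega>. (if covers z \<omega> t n then \<zeta> (process z \<omega> t) else 0) \<partial>noise_space)"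

context
  fixes E M :: real and \<zeta> :: "'m::finite state \<Rightarrow> real"
  assumes E: "0 < E" and \<zeta>[measurable]: "\<zeta> \<in> borel_measurable (state_space E)"
    and M: "\<And>w. w \<in> energy_simplex E \<Longrightarrow> \<bar>\<zeta> w\<bar> \<le> M"
begin

lemma measurable_truncated_path:
  assumes Z: "Z \<in> N \<rightarrow>\<^sub>M state_space E" and W: "W \<in> N \<rightarrow>\<^sub>M noise_space" and T[measurable]: "T \<in> borel_measurable N"
  shows "(\<lambda>x. if covers (Z x) (W x) (T x) n then \<zeta> (process (Z x) (W x) (T x)) else 0) \<in> borel_measurable N"
proof -
  note [measurable] = measurable_jump_time[OF Z W] measurable_compose[OF measurable_process[OF Z W T] \<zeta>]
  show ?thesis unfolding covers_def by measurable
qed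

lemma process_in_simplex:
  assumes z: "z \<in> energy_simplex E" and \<omega>: "\<omega> \<in> space noise_space"
  shows "process z \<omega> t \<in> energy_simplex E"
  using measurable_space[OF measurable_process[where Z="\<lambda>_. z" and W="\<lambda>\<omega>. \<omega>" and T="\<lambda>_. t" and N="noise_space" and E=E] \<omega>] z
  by simp

lemma truncated_path_bound:
  assumes z: "z \<in> energy_simplex E" and \<omega>: "\<omega> \<in> space noise_space"
  shows "\<bar>if covers z \<omega> t n then \<zeta> (process z \<omega> t) else 0\<bar> \<le> M"
  using M[OF process_in_simplex[OF z \<omega>, of t]] by auto

lemma measurable_truncated:
  assumes Z: "Z \<in> N \<rightarrow>\<^sub>M state_space E" and T: "T \<in> borel_measurable N"
  shows "(\<lambda>x. truncated \<zeta> n (T x) (Z x)) \<in> borel_measurable N"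
proof -
  have "(\<lambda>(x, \<omega>). if covers (Z x) \<omega> (T x) n then \<zeta> (process (Z x) \<omega> (T x)) else 0) \<in> borel_measurable (N \<Otimes>\<^sub>M noise_space)"
    unfolding case_prod_unfold
    by (intro measurable_truncated_path measurable_compose[OF measurable_fst Z] measurable_snd measurable_compose[OF measurable_fst T])
  then show ?thesis
    unfolding truncated_def by (rule noise_space.borel_measurable_lebesgue_integral)
qed

lemma truncated_bound:
  assumes z: "z \<in> energy_simplex E"
  shows "\<bar>truncated \<zeta> n t z\<bar> \<le> M"
  unfolding truncated_def
  using truncated_path_bound[OF z] M[OF z] by (intro noise_space.integral_abs_le) auto

lemma truncated_0: "truncated \<zeta> 0 t z = 0"
  by (simp add: truncated_def covers_def)

lemma covers_Suc_shift:
  "covers z (x ## \<omega>) t (Suc n) \<longleftrightarrow> t < waiting_time z (fst x) \<or>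
     covers (exchange (ringing z (fst x)) (snd x) z) \<omega> (t - waiting_time z (fst x)) n"
  unfolding covers_def Ex_less_Suc2 jump_time_Suc_shift
  by (auto simp: jump_time_def less_diff_eq diff_less_eq algebra_simps)

lemma truncated_path_Suc_shift:
  "(if covers z (x ## \<omega>) t (Suc n) then \<zeta> (process z (x ## \<omega>) t) else 0)
     = (if t < waiting_time z (fst x) then \<zeta> z
        else if covers (exchange (ringing z (fst x)) (snd x) z) \<omega> (t - waiting_time z (fst x)) n
          then \<zeta> (process (exchange (ringing z (fst x)) (snd x) z) \<omega> (t - waiting_time z (fst x))) else 0)"
proof (cases "t < waiting_time z (fst x)")
  case True
  then show ?thesis by (simp add: covers_Suc_shift process_before_first_jump)
next
  case False
  have "process z (x ## \<omega>) t = process (exchange (ringing z (fst x)) (snd x) z) \<omega> (t - waiting_time z (fst x))"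
    if past: "covers (exchange (ringing z (fst x)) (snd x) z) \<omega> (t - waiting_time z (fst x)) n"
  proof -
    obtain k where "t - waiting_time z (fst x) < jump_time (exchange (ringing z (fst x)) (snd x) z) \<omega> (Suc k)"
      using past unfolding covers_def by blast
    then show ?thesis using False by (intro process_after_first_jump) auto
  qed
  then show ?thesis using False by (simp add: covers_Suc_shift)
qed

lemma measurable_ring_mean_truncated:
  assumes z: "z \<in> energy_simplex E"
  shows "(\<lambda>s. ring_mean i (truncated \<zeta> n (t - s)) z) \<in> borel_measurable borel"
proof -
  have "(\<lambda>(s, u). truncated \<zeta> n (t - s) (exchange i u z)) \<in> borel_measurable (borel \<Otimes>\<^sub>M uniform01)"
    unfolding case_prod_unfold
    by (rule measurable_truncated[OF measurable_compose[OF measurable_snd measurable_exchange_at[OF z]]]) measurable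
  then show ?thesis
    unfolding ring_mean_def by (rule uniform01.borel_measurable_lebesgue_integral)
qed

lemma ring_mean_truncated_bound:
  assumes z: "z \<in> energy_simplex E"
  shows "\<bar>ring_mean i (truncated \<zeta> n s) z\<bar> \<le> M"
  unfolding ring_mean_def using truncated_bound exchange_in_simplex[OF z, of _ i] M[OF z]
  by (intro uniform01.integral_abs_le) (auto simp: space_restrict_space)

lemma truncated_Suc:
  assumes z: "z \<in> energy_simplex E"
  shows "truncated \<zeta> (Suc n) t z = (\<Sum>i\<in>UNIV. sqrt (fst z $ i) / total_rate z *
    (\<integral>s. (if t < s then \<zeta> z else ring_mean i (truncated \<zeta> n (t - s)) z) \<partial>exponential (total_rate z)))"
proof -
  let ?next = "\<lambda>x :: ('m \<Rightarrow> real) \<times> real. exchange (ringing z (fst x)) (snd x) z"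
  let ?W = "\<lambda>x :: ('m \<Rightarrow> real) \<times> real. waiting_time z (fst x)"
  have z': "(\<lambda>_. z) \<in> N \<rightarrow>\<^sub>M state_space E" for N :: "'x measure" using z by auto
  have M0: "0 \<le> M" using M[OF z] by linarith
  have fst: "fst \<in> jump_noise \<rightarrow>\<^sub>M exponential_clocks" and snd: "snd \<in> jump_noise \<rightarrow>\<^sub>M uniform01"
    unfolding jump_noise_eq by simp_all
  have W[measurable]: "?W \<in> borel_measurable jump_noise"
    by (rule measurable_waiting_time[OF z' fst])
  have Y: "?next \<in> jump_noise \<rightarrow>\<^sub>M state_space E"
  proof (rule measurable_compose_countable[OF _ measurable_ringing[OF z' fst]])
    show "(\<lambda>x. exchange i (snd x) z) \<in> jump_noise \<rightarrow>\<^sub>M state_space E" for i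
      by (rule measurable_compose[OF snd measurable_exchange_at[OF z]])
  qed
  define H where "H x = (if t < ?W x then \<zeta> z else truncated \<zeta> n (t - ?W x) (?next x))" for x
  have H_meas: "H \<in> borel_measurable jump_noise"
  proof -
    have [measurable]: "(\<lambda>x. truncated \<zeta> n (t - ?W x) (?next x)) \<in> borel_measurable jump_noise"
      by (rule measurable_truncated[OF Y]) measurable
    show ?thesis unfolding H_def by measurable
  qed
  have H_bound: "\<bar>H x\<bar> \<le> M" if "x \<in> space jump_noise" for x
    using M[OF z] truncated_bound[of "?next x"] measurable_space[OF Y that] by (auto simp: H_def)
  have "truncated \<zeta> (Suc n) t z = (\<integral>x. (\<integral>\<omega>. (if covers z (x ## \<omega>) t (Suc n) then \<zeta> (process z (x ## \<omega>) t) else 0) \<partial>noise_space) \<partial>jump_noise)"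
    unfolding truncated_def
    by (rule integral_noise_space[of _ M])
      (use z truncated_path_bound[OF z] in \<open>auto intro!: measurable_truncated_path[where Z="\<lambda>_. z" and W="\<lambda>\<omega>. \<omega>" and T="\<lambda>_. t"]\<close>)
  also have "\<dots> = (\<integral>x. H x \<partial>jump_noise)"
  proof (intro Bochner_Integration.integral_cong refl)
    fix x :: "('m \<Rightarrow> real) \<times> real"
    show "(\<integral>\<omega>. (if covers z (x ## \<omega>) t (Suc n) then \<zeta> (process z (x ## \<omega>) t) else 0) \<partial>noise_space) = H x"
      unfolding truncated_path_Suc_shift H_def truncated_def using noise_space.prob_space[where 'm='m]
      by (cases "t < ?W x") auto
  qed
  also have "\<dots> = (\<integral>e. (\<integral>u. H (e, u) \<partial>uniform01) \<partial>exponential_clocks)"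
    by (rule integral_jump_noise[OF H_meas H_bound])
  also have "\<dots> = (\<integral>e. (\<lambda>i s. if t < s then \<zeta> z else ring_mean i (truncated \<zeta> n (t - s)) z) (ringing z e) (waiting_time z e) \<partial>exponential_clocks)"
  proof (intro Bochner_Integration.integral_cong refl)
    fix e :: "'m \<Rightarrow> real"
    show "(\<integral>u. H (e, u) \<partial>uniform01) = (\<lambda>i s. if t < s then \<zeta> z else ring_mean i (truncated \<zeta> n (t - s)) z) (ringing z e) (waiting_time z e)"
      using uniform01.prob_space by (cases "t < waiting_time z e") (auto simp: H_def ring_mean_def)
  qed
  also have "\<dots> = (\<Sum>i\<in>UNIV. sqrt (fst z $ i) / total_rate z *
    (\<integral>s. (if t < s then \<zeta> z else ring_mean i (truncated \<zeta> n (t - s)) z) \<partial>exponential (total_rate z)))"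
  proof (rule first_ring_law[OF z, of _ M])
    fix i
    note [measurable] = measurable_ring_mean_truncated[OF z]
    show "(\<lambda>s. if t < s then \<zeta> z else ring_mean i (truncated \<zeta> n (t - s)) z) \<in> borel_measurable borel"
      by measurable
    show "\<bar>if t < s then \<zeta> z else ring_mean i (truncated \<zeta> n (t - s)) z\<bar> \<le> M" for s
      using M[OF z] ring_mean_truncated_bound[OF z] by auto
  qed
  finally show ?thesis .
qed

text \<open>
  Both functions satisfy the first-jump equation, one with \<open>n\<close> decreasing.  The difference is passed on only if the
  first jump happens before time \<open>t\<close>, which has probability at most \<open>1 - exp (- (max_rate TYPE('m) E * T))\<close>.
\<close>

lemma truncated_minus_uniformised:
  assumes "z \<in> energy_simplex E" "0 \<le> t" "t \<le> T"
  shows "\<bar>truncated \<zeta> n t z - uniformised E \<zeta> t z\<bar> \<le> M * (1 - exp (- (max_rate TYPE('m) E * T))) ^ n"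
  using assms
proof (induction n arbitrary: z t)
  case 0
  then show ?case using uniformised_bound[OF E \<zeta> M 0(1,2)] by (simp add: truncated_0)
next
  case (Suc n)
  define q where "q = 1 - exp (- (max_rate TYPE('m) E * T))"
  have z: "z \<in> energy_simplex E" and t: "0 \<le> t" "t \<le> T" using Suc.prems by auto
  have M0: "0 \<le> M" using M[OF z] by linarith
  have \<Lambda>: "0 < max_rate TYPE('m) E" by (rule max_rate_pos[OF E])
  have q: "0 \<le> q" using \<Lambda> t by (simp add: q_def)
  define l where "l = total_rate z"
  have l: "0 < l" "l \<le> max_rate TYPE('m) E"
    using total_rate_pos[OF z] total_rate_le[OF z] by (auto simp: l_def)
  interpret X: prob_space "exponential l" by (rule prob_space_exponential_density[OF l(1)])
  define A where "A i s = (if t < s then \<zeta> z else ring_mean i (truncated \<zeta> n (t - s)) z)" for i s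
  define B where "B i s = (if t < s then \<zeta> z else ring_mean i (uniformised E \<zeta> (t - s)) z)" for i s
  note [measurable] = measurable_ring_mean_truncated[OF z]
  have [measurable]: "(\<lambda>s. ring_mean i (uniformised E \<zeta> (t - s)) z) \<in> borel_measurable borel" for i
  proof (intro borel_measurable_continuous_onI continuous_at_imp_continuous_on ballI)
    show "isCont (\<lambda>s. ring_mean i (uniformised E \<zeta> (t - s)) z) s" for s
      by (rule isCont_o2[OF _ isCont_uniformised(2)[OF E \<zeta> M z]]) (auto intro!: continuous_intros)
  qed
  have meas: "A i \<in> borel_measurable borel" "B i \<in> borel_measurable borel" for i
    unfolding A_def B_def by measurable
  have ring_diff: "\<bar>ring_mean i (truncated \<zeta> n s) z - ring_mean i (uniformised E \<zeta> s) z\<bar> \<le> M * q ^ n"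
    if s: "0 \<le> s" "s \<le> T" for i s
  proof -
    have ex: "exchange i u z \<in> energy_simplex E" if "u \<in> space uniform01" for u
      using that z by (intro exchange_in_simplex) (auto simp: space_restrict_space)
    have m1: "truncated \<zeta> n s \<in> borel_measurable (state_space E)"
      by (rule measurable_truncated[where Z="\<lambda>z. z" and T="\<lambda>_. s"]) auto
    have m2: "uniformised E \<zeta> s \<in> borel_measurable (state_space E)"
      by (rule measurable_uniformised[OF E \<zeta> M])
    have int: "integrable uniform01 (\<lambda>u. truncated \<zeta> n s (exchange i u z))"
      "integrable uniform01 (\<lambda>u. uniformised E \<zeta> s (exchange i u z))"
      using truncated_bound[OF ex] uniformised_bound[OF E \<zeta> M ex s(1)]
      by (auto intro!: uniform01.integrable_const_bound[of _ M] AE_I2 measurable_compose[OF measurable_exchange_at[OF z] m1]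
          measurable_compose[OF measurable_exchange_at[OF z] m2])
    have "ring_mean i (truncated \<zeta> n s) z - ring_mean i (uniformised E \<zeta> s) z
        = (\<integral>u. truncated \<zeta> n s (exchange i u z) - uniformised E \<zeta> s (exchange i u z) \<partial>uniform01)"
      unfolding ring_mean_def using int by simp
    also have "\<bar>\<dots>\<bar> \<le> M * q ^ n"
      using Suc.IH[OF ex s] M0 q by (intro uniform01.integral_abs_le) (auto simp: q_def)
    finally show ?thesis .
  qed
  have "\<bar>B i s\<bar> \<le> M" if "0 \<le> s" for i s
  proof (cases "t < s")
    case False
    then have "\<bar>ring_mean i (uniformised E \<zeta> (t - s)) z\<bar> \<le> M"
      unfolding ring_mean_def using uniformised_bound[OF E \<zeta> M] exchange_in_simplex[OF z, of _ i] M0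
      by (intro uniform01.integral_abs_le) (auto simp: space_restrict_space)
    then show ?thesis using False by (simp add: B_def)
  qed (simp add: B_def M[OF z])
  moreover have s0: "AE s in exponential l. 0 \<le> s"
    by (subst AE_density) (auto simp: exponential_density_def)
  ultimately have intB: "integrable (exponential l) (B i)" for i
    using meas by (intro X.integrable_const_bound[of _ M]) (auto elim!: eventually_mono)
  have intA: "integrable (exponential l) (A i)" for i
    using meas M[OF z] ring_mean_truncated_bound[OF z]
    by (intro X.integrable_const_bound[of _ M] AE_I2) (auto simp: A_def)
  have int_diff: "\<bar>(\<integral>s. A i s \<partial>exponential l) - (\<integral>s. B i s \<partial>exponential l)\<bar> \<le> M * q ^ Suc n" for i
  proof -
    have "\<bar>(\<integral>s. A i s \<partial>exponential l) - (\<integral>s. B i s \<partial>exponential l)\<bar> = \<bar>\<integral>s. A i s - B i s \<partial>exponential l\<bar>"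
      using intA intB by simp
    also have "\<dots> \<le> (\<integral>s. \<bar>A i s - B i s\<bar> \<partial>exponential l)" by (rule integral_abs_bound)
    also have "\<dots> \<le> (\<integral>s. M * q ^ n * indicator {..t} s \<partial>exponential l)"
    proof (rule integral_mono_AE)
      show "integrable (exponential l) (\<lambda>s. M * q ^ n * indicator {..t} s)"
        using M0 q by (intro X.integrable_const_bound[of _ "M * q ^ n"] AE_I2) (auto simp: indicator_def)
      show "AE s in exponential l. \<bar>A i s - B i s\<bar> \<le> M * q ^ n * indicator {..t} s"
        using s0
      proof eventually_elim
        case (elim s)
        then show ?case using ring_diff[of "t - s" i] t by (auto simp: A_def B_def)
      qed
    qed (use intA intB in auto)
    also have "\<dots> = M * q ^ n * (1 - exp (- (l * t)))"
      using emeasure_exponential_gt(2)[OF l(1) t(1)] by simp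
    also have "\<dots> \<le> M * q ^ n * q"
    proof (rule mult_left_mono)
      have "l * t \<le> max_rate TYPE('m) E * T" using l \<Lambda> t by (intro mult_mono) auto
      then show "1 - exp (- (l * t)) \<le> q" by (simp add: q_def)
    qed (use M0 q in auto)
    finally show ?thesis by (simp add: mult_ac)
  qed
  have pq: "0 \<le> sqrt (fst z $ i) / l" for i
    using z l by (auto simp: mem_energy_simplex intro: less_imp_le)
  have "truncated \<zeta> (Suc n) t z - uniformised E \<zeta> t z
      = (\<Sum>i\<in>UNIV. sqrt (fst z $ i) / l * ((\<integral>s. A i s \<partial>exponential l) - (\<integral>s. B i s \<partial>exponential l)))"
  proof -
    have "truncated \<zeta> (Suc n) t z = (\<Sum>i\<in>UNIV. sqrt (fst z $ i) / l * (\<integral>s. A i s \<partial>exponential l))"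
      unfolding A_def l_def by (rule truncated_Suc[OF z])
    moreover have "uniformised E \<zeta> t z = (\<Sum>i\<in>UNIV. sqrt (fst z $ i) / l * (\<integral>s. B i s \<partial>exponential l))"
      unfolding B_def l_def by (rule uniformised_first_jump[OF E \<zeta> M z t(1)])
    ultimately show ?thesis by (simp only: sum_subtractf right_diff_distrib)
  qed
  also have "\<bar>\<dots>\<bar> \<le> (\<Sum>i\<in>UNIV. sqrt (fst z $ i) / l * (M * q ^ Suc n))"
  proof (rule sum_abs[THEN order_trans], rule sum_mono)
    fix i
    show "\<bar>sqrt (fst z $ i) / l * ((\<integral>s. A i s \<partial>exponential l) - (\<integral>s. B i s \<partial>exponential l))\<bar>
        \<le> sqrt (fst z $ i) / l * (M * q ^ Suc n)"
      unfolding abs_mult using int_diff[of i] pq[of i] by (simp only: abs_of_nonneg mult_left_mono)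
  qed
  also have "\<dots> = M * q ^ Suc n"
  proof -
    have "(\<Sum>i\<in>UNIV. sqrt (fst z $ i) / l) = 1"
      using l by (simp add: sum_divide_distrib[symmetric] total_rate_def[symmetric] l_def)
    then show ?thesis by (simp only: sum_distrib_right[symmetric] mult_1)
  qed
  finally show ?case by (simp add: q_def)
qed

lemma truncated_tendsto:
  assumes "z \<in> energy_simplex E" "0 \<le> t"
  shows "(\<lambda>n. truncated \<zeta> n t z) \<longlonglongrightarrow> uniformised E \<zeta> t z"
proof -
  define q where "q = 1 - exp (- (max_rate TYPE('m) E * t))"
  have q: "0 \<le> q" "q < 1" using max_rate_pos[OF E, where 'm='m] assms by (auto simp: q_def)
  have "(\<lambda>n. M * q ^ n) \<longlonglongrightarrow> M * 0"
    using q by (intro tendsto_mult_left LIMSEQ_power_zero) auto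
  then have lim: "(\<lambda>n. M * q ^ n) \<longlonglongrightarrow> 0" by simp
  have "(\<lambda>n. truncated \<zeta> n t z - uniformised E \<zeta> t z) \<longlonglongrightarrow> 0"
    by (rule Lim_null_comparison[OF _ lim])
      (simp add: q_def truncated_minus_uniformised[OF assms order_refl])
  then show ?thesis by (simp add: LIM_zero_iff)
qed

end

text \<open>
  For the constant function \<open>1\<close> the truncated mean is the probability that \<open>n\<close> jumps pass time \<open>t\<close>.  It tends to \<open>1\<close>, so
  there is no explosion, and the truncation disappears in the limit for every bounded \<open>\<zeta>\<close>.
\<close>

theorem semigroup_op_eq_uniformised:
  fixes \<zeta> :: "'m::finite state \<Rightarrow> real"
  assumes E: "0 < E" and \<zeta>: "\<zeta> \<in> borel_measurable (state_space E)"
    and M: "\<And>w. w \<in> energy_simplex E \<Longrightarrow> \<bar>\<zeta> w\<bar> \<le> M"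
    and z: "z \<in> energy_simplex E" and t: "0 \<le> t"
  shows "semigroup_op E t \<zeta> z = uniformised E \<zeta> t z"
proof -
  have one: "(\<lambda>_. 1) \<in> borel_measurable (state_space E)" "\<And>w :: 'm state. w \<in> energy_simplex E \<Longrightarrow> \<bar>1\<bar> \<le> (1::real)"
    by auto
  have P: "(\<lambda>\<omega>. process z \<omega> t) \<in> noise_space \<rightarrow>\<^sub>M state_space E"
    using z by (intro measurable_process[where Z="\<lambda>_. z" and W="\<lambda>\<omega>. \<omega>" and T="\<lambda>_. t"]) auto
  have \<zeta>P: "(\<lambda>\<omega>. \<zeta> (process z \<omega> t)) \<in> borel_measurable noise_space"
    by (rule measurable_compose[OF P \<zeta>])
  have bound: "\<bar>\<zeta> (process z \<omega> t)\<bar> \<le> M" if "\<omega> \<in> space noise_space" for \<omega>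
    by (rule M[OF process_in_simplex[OF E \<zeta> M z that]])
  have M0: "0 \<le> M" using M[OF z] by linarith
  have tm: "(\<lambda>\<omega>. if covers z \<omega> t n then f (process z \<omega> t) else 0) \<in> borel_measurable noise_space"
    if "f \<in> borel_measurable (state_space E)" "\<And>w. w \<in> energy_simplex E \<Longrightarrow> \<bar>f w\<bar> \<le> B"
    for n B and f :: "'m state \<Rightarrow> real"
    using z by (intro measurable_truncated_path[OF E that, where Z="\<lambda>_. z" and W="\<lambda>\<omega>. \<omega>" and T="\<lambda>_. t"]) auto
  have "semigroup_op E t \<zeta> z = (\<integral>\<omega>. \<zeta> (process z \<omega> t) \<partial>noise_space)"
    unfolding semigroup_op_def transition_def by (rule integral_distr[OF P \<zeta>])
  moreover have "(\<lambda>n. truncated \<zeta> n t z) \<longlonglongrightarrow> (\<integral>\<omega>. \<zeta> (process z \<omega> t) \<partial>noise_space)"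
  proof -
    have "(\<lambda>n. truncated (\<lambda>_. 1) n t z) \<longlonglongrightarrow> uniformised E (\<lambda>_. 1) t z"
      by (rule truncated_tendsto[OF E one z t])
    also have "uniformised E (\<lambda>_. 1) t z = 1"
      using skeleton_power_const[OF E, of "1 / 8" _ 1 z] by (simp add: uniformised_def poisson_mean_const)
    finally have "(\<lambda>n. M * (1 - truncated (\<lambda>_. 1) n t z)) \<longlonglongrightarrow> M * (1 - 1)"
      by (intro tendsto_intros)
    then have lim: "(\<lambda>n. M * (1 - truncated (\<lambda>_. 1) n t z)) \<longlonglongrightarrow> 0" by simp
    have "\<bar>truncated \<zeta> n t z - (\<integral>\<omega>. \<zeta> (process z \<omega> t) \<partial>noise_space)\<bar> \<le> M * (1 - truncated (\<lambda>_. 1) n t z)" for n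
    proof -
      let ?J = "\<lambda>\<omega>. if covers z \<omega> t n then \<zeta> (process z \<omega> t) else 0"
      let ?I = "\<lambda>\<omega>. if covers z \<omega> t n then 1 else 0 :: real"
      have J: "integrable noise_space ?J"
        using bound M0 tm[OF \<zeta> M] by (intro noise_space.integrable_const_bound[of _ M] AE_I2) auto
      have I: "integrable noise_space ?I"
        using tm[OF one] by (intro noise_space.integrable_const_bound[of _ 1] AE_I2) auto
      have Z: "integrable noise_space (\<lambda>\<omega>. \<zeta> (process z \<omega> t))"
        using bound \<zeta>P by (intro noise_space.integrable_const_bound[of _ M] AE_I2) auto
      have "\<bar>truncated \<zeta> n t z - (\<integral>\<omega>. \<zeta> (process z \<omega> t) \<partial>noise_space)\<bar>
          = \<bar>\<integral>\<omega>. ?J \<omega> - \<zeta> (process z \<omega> t) \<partial>noise_space\<bar>"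
        unfolding truncated_def using J Z by simp
      also have "\<dots> \<le> (\<integral>\<omega>. \<bar>?J \<omega> - \<zeta> (process z \<omega> t)\<bar> \<partial>noise_space)" by (rule integral_abs_bound)
      also have "\<dots> \<le> (\<integral>\<omega>. M * (1 - ?I \<omega>) \<partial>noise_space)"
        using J I Z bound by (intro integral_mono_AE AE_I2) auto
      also have "\<dots> = M * (1 - truncated (\<lambda>_. 1) n t z)"
        using I noise_space.prob_space[where 'm='m] by (simp add: truncated_def)
      finally show ?thesis .
    qed
    then have "(\<lambda>n. truncated \<zeta> n t z - (\<integral>\<omega>. \<zeta> (process z \<omega> t) \<partial>noise_space)) \<longlonglongrightarrow> 0"
      by (intro Lim_null_comparison[OF _ lim]) simp
    then show ?thesis by (simp add: LIM_zero_iff)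
  qed
  ultimately show ?thesis
    using truncated_tendsto[OF E \<zeta> M z t] LIMSEQ_unique by metis
qed


section \<open>Decay of correlations\<close>

lemma uniformised_difference_decay:
  fixes E \<delta> :: real
  assumes E: "0 < E" and \<delta>: "0 < \<delta>" "\<delta> < 1 / 4"
  shows "\<exists>C\<ge>0. \<forall>(\<zeta> :: 'm::finite state \<Rightarrow> real) M t z z'. \<zeta> \<in> borel_measurable (state_space E) \<longrightarrow>
     (\<forall>w\<in>energy_simplex E. \<bar>\<zeta> w\<bar> \<le> M) \<longrightarrow> z \<in> energy_simplex E \<longrightarrow> z' \<in> energy_simplex E \<longrightarrow> 0 < t \<longrightarrow>
     \<bar>uniformised E \<zeta> t z - uniformised E \<zeta> t z'\<bar>
       \<le> M * C * (1 + weight \<delta> z + weight \<delta> z') * t powr - (2 - 4 * \<delta>)"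
proof -
  define p where "p = 2 - 4 * \<delta>"
  have p: "0 \<le> p" "p \<le> 2" using \<delta> by (auto simp: p_def)
  obtain C where C: "0 \<le> C" and decay: "\<forall>(f :: 'm state \<Rightarrow> real) M n z z'. f \<in> borel_measurable (state_space E) \<longrightarrow>
     (\<forall>w\<in>energy_simplex E. \<bar>f w\<bar> \<le> M) \<longrightarrow> z \<in> energy_simplex E \<longrightarrow> z' \<in> energy_simplex E \<longrightarrow>
     \<bar>(skeleton E ^^ n) f z - (skeleton E ^^ n) f z'\<bar>
       \<le> M * C * (1 + weight \<delta> z + weight \<delta> z') / (real n + 1) powr p"
    using skeleton_oscillation_decay[OF E \<delta>, where 'm='m] unfolding p_def by (elim exE conjE)
  define \<Lambda> where "\<Lambda> = max_rate TYPE('m) E"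
  have \<Lambda>: "0 < \<Lambda>" using max_rate_pos[OF E] by (simp add: \<Lambda>_def)
  define C' where "C' = 3 * C * \<Lambda> powr - p"
  have bound: "\<bar>uniformised E \<zeta> t z - uniformised E \<zeta> t z'\<bar>
       \<le> M * C' * (1 + weight \<delta> z + weight \<delta> z') * t powr - p"
    if \<zeta>: "\<zeta> \<in> borel_measurable (state_space E)" "\<forall>w\<in>energy_simplex E. \<bar>\<zeta> w\<bar> \<le> M"
      and z: "z \<in> energy_simplex E" "z' \<in> energy_simplex E" and t: "0 < t"
    for \<zeta> :: "'m state \<Rightarrow> real" and M t z z'
  proof -
    define D where "D = M * C * (1 + weight \<delta> z + weight \<delta> z')"
    have "0 \<le> M" using \<zeta>(2) z by force
    then have D: "0 \<le> D" using C weight_nonneg[of \<delta> z] weight_nonneg[of \<delta> z'] by (simp add: D_def)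
    define c d where "c n = (skeleton E ^^ n) \<zeta> z" and "d n = (skeleton E ^^ n) \<zeta> z'" for n
    define e where "e n = 1 / (real n + 1) powr p" for n
    have cd: "\<bar>c n\<bar> \<le> M" "\<bar>d n\<bar> \<le> M" for n
      using skeleton_iterates_bound[OF E \<zeta>(1)] \<zeta>(2) z by (auto simp: c_def d_def)
    have e: "\<bar>e n\<bar> \<le> 1" for n using p by (simp add: e_def ge_one_powr_ge_zero)
    have diff: "\<bar>c n - d n\<bar> \<le> D * e n" for n
      using decay[rule_format, OF \<zeta>(1) _ z, of M n] \<zeta>(2) by (simp add: c_def d_def D_def e_def)
    have De: "\<bar>a * (D * e n)\<bar> \<le> D" if "\<bar>a\<bar> = 1" for n a
      using e[of n] D that by (simp add: abs_mult mult_left_le)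
    have s: "0 < \<Lambda> * t" using \<Lambda> t by simp
    have pe: "poisson_mean e (\<Lambda> * t) \<le> 3 * (\<Lambda> * t) powr - p"
      using poisson_mean_inverse_power_le[OF p s] by (simp add: e_def[abs_def])
    have lin: "poisson_mean (\<lambda>n. D * e n + 0 * e n) (\<Lambda> * t) = D * poisson_mean e (\<Lambda> * t) + 0 * poisson_mean e (\<Lambda> * t)"
      by (rule poisson_mean_linear[OF e e])
    have one: "poisson_mean c' (\<Lambda> * t) - poisson_mean d' (\<Lambda> * t) \<le> D * poisson_mean e (\<Lambda> * t)"
      if "\<And>n. \<bar>c' n\<bar> \<le> M" "\<And>n. \<bar>d' n\<bar> \<le> M" "\<And>n. c' n - d' n \<le> D * e n" for c' d'
    proof -
      have "poisson_mean (\<lambda>n. 1 * c' n + (- 1) * d' n) (\<Lambda> * t) \<le> poisson_mean (\<lambda>n. D * e n + 0 * e n) (\<Lambda> * t)"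
      proof (rule poisson_mean_mono[where M="2 * M" and M'=D])
        show "\<bar>1 * c' n + (- 1) * d' n\<bar> \<le> 2 * M" for n
          using that(1)[of n] that(2)[of n] by (simp add: abs_le_iff)
        show "\<bar>D * e n + 0 * e n\<bar> \<le> D" for n using De[of 1 n] by simp
        show "1 * c' n + (- 1) * d' n \<le> D * e n + 0 * e n" for n using that(3)[of n] by simp
      qed (use s in simp)
      also have "poisson_mean (\<lambda>n. 1 * c' n + (- 1) * d' n) (\<Lambda> * t) = 1 * poisson_mean c' (\<Lambda> * t) + (- 1) * poisson_mean d' (\<Lambda> * t)"
        by (rule poisson_mean_linear[OF that(1,2)])
      finally show ?thesis using lin by simp
    qed
    have "\<bar>poisson_mean c (\<Lambda> * t) - poisson_mean d (\<Lambda> * t)\<bar> \<le> D * poisson_mean e (\<Lambda> * t)"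
      using one[of c d] one[of d c] cd diff by (simp add: abs_le_iff)
    also have "\<dots> \<le> D * (3 * (\<Lambda> * t) powr - p)" using pe D by (rule mult_left_mono)
    also have "\<dots> = M * C' * (1 + weight \<delta> z + weight \<delta> z') * t powr - p"
      using \<Lambda> t by (simp add: D_def C'_def powr_mult)
    finally show ?thesis by (simp add: uniformised_def c_def[abs_def] d_def[abs_def] \<Lambda>_def)
  qed
  have "0 \<le> C'" using C by (simp add: C'_def)
  then show ?thesis
    using bound unfolding p_def by (intro exI[of _ C'] conjI allI impI)
qed

text \<open>
  A covariance does not change when a constant \<open>a\<close> is subtracted from \<open>f\<close>.
\<close>

lemma (in prob_space) abs_covariance_le:
  fixes f g :: "'a \<Rightarrow> real"
  assumes f: "f \<in> borel_measurable M" "\<And>x. x \<in> space M \<Longrightarrow> \<bar>f x\<bar> \<le> A"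
    and g: "g \<in> borel_measurable M" "\<And>x. x \<in> space M \<Longrightarrow> \<bar>g x\<bar> \<le> B"
  shows "\<bar>(\<integral>x. f x * g x \<partial>M) - (\<integral>x. f x \<partial>M) * (\<integral>x. g x \<partial>M)\<bar> \<le> 2 * B * (\<integral>x. \<bar>f x - a\<bar> \<partial>M)"
proof -
  have "space M \<noteq> {}" by (rule not_empty)
  then have B: "0 \<le> B" using g(2) by fastforce
  have fi: "integrable M f" using f by (intro integrable_const_bound[of _ A] AE_I2) auto
  have gi: "integrable M g" using g by (intro integrable_const_bound[of _ B] AE_I2) auto
  have fgi: "integrable M (\<lambda>x. f x * g x)"
    using f g by (intro integrable_const_bound[of _ "A * B"] AE_I2 borel_measurable_times) (auto simp: abs_mult intro!: mult_mono')
  have hi: "integrable M (\<lambda>x. \<bar>f x - a\<bar>)" using fi by simp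
  have hgi: "integrable M (\<lambda>x. (f x - a) * g x)" using fgi gi by (simp add: left_diff_distrib)
  have G: "\<bar>\<integral>x. g x \<partial>M\<bar> \<le> B"
  proof -
    have "\<bar>\<integral>x. g x \<partial>M\<bar> \<le> (\<integral>x. \<bar>g x\<bar> \<partial>M)" by (rule integral_abs_bound)
    also have "\<dots> \<le> (\<integral>x. B \<partial>M)" using gi g(2) by (intro integral_mono_AE AE_I2) auto
    finally show ?thesis by (simp add: prob_space)
  qed
  have "(\<integral>x. f x * g x \<partial>M) - (\<integral>x. f x \<partial>M) * (\<integral>x. g x \<partial>M)
      = (\<integral>x. (f x - a) * g x \<partial>M) - (\<integral>x. f x - a \<partial>M) * (\<integral>x. g x \<partial>M)"
    using fi gi fgi by (simp add: left_diff_distrib prob_space)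
  also have "\<bar>\<dots>\<bar> \<le> \<bar>\<integral>x. (f x - a) * g x \<partial>M\<bar> + \<bar>\<integral>x. f x - a \<partial>M\<bar> * \<bar>\<integral>x. g x \<partial>M\<bar>"
    by (rule order_trans[OF abs_triangle_ineq4]) (simp only: abs_mult order_refl)
  also have "\<dots> \<le> B * (\<integral>x. \<bar>f x - a\<bar> \<partial>M) + (\<integral>x. \<bar>f x - a\<bar> \<partial>M) * B"
  proof (intro add_mono mult_mono)
    have "\<bar>\<integral>x. (f x - a) * g x \<partial>M\<bar> \<le> (\<integral>x. \<bar>(f x - a) * g x\<bar> \<partial>M)" by (rule integral_abs_bound)
    also have "\<dots> \<le> (\<integral>x. B * \<bar>f x - a\<bar> \<partial>M)"
    proof (intro integral_mono_AE AE_I2)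
      show "\<bar>(f x - a) * g x\<bar> \<le> B * \<bar>f x - a\<bar>" if "x \<in> space M" for x
        unfolding abs_mult mult.commute[of B] by (intro mult_left_mono g(2)[OF that]) simp
    qed (use hgi hi in auto)
    finally show "\<bar>\<integral>x. (f x - a) * g x \<partial>M\<bar> \<le> B * (\<integral>x. \<bar>f x - a\<bar> \<partial>M)" by simp
    show "\<bar>\<integral>x. f x - a \<partial>M\<bar> \<le> (\<integral>x. \<bar>f x - a\<bar> \<partial>M)" by (rule integral_abs_bound)
  qed (use G in auto)
  finally show ?thesis by simp
qed

lemma smallo_if_le_smallo_factor:
  fixes f :: "real \<Rightarrow> real"
  assumes le: "\<And>t. 1 \<le> t \<Longrightarrow> \<bar>f t\<bar> * t powr r \<le> h t" and h: "(h \<longlongrightarrow> 0) at_top"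
  shows "f \<in> o[at_top](\<lambda>t. 1 / t powr r)"
proof (rule smalloI_tendsto)
  have "eventually (\<lambda>t. norm (f t / (1 / t powr r)) \<le> h t) at_top"
    using eventually_ge_at_top[of 1] by eventually_elim (use le in \<open>simp add: abs_mult\<close>)
  then show "((\<lambda>t. f t / (1 / t powr r)) \<longlongrightarrow> 0) at_top" using h by (rule Lim_null_comparison)
  show "eventually (\<lambda>t. 1 / t powr r \<noteq> 0) at_top"
    using eventually_gt_at_top[of 0] by eventually_elim simp
qed

theorem theorem4:
  fixes E \<gamma> :: real
    and \<mu> :: "'m::finite state measure"
    and \<xi> \<zeta> :: "'m state \<Rightarrow> real"
  assumes "E > 0"
    and "\<gamma> > 0"
    and "\<mu> \<in> moment_class E (\<gamma> / 8)"
    and "\<xi> \<in> bounded_measurable E"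
    and "\<zeta> \<in> bounded_measurable E"
  shows "(\<lambda>t. \<bar>(\<integral>z. semigroup_op E t \<zeta> z * \<xi> z \<partial>\<mu>)
               - (\<integral>z. semigroup_op E t \<zeta> z \<partial>\<mu>) * (\<integral>z. \<xi> z \<partial>\<mu>)\<bar>)
         \<in> o[at_top](\<lambda>t. 1 / t powr (2 - \<gamma>))"
proof -
  note E = \<open>E > 0\<close> and \<gamma> = \<open>\<gamma> > 0\<close>
  let ?S = "energy_simplex E :: 'm state set"
  have sets_\<mu>[measurable_cong]: "sets \<mu> = sets (state_space E)" and "prob_space \<mu>"
    and moment: "(\<integral>\<^sup>+ (x, y). ennreal ((\<Sum>k\<in>UNIV. (x $ k) powr (2 * (\<gamma> / 8) - 1)) + y powr (\<gamma> / 8 - 1 / 2)) \<partial>\<mu>) < \<infinity>"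
    using assms(3) by (auto simp: moment_class_def)
  interpret \<mu>: prob_space \<mu> by fact
  have space_\<mu>: "space \<mu> = ?S" using sets_eq_imp_space_eq[OF sets_\<mu>] by simp
  have meas_\<mu>: "f \<in> borel_measurable \<mu>" if "f \<in> borel_measurable (state_space E)" for f :: "'m state \<Rightarrow> real"
    using that measurable_cong_sets[OF sets_\<mu> refl] by blast
  obtain z0 where z0: "z0 \<in> ?S" using \<mu>.not_empty space_\<mu> by auto
  obtain M where \<zeta>: "\<zeta> \<in> borel_measurable (state_space E)" and M: "\<And>w. w \<in> ?S \<Longrightarrow> \<bar>\<zeta> w\<bar> \<le> M"
    using assms(5) by (auto simp: bounded_measurable_def bounded_iff)
  obtain B where \<xi>: "\<xi> \<in> borel_measurable (state_space E)" and B: "\<And>w. w \<in> ?S \<Longrightarrow> \<bar>\<xi> w\<bar> \<le> B"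
    using assms(4) by (auto simp: bounded_measurable_def bounded_iff)
  have M0: "0 \<le> M" and B0: "0 \<le> B" using M[OF z0] B[OF z0] by linarith+
  define F where "F t z = uniformised E \<zeta> t z" for t z
  have F_meas: "F t \<in> borel_measurable \<mu>" for t
    unfolding F_def[abs_def] by (rule meas_\<mu>[OF measurable_uniformised[OF E \<zeta> M]])
  have F_bound: "\<bar>F t z\<bar> \<le> M" if "z \<in> ?S" "0 \<le> t" for t z
    unfolding F_def by (rule uniformised_bound[OF E \<zeta> M that])
  define cov where "cov t = \<bar>(\<integral>z. semigroup_op E t \<zeta> z * \<xi> z \<partial>\<mu>) - (\<integral>z. semigroup_op E t \<zeta> z \<partial>\<mu>) * (\<integral>z. \<xi> z \<partial>\<mu>)\<bar>" for t
  have cov_le: "\<bar>cov t\<bar> \<le> 2 * B * (\<integral>z. \<bar>F t z - F t z0\<bar> \<partial>\<mu>)" if t: "0 \<le> t" for t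
  proof -
    have eq: "semigroup_op E t \<zeta> z = F t z" if "z \<in> space \<mu>" for z
      using semigroup_op_eq_uniformised[OF E \<zeta> M _ t] that by (simp add: F_def space_\<mu>)
    have "cov t = \<bar>(\<integral>z. F t z * \<xi> z \<partial>\<mu>) - (\<integral>z. F t z \<partial>\<mu>) * (\<integral>z. \<xi> z \<partial>\<mu>)\<bar>"
      unfolding cov_def using eq by (simp cong: Bochner_Integration.integral_cong)
    then show ?thesis
      using \<mu>.abs_covariance_le[OF F_meas _ meas_\<mu>[OF \<xi>], of t M B "F t z0"] F_bound[OF _ t] B by (simp add: space_\<mu>)
  qed
  have int_diff: "integrable \<mu> (\<lambda>z. \<bar>F t z - F t z0\<bar>)" if "0 \<le> t" for t
    using F_meas[of t] F_bound[OF _ that] z0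
    by (intro integrable_abs Bochner_Integration.integrable_diff \<mu>.integrable_const_bound[of _ M] AE_I2) (auto simp: space_\<mu>)
  show ?thesis
  proof (cases "\<gamma> < 2")
    case True
    \<comment> \<open>The weight for this \<open>\<delta>\<close> is integrable, and the exponent exceeds the required one by \<open>\<gamma> / 2\<close>.\<close>
    define \<delta> where "\<delta> = \<gamma> / 8"
    have \<delta>: "0 < \<delta>" "\<delta> < 1 / 4" using True \<gamma> by (auto simp: \<delta>_def)
    obtain C where C: "0 \<le> C" and decay: "\<forall>(\<zeta> :: 'm state \<Rightarrow> real) M t z z'. \<zeta> \<in> borel_measurable (state_space E) \<longrightarrow>
      (\<forall>w\<in>energy_simplex E. \<bar>\<zeta> w\<bar> \<le> M) \<longrightarrow> z \<in> energy_simplex E \<longrightarrow> z' \<in> energy_simplex E \<longrightarrow> 0 < t \<longrightarrow>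
      \<bar>uniformised E \<zeta> t z - uniformised E \<zeta> t z'\<bar>
        \<le> M * C * (1 + weight \<delta> z + weight \<delta> z') * t powr - (2 - 4 * \<delta>)"
      using uniformised_difference_decay[OF E \<delta>, where 'm='m] by (elim exE conjE)
    let ?V = "weight \<delta> :: 'm state \<Rightarrow> real"
    have V: "integrable \<mu> ?V"
    proof (rule integrableI_nonneg)
      show "(\<integral>\<^sup>+z. ennreal (?V z) \<partial>\<mu>) < \<infinity>"
        using moment by (simp add: weight_def \<delta>_def case_prod_unfold)
    qed (auto intro: meas_\<mu> weight_nonneg)
    define K where "K = 2 * B * (M * C * (1 + (\<integral>z. ?V z \<partial>\<mu>) + ?V z0))"
    have "\<bar>cov t\<bar> * t powr (2 - \<gamma>) \<le> K * t powr - (\<gamma> / 2)" if t: "1 \<le> t" for t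
    proof -
      have "(\<integral>z. \<bar>F t z - F t z0\<bar> \<partial>\<mu>) \<le> (\<integral>z. M * C * (1 + ?V z + ?V z0) * t powr - (2 - 4 * \<delta>) \<partial>\<mu>)"
        using decay[rule_format, OF \<zeta> _ _ z0, of M] M t V z0 int_diff[of t]
        by (intro integral_mono_AE AE_I2) (auto simp: F_def space_\<mu>)
      also have "\<dots> = M * C * (1 + (\<integral>z. ?V z \<partial>\<mu>) + ?V z0) * t powr - (2 - 4 * \<delta>)"
        using V by (simp add: \<mu>.prob_space)
      finally have "2 * B * (\<integral>z. \<bar>F t z - F t z0\<bar> \<partial>\<mu>) \<le> 2 * B * (M * C * (1 + (\<integral>z. ?V z \<partial>\<mu>) + ?V z0) * t powr - (2 - 4 * \<delta>))"
        using B0 by (intro mult_left_mono) auto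
      then have "\<bar>cov t\<bar> \<le> K * t powr - (2 - 4 * \<delta>)"
        using cov_le[of t] t by (simp add: K_def mult.assoc)
      then have "\<bar>cov t\<bar> * t powr (2 - \<gamma>) \<le> K * t powr - (2 - 4 * \<delta>) * t powr (2 - \<gamma>)"
        by (rule mult_right_mono) simp
      also have "\<dots> = K * t powr - (\<gamma> / 2)"
        by (simp add: mult.assoc powr_add[symmetric] \<delta>_def)
      finally show ?thesis .
    qed
    moreover have "((\<lambda>t. K * t powr - (\<gamma> / 2)) \<longlongrightarrow> K * 0) at_top"
      using \<gamma> by (intro tendsto_mult_left tendsto_neg_powr filterlim_ident) auto
    ultimately have "cov \<in> o[at_top](\<lambda>t. 1 / t powr (2 - \<gamma>))"
      by (intro smallo_if_le_smallo_factor) auto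
    then show ?thesis by (simp add: cov_def[abs_def])
  next
    case False
    \<comment> \<open>The weight for \<open>\<delta> = 1 / 8\<close> may fail to be integrable, but it is finite at every state.\<close>
    obtain C where C: "0 \<le> C" and decay: "\<forall>(\<zeta> :: 'm state \<Rightarrow> real) M t z z'. \<zeta> \<in> borel_measurable (state_space E) \<longrightarrow>
      (\<forall>w\<in>energy_simplex E. \<bar>\<zeta> w\<bar> \<le> M) \<longrightarrow> z \<in> energy_simplex E \<longrightarrow> z' \<in> energy_simplex E \<longrightarrow> 0 < t \<longrightarrow>
      \<bar>uniformised E \<zeta> t z - uniformised E \<zeta> t z'\<bar>
        \<le> M * C * (1 + weight (1 / 8) z + weight (1 / 8) z') * t powr - (2 - 4 * (1 / 8))"
      using uniformised_difference_decay[OF E, of "1 / 8", where 'm='m] by auto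
    have pointwise: "((\<lambda>t. \<bar>F t z - F t z0\<bar>) \<longlongrightarrow> 0) at_top" if z: "z \<in> ?S" for z
    proof (rule Lim_null_comparison)
      define K where "K = M * C * (1 + weight (1 / 8) z + weight (1 / 8) z0)"
      show "eventually (\<lambda>t. norm \<bar>F t z - F t z0\<bar> \<le> K * t powr - (2 - 4 * (1 / 8))) at_top"
        using eventually_gt_at_top[of 0]
        by eventually_elim (use decay[rule_format, OF \<zeta> _ z z0, of M] M in \<open>simp add: F_def K_def\<close>)
      have "((\<lambda>t. K * t powr - (2 - 4 * (1 / 8))) \<longlongrightarrow> K * 0) at_top"
        by (intro tendsto_mult_left tendsto_neg_powr filterlim_ident) auto
      then show "((\<lambda>t. K * t powr - (2 - 4 * (1 / 8))) \<longlongrightarrow> 0) at_top" by simp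
    qed
    have "((\<lambda>t. \<integral>z. \<bar>F t z - F t z0\<bar> \<partial>\<mu>) \<longlongrightarrow> (\<integral>z. 0 \<partial>\<mu>)) at_top"
    proof (rule integral_dominated_convergence_at_top)
      show "eventually (\<lambda>t. AE z in \<mu>. norm \<bar>F t z - F t z0\<bar> \<le> 2 * M) at_top"
        using eventually_ge_at_top[of 0]
      proof eventually_elim
        case (elim t)
        have "norm \<bar>F t z - F t z0\<bar> \<le> 2 * M" if "z \<in> ?S" for z
          using F_bound[OF that elim] F_bound[OF z0 elim] by simp
        then show ?case by (intro AE_I2) (simp add: space_\<mu>)
      qed
    qed (use F_meas pointwise space_\<mu> in auto)
    then have "((\<lambda>t. 2 * B * (\<integral>z. \<bar>F t z - F t z0\<bar> \<partial>\<mu>)) \<longlongrightarrow> 2 * B * (\<integral>z. 0 \<partial>\<mu>)) at_top"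
      by (rule tendsto_mult_left)
    moreover have "\<bar>cov t\<bar> * t powr (2 - \<gamma>) \<le> 2 * B * (\<integral>z. \<bar>F t z - F t z0\<bar> \<partial>\<mu>)" if t: "1 \<le> t" for t
    proof -
      have "t powr (2 - \<gamma>) \<le> 1" using powr_mono[of "2 - \<gamma>" 0 t] False t by simp
      then have "\<bar>cov t\<bar> * t powr (2 - \<gamma>) \<le> \<bar>cov t\<bar>" by (intro mult_left_le) auto
      then show ?thesis using cov_le[of t] t by simp
    qed
    ultimately have "cov \<in> o[at_top](\<lambda>t. 1 / t powr (2 - \<gamma>))"
      by (intro smallo_if_le_smallo_factor) auto
    then show ?thesis by (simp add: cov_def[abs_def])
  qed
qed

end
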